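(* Let $n\ge 2$, $\ell>0$, and let $\alpha\colon[0,\ell]\to(0,\infty)$ be of bounded variation with $1/\alpha$ bounded. Fix $a_1,a_2\in\mathbb{R}^n$ and $T_1,T_2\in S^{n-1}$. Suppose that $\gamma\in\mathcal{G}$, and let $T=\gamma'$ and $k=\mathcal{K}_\alpha(\gamma)$. Then $\gamma$ is an $\infty$-elastica if, and only if, there exist $\lambda\in S^{n-1}$ and $g\in W^{1,\infty}(0,\ell)\setminus\{0\}$ with $g\ge 0$ such that the equations \[ g\bigl((\alpha T')'+k^2T/\alpha\bigr)=k^2\,\mathrm{proj}^\perp_{T,T'}(\lambda),\qquad g'=\alpha\,\lambda\cdot T' \] hold weakly in $(0,\ell)$. Here the first equation holding weakly means \[ \int_0^\ell\Bigl(g\alpha T'\cdot\xi'+g'\alpha T'\cdot\xi-gk^2\alpha^{-1}T\cdot\xi+k^2\,\mathrm{proj}^\perp_{T,T'}(\lambda)\cdot\xi\Bigr)\,ds=0 \] for all $\xi\in C_0^\infty((0,\ell);\mathbb{R}^n)$.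
   Context: $S^{n-1}=\{x\in\mathbb{R}^n:|x|=1\}$. $\mathcal{G}$ denotes the set of all $\gamma\in W^{2,\infty}((0,\ell);\mathbb{R}^n)$ with $|\gamma'|\equiv1$ on $[0,\ell]$ satisfying the boundary conditions $\gamma(0)=a_1$, $\gamma(\ell)=a_2$, $\gamma'(0)=T_1$, $\gamma'(\ell)=T_2$. For $\gamma\in\mathcal{G}$, $\mathcal{K}_\alpha(\gamma)=\operatorname{ess\,sup}_{[0,\ell]}\alpha|\gamma''|$. A curve $\gamma\in\mathcal{G}$ is an $\infty$-elastica if there exists $M\in\mathbb{R}$ such that for every $\tilde\gamma\in\mathcal{G}$, $\mathcal{K}_\alpha(\gamma)\le\mathcal{K}_\alpha(\tilde\gamma)+\frac M2\int_0^\ell|\tilde\gamma'-\gamma'|^2\,ds$. For $V,W\in\mathbb{R}^n$, $\mathrm{proj}^\perp_{V,W}$ denotes the orthogonal projection onto the orthogonal complement of the linear span of $V$ and $W$. *)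

theory Defs
  imports "HOL-Analysis.Analysis" "HOL-Probability.Essential_Supremum"
begin

text \<open>Functions on [0,l] are represented as total functions real => _; only the
values on {0..l} matter.\<close>

text \<open>Derivative of a function on [0,l] (one-sided at the endpoints). For a Lipschitz
function this is the a.e. (equivalently, weak) derivative.\<close>
definition Dl :: "real \<Rightarrow> (real \<Rightarrow> 'a::real_normed_vector) \<Rightarrow> real \<Rightarrow> 'a" where
  "Dl l f s = vector_derivative f (at s within {0..l})"

text \<open>W^{1,infty}(0,l), identified with its Lipschitz continuous representative.\<close>
definition W1inf :: "real \<Rightarrow> (real \<Rightarrow> 'a::real_normed_vector) \<Rightarrow> bool" where
  "W1inf l f \<longleftrightarrow> (\<exists>C. C-lipschitz_on {0..l} f)"

definition W2inf :: "real \<Rightarrow> (real \<Rightarrow> 'a::real_normed_vector) \<Rightarrow> bool" where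
  "W2inf l f \<longleftrightarrow> (\<exists>T. (\<forall>s\<in>{0..l}. (f has_vector_derivative T s) (at s within {0..l}))
                      \<and> W1inf l T)"

definition admissible ::
  "real \<Rightarrow> real^'n \<Rightarrow> real^'n \<Rightarrow> real^'n \<Rightarrow> real^'n \<Rightarrow> (real \<Rightarrow> real^'n) \<Rightarrow> bool" where
  "admissible l a1 a2 T1 T2 \<gamma> \<longleftrightarrow>
     W2inf l \<gamma> \<and> (\<forall>s\<in>{0..l}. norm (Dl l \<gamma> s) = 1) \<and>
     \<gamma> 0 = a1 \<and> \<gamma> l = a2 \<and> Dl l \<gamma> 0 = T1 \<and> Dl l \<gamma> l = T2"

definition Kalpha :: "real \<Rightarrow> (real \<Rightarrow> real) \<Rightarrow> (real \<Rightarrow> real^'n) \<Rightarrow> real" where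
  "Kalpha l \<alpha> \<gamma> = real_of_ereal
     (esssup (lebesgue_on {0..l}) (\<lambda>s. ereal (\<alpha> s * norm (Dl l (Dl l \<gamma>) s))))"

definition inf_elastica ::
  "real \<Rightarrow> (real \<Rightarrow> real) \<Rightarrow> real^'n \<Rightarrow> real^'n \<Rightarrow> real^'n \<Rightarrow> real^'n \<Rightarrow> (real \<Rightarrow> real^'n) \<Rightarrow> bool" where
  "inf_elastica l \<alpha> a1 a2 T1 T2 \<gamma> \<longleftrightarrow> admissible l a1 a2 T1 T2 \<gamma> \<and>
     (\<exists>M::real. \<forall>\<gamma>'. admissible l a1 a2 T1 T2 \<gamma>' \<longrightarrow>
        Kalpha l \<alpha> \<gamma> \<le> Kalpha l \<alpha> \<gamma>' +
          M / 2 * integral {0..l} (\<lambda>s. (norm (Dl l \<gamma>' s - Dl l \<gamma> s))\<^sup>2))"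

definition total_variation :: "(real \<Rightarrow> real) \<Rightarrow> real \<Rightarrow> real \<Rightarrow> ereal" where
  "total_variation f a b = (SUP (m, t) \<in> {(m::nat, t::nat \<Rightarrow> real).
        t 0 = a \<and> t m = b \<and> (\<forall>i<m. t i \<le> t (Suc i))}.
        ereal (\<Sum>i<m. \<bar>f (t (Suc i)) - f (t i)\<bar>))"

definition bounded_variation_on :: "(real \<Rightarrow> real) \<Rightarrow> real \<Rightarrow> real \<Rightarrow> bool" where
  "bounded_variation_on f a b \<longleftrightarrow> total_variation f a b < \<infinity>"

definition smooth :: "(real \<Rightarrow> 'a::real_normed_vector) \<Rightarrow> bool" where
  "smooth f \<longleftrightarrow> (\<exists>Ds::nat \<Rightarrow> real \<Rightarrow> 'a. Ds 0 = f \<and>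
      (\<forall>k s. (Ds k has_vector_derivative Ds (Suc k) s) (at s)))"

definition test_fun :: "real \<Rightarrow> (real \<Rightarrow> 'a::real_normed_vector) \<Rightarrow> bool" where
  "test_fun l f \<longleftrightarrow> smooth f \<and> (\<exists>a b. 0 < a \<and> b < l \<and> (\<forall>s. s \<notin> {a..b} \<longrightarrow> f s = 0))"

definition proj_perp :: "'a::euclidean_space \<Rightarrow> 'a \<Rightarrow> 'a \<Rightarrow> 'a" where
  "proj_perp V W x = (let U = {u. \<forall>z\<in>span {V, W}. u \<bullet> z = 0} in
     (THE p. p \<in> U \<and> (\<forall>u\<in>U. (x - p) \<bullet> u = 0)))"

end

theory Submission
  imports Defs "HOL-Probability.Distribution_Functions"
begin

text \<open>Write \<open>T = \<gamma>'\<close> and \<open>k\<close> for the value of the functional at \<open>\<gamma>\<close>.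
The weak system says that \<open>V = g \<alpha> T'\<close> is Lipschitz, and it forces \<open>g (\<alpha> |T'| - k) = 0\<close> and
\<open>V' = k\<^sup>2 (\<lambda> - (\<lambda> \<bullet> T) T) - g k\<^sup>2 T / \<alpha>\<close>. Pairing V with the derivative of a competing tangent and
integrating by parts gives the defining inequality of an \<open>\<infinity>\<close>-elastica.

Conversely, vary T by \<open>(I + e A) T\<close>, normalised, with A a Lipschitz curve of skew matrices and
\<open>\<alpha> |T' + A' T| \<le> k' < k\<close>: this lowers the functional at first order in e, whereas the penalty
\<open>\<integral> |\<tau> - T|\<^sup>2\<close> is of second order. If the convex set of linearised endpoint displacements had 0 in its
interior, Brouwer's fixed point theorem would produce an exact competitor, which is impossible. A
hyperplane supporting this finite-dimensional set at 0 is the multiplier: it defines a skew matrix curve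
that must be of the form \<open>q \<and> T\<close>, the pointwise maximum principle reads \<open>|q| \<alpha> T' = - k q\<close>, and g is a
constant multiple of \<open>|q|\<close> unless \<open>\<lambda> = 0\<close>, in which case the curve is planar.

Differentiability almost everywhere of Lipschitz functions comes from the Vitali covering theorem.\<close>

section \<open>Differentiability of Lipschitz functions\<close>

text \<open>The essential supremum is convex but not differentiable, so no multiplier arises from a
  stationarity equation; convexity has to supply it. Rotation generators are chosen as variations
  because the first-order curvature bound is then a pointwise convex condition on
  \<open>A' T\<close>, while the remaining contribution \<open>A T'\<close> is orthogonal to
  \<open>T'\<close> and enters only at second order. The endpoint conditions are finite in number,
  so the separation takes place in dimension 2n and no duality for bounded functions is needed.
  Brouwer's theorem replaces an inverse function theorem, since all that is established about the
  nonlinear endpoint map is its continuity and a quadratic distance to its linear part. Two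
  degenerate situations are treated apart: zeros of g, where nothing can be divided by g but
  minimality makes the first derivatives vanish, and k = 0, where T is constant and both sides of
  the equivalence hold.\<close>

text \<open>Vitali's theorem picks countably many disjoint intervals of slope at most p that cover
  \<open>E\<close> up to a null set. Their images are disjoint intervals with total length at most p
  times the measure of an open neighbourhood of \<open>E\<close>, and the null remainder stays null
  because \<open>F\<close> is Lipschitz.\<close>

lemma emeasure_image_le_of_fine_slopes:
  fixes F :: "real \<Rightarrow> real"
  assumes sm: "strict_mono F" and lip: "K-lipschitz_on UNIV F" and p: "0 \<le> p"
    and E: "E \<in> sets lborel" and FE: "F ` E \<in> sets lborel"
    and fine: "\<And>x d. x \<in> E \<Longrightarrow> 0 < d \<Longrightarrow> \<exists>u v. u < x \<and> x < v \<and> v - u < d \<and> F v - F u \<le> p * (v - u)"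
  shows "emeasure lborel (F ` E) \<le> ennreal p * emeasure lborel E"
proof -
  have main: "emeasure lborel (F ` E) \<le> ennreal p * (emeasure lborel E + ennreal e)" if e: "e > 0" for e
  proof -
    obtain U where U: "open U" "E \<subseteq> U" "emeasure lborel (U - E) < ennreal e"
      using outer_regular_lborel[of E e] E e by auto
    define I where "I = {(u, v). u < v \<and> {u..v} \<subseteq> U \<and> F v - F u \<le> p * (v - u)}"
    define a where "a = (\<lambda>(u::real, v). (u + v) / 2)"
    define r where "r = (\<lambda>(u::real, v). (v - u) / 2)"
    have cb: "cball (a i) (r i) = {fst i..snd i}" for i
      by (cases i) (auto simp: a_def r_def cball_eq_atLeastAtMost field_simps)
    have ri: "0 < r i" if "i \<in> I" for i using that by (auto simp: I_def r_def)
    have S: "\<exists>i. i \<in> I \<and> x \<in> cball (a i) (r i) \<and> r i < d" if xE: "x \<in> E" and d0: "0 < d" for x d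
    proof -
      have "x \<in> U" using U xE by blast
      then obtain h where h: "h > 0" "ball x h \<subseteq> U" using U(1) openE by blast
      obtain u v where uv: "u < x" "x < v" "v - u < min d h" "F v - F u \<le> p * (v - u)"
        using fine[OF xE, of "min d h"] h(1) d0 by auto
      have "{u..v} \<subseteq> ball x h" using uv by (auto simp: dist_real_def)
      then have "(u, v) \<in> I" using uv h by (auto simp: I_def)
      then show ?thesis using uv unfolding cb by (intro exI[of _ "(u,v)"]) (auto simp: r_def)
    qed
    obtain C where C: "countable C" "C \<subseteq> I"
      "pairwise (\<lambda>i j. disjnt (cball (a i) (r i)) (cball (a j) (r j))) C"
      "negligible (E - (\<Union>i \<in> C. cball (a i) (r i)))"
      using Vitali_covering_theorem_cballs[of I r E a, OF ri S] by blast
    define N where "N = E - (\<Union>i \<in> C. {fst i..snd i})"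
    have N: "negligible N" using C(4) unfolding N_def cb .
    have Nb: "N \<in> sets borel" using E C(1) unfolding N_def by (auto intro!: sets.countable_UN')
    have FN: "negligible (F ` N)"
    proof (rule negligible_locally_Lipschitz_image[OF _ N])
      fix x assume "x \<in> N"
      have "norm (F y - F x) \<le> K * norm (y - x)" for y
        using lipschitz_onD[OF lip UNIV_I UNIV_I, of y x] by (simp add: dist_norm)
      then show "\<exists>T B. open T \<and> x \<in> T \<and> (\<forall>y\<in>N \<inter> T. norm (F y - F x) \<le> B * norm (y - x))"
        by (intro exI[of _ UNIV] exI[of _ K]) simp
    qed simp
    have nFN: "F ` N \<in> null_sets lebesgue" using FN negligible_iff_null_sets by blast
    have dis1: "disjoint_family_on (\<lambda>i. {fst i..snd i}) C"
      using C(3) unfolding cb by (auto simp: disjoint_family_on_def pairwise_def disjnt_def)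
    have lt: "fst i < snd i" if "i \<in> C" for i using that C(2) by (auto simp: I_def)
    have dis2: "disjoint_family_on (\<lambda>i. {F (fst i)..F (snd i)}) C"
      unfolding disjoint_family_on_def
    proof (intro ballI impI)
      fix i j assume ij: "i \<in> C" "j \<in> C" "i \<noteq> j"
      then have "{fst i..snd i} \<inter> {fst j..snd j} = {}" using dis1 by (auto simp: disjoint_family_on_def)
      then have "snd i < fst j \<or> snd j < fst i" using lt[OF ij(1)] lt[OF ij(2)]
        by (smt (verit, best) IntI atLeastAtMost_iff empty_iff)
      then show "{F (fst i)..F (snd i)} \<inter> {F (fst j)..F (snd j)} = {}"
        using strict_monoD[OF sm] by force
    qed
    have sub: "F ` E \<subseteq> F ` N \<union> (\<Union>i\<in>C. {F (fst i)..F (snd i)})"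
    proof
      fix y assume "y \<in> F ` E"
      then obtain x where x: "x \<in> E" "y = F x" by blast
      show "y \<in> F ` N \<union> (\<Union>i\<in>C. {F (fst i)..F (snd i)})"
      proof (cases "x \<in> N")
        case False
        then obtain i where "i \<in> C" "fst i \<le> x" "x \<le> snd i" using x(1) by (auto simp: N_def)
        then show ?thesis using x(2) strict_mono_less_eq[OF sm] by auto
      qed (use x in auto)
    qed
    have UNs: "(\<Union>i\<in>C. {F (fst i)..F (snd i)}) \<in> sets borel"
      using C(1) by (auto intro!: sets.countable_UN')
    have "emeasure lborel (F ` E) = emeasure lebesgue (F ` E)" using FE by simp
    also have "\<dots> \<le> emeasure lebesgue (F ` N \<union> (\<Union>i\<in>C. {F (fst i)..F (snd i)}))"
      using nFN UNs by (intro emeasure_mono[OF sub]) auto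
    also have "\<dots> \<le> emeasure lebesgue (F ` N) + emeasure lebesgue (\<Union>i\<in>C. {F (fst i)..F (snd i)})"
      using nFN UNs by (intro emeasure_subadditive) auto
    also have "\<dots> = emeasure lborel (\<Union>i\<in>C. {F (fst i)..F (snd i)})"
      using nFN UNs by (auto simp: null_setsD1)
    also have "\<dots> = (\<integral>\<^sup>+i. emeasure lborel {F (fst i)..F (snd i)} \<partial>count_space C)"
      using C(1) dis2 by (intro emeasure_UN_countable) auto
    also have "\<dots> \<le> (\<integral>\<^sup>+i. ennreal p * emeasure lborel {fst i..snd i} \<partial>count_space C)"
    proof (rule nn_integral_mono)
      fix i assume "i \<in> space (count_space C)"
      then have i: "i \<in> C" by simp
      have "F (snd i) - F (fst i) \<le> p * (snd i - fst i)" using i C(2) by (auto simp: I_def)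
      moreover have "F (fst i) \<le> F (snd i)" using lt[OF i] strict_monoD[OF sm] by (simp add: less_imp_le)
      ultimately show "emeasure lborel {F (fst i)..F (snd i)} \<le> ennreal p * emeasure lborel {fst i..snd i}"
        using lt[OF i] p by (auto simp: ennreal_mult[symmetric] intro!: ennreal_leI)
    qed
    also have "\<dots> = ennreal p * (\<integral>\<^sup>+i. emeasure lborel {fst i..snd i} \<partial>count_space C)"
      by (rule nn_integral_cmult) simp
    also have "(\<integral>\<^sup>+i. emeasure lborel {fst i..snd i} \<partial>count_space C) = emeasure lborel (\<Union>i\<in>C. {fst i..snd i})"
      using C(1) dis1 by (intro emeasure_UN_countable[symmetric]) auto
    also have "\<dots> \<le> emeasure lborel U"
    proof (rule emeasure_mono)
      have "{fst i..snd i} \<subseteq> U" if "i \<in> C" for i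
        using subsetD[OF C(2) that] by (auto simp: I_def split: prod.splits)
      then show "(\<Union>i\<in>C. {fst i..snd i}) \<subseteq> U" by blast
    qed (use U(1) in auto)
    also have "\<dots> = emeasure lborel E + emeasure lborel (U - E)"
      using U(1,2) E by (subst plus_emeasure) (auto simp: Un_absorb1)
    also have "\<dots> \<le> emeasure lborel E + ennreal e" using U(3) by (intro add_left_mono) auto
    finally show ?thesis by (simp add: mult_left_mono)
  qed
  show ?thesis
  proof (rule ennreal_le_epsilon)
    fix e :: real assume "e > 0"
    \<comment> \<open>The denominator p + 1 makes \<open>p * e' \<le> e\<close> hold also for p =
      0.\<close>
    define e' where "e' = e / (p + 1)"
    have e': "e' > 0" "p * e' \<le> e" using p \<open>e > 0\<close> by (auto simp: e'_def field_simps)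
    have "emeasure lborel (F ` E) \<le> ennreal p * emeasure lborel E + ennreal (p * e')"
      using main[OF e'(1)] p e'(1) by (simp add: distrib_left ennreal_mult)
    also have "\<dots> \<le> ennreal p * emeasure lborel E + ennreal e"
      using e'(2) by (intro add_left_mono ennreal_leI)
    finally show "emeasure lborel (F ` E) \<le> ennreal p * emeasure lborel E + ennreal e" .
  qed
qed

text \<open>At every point of the exceptional set, straddling intervals of slope at most p force
  |F(E)| \<le> p |E|, and slopes at least q force |E| \<le> |F(E)| / q, the same estimate for the inverse of F.\<close>
lemma bilipschitz_oscillation_null:
  fixes F :: "real \<Rightarrow> real"
  assumes lo: "\<And>u v. u \<le> v \<Longrightarrow> v - u \<le> F v - F u"
    and up: "\<And>u v. u \<le> v \<Longrightarrow> F v - F u \<le> K * (v - u)"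
    and pq: "0 < p" "p < q"
  shows "{x. (\<forall>d>0. \<exists>u v. u < x \<and> x < v \<and> v - u < d \<and> F v - F u < p * (v - u)) \<and>
             (\<forall>d>0. \<exists>u v. u < x \<and> x < v \<and> v - u < d \<and> F v - F u > q * (v - u))} \<in> null_sets lborel"
    (is "?E \<in> _")
proof -
  \<comment> \<open>Points straddled at every scale by an interval with property \<open>R\<close>
    form a countable intersection of the open sets \<open>A R d\<close>, which makes the exceptional
    set Borel.\<close>
  define A where "A R d = (\<Union>(u,v)\<in>{(u,v). v - u < (d::real) \<and> R u v}. {u<..<v::real})" for R d
  have opA: "open (A R d)" for R d unfolding A_def by (auto intro!: open_UN)
  have Aeq: "{x. \<forall>d>0. \<exists>u v. u < x \<and> x < v \<and> v - u < d \<and> R u v} = (\<Inter>n. A R (inverse (real (Suc n))))" for R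
  proof (intro equalityI subsetI)
    fix x assume "x \<in> {x. \<forall>d>0. \<exists>u v. u < x \<and> x < v \<and> v - u < d \<and> R u v}"
    then have *: "\<exists>u v. u < x \<and> x < v \<and> v - u < d \<and> R u v" if "d > 0" for d using that by blast
    show "x \<in> (\<Inter>n. A R (inverse (real (Suc n))))"
    proof
      fix n show "x \<in> A R (inverse (real (Suc n)))" using *[of "inverse (real (Suc n))"] by (fastforce simp: A_def)
    qed
  next
    fix x assume x: "x \<in> (\<Inter>n. A R (inverse (real (Suc n))))"
    show "x \<in> {x. \<forall>d>0. \<exists>u v. u < x \<and> x < v \<and> v - u < d \<and> R u v}"
    proof (intro CollectI allI impI)
      fix d :: real assume "d > 0"
      then obtain n where n: "inverse (real (Suc n)) < d" using reals_Archimedean by blast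
      from x have "x \<in> A R (inverse (real (Suc n)))" by blast
      then show "\<exists>u v. u < x \<and> x < v \<and> v - u < d \<and> R u v" using n unfolding A_def by fastforce
    qed
  qed
  have Eb: "?E \<in> sets borel"
  proof -
    have "?E = {x. \<forall>d>0. \<exists>u v. u < x \<and> x < v \<and> v - u < d \<and> F v - F u < p * (v - u)} \<inter>
      {x. \<forall>d>0. \<exists>u v. u < x \<and> x < v \<and> v - u < d \<and> F v - F u > q * (v - u)}" by blast
    also have "\<dots> \<in> sets borel"
      unfolding Aeq[of "\<lambda>u v. F v - F u < p * (v - u)"] Aeq[of "\<lambda>u v. F v - F u > q * (v - u)"] using opA by auto
    finally show ?thesis .
  qed
  have smF: "strict_mono F"
    by (rule strict_monoI) (use lo in \<open>smt (verit)\<close>)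
  have K1: "K \<ge> 1" using lo[of 0 1] up[of 0 1] by simp
  have lipF: "K-lipschitz_on UNIV F"
  proof (rule lipschitz_onI)
    fix x y :: real
    show "dist (F x) (F y) \<le> K * dist x y"
      using lo[of x y] up[of x y] lo[of y x] up[of y x] by (cases "x \<le> y") (auto simp: dist_real_def abs_if)
  qed (use K1 in auto)
  have contF: "continuous_on UNIV F" using lipF by (rule lipschitz_on_continuous_on)
  have surj: "\<exists>x. F x = y" for y
  proof -
    define m where "m = \<bar>y - F 0\<bar>"
    have "F (-m) \<le> y" "y \<le> F m" using lo[of "-m" 0] lo[of 0 m] by (auto simp: m_def)
    then show ?thesis using IVT'[of F "-m" y m] continuous_on_subset[OF contF] by (auto simp: m_def)
  qed
  define G where "G = inv F"
  have injF: "inj F" using smF by (rule strict_mono_imp_inj_on)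
  have GF: "G (F x) = x" for x using injF by (simp add: G_def)
  have FG: "F (G y) = y" for y unfolding G_def using surj by (metis f_inv_into_f rangeI)
  have smG: "strict_mono G"
    by (rule strict_monoI) (metis FG smF linorder_not_less strict_mono_less_eq)
  have lipG: "1-lipschitz_on UNIV G"
  proof (rule lipschitz_onI)
    fix x y :: real
    show "dist (G x) (G y) \<le> 1 * dist x y"
      using lo[of "G x" "G y"] lo[of "G y" "G x"] FG[of x] FG[of y]
      by (cases "G x \<le> G y") (auto simp: dist_real_def)
  qed auto
  have contG: "continuous_on UNIV G" using lipG by (rule lipschitz_on_continuous_on)
  \<comment> \<open>The final comparison |E| \<le> (p / q) |E| forces |E| = 0 only if |E| is finite,
    hence the bounded windows.\<close>
  have bd: "?E \<inter> {-real m..real m} \<in> null_sets lborel" for m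
  proof -
    define E where "E = ?E \<inter> {-real m..real m}"
    have E: "E \<in> sets lborel" using Eb by (simp add: E_def)
    have "F ` E = G -` E" using FG GF by (auto simp: image_iff) (metis FG)
    then have FE: "F ` E \<in> sets lborel"
      using measurable_sets[OF borel_measurable_continuous_onI[OF contG], of E] E by simp
    have GFE: "G ` (F ` E) = E" by (simp add: image_image GF)
    have 1: "emeasure lborel (F ` E) \<le> ennreal p * emeasure lborel E"
    proof (rule emeasure_image_le_of_fine_slopes[OF smF lipF _ E FE])
      fix x d :: real assume "x \<in> E" "0 < d"
      then have "\<exists>u v. u < x \<and> x < v \<and> v - u < d \<and> F v - F u < p * (v - u)" unfolding E_def by blast
      then show "\<exists>u v. u < x \<and> x < v \<and> v - u < d \<and> F v - F u \<le> p * (v - u)" using less_imp_le by blast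
    qed (use pq in auto)
    have 2: "emeasure lborel (G ` (F ` E)) \<le> ennreal (1 / q) * emeasure lborel (F ` E)"
    proof (rule emeasure_image_le_of_fine_slopes[OF smG lipG _ FE])
      fix y d :: real assume y: "y \<in> F ` E" and d: "0 < d"
      then obtain x where x: "x \<in> E" "y = F x" by blast
      \<comment> \<open>\<open>F\<close> stretches lengths by at most \<open>K\<close>, so an
        interval shorter than d / K has an image shorter than d.\<close>
      have "d / K > 0" using d K1 by simp
      then have "\<exists>u v. u < x \<and> x < v \<and> v - u < d / K \<and> F v - F u > q * (v - u)" using x(1) unfolding E_def by blast
      then obtain u v where uv: "u < x" "x < v" "v - u < d / K" "F v - F u > q * (v - u)" by blast
      have "F v - F u \<le> K * (v - u)" using up uv by simp
      also have "\<dots> < d" using uv(3) K1 by (simp add: field_simps)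
      finally have "F v - F u < d" .
      then show "\<exists>u v. u < y \<and> y < v \<and> v - u < d \<and> G v - G u \<le> 1 / q * (v - u)"
        using uv pq x by (intro exI[of _ "F u"] exI[of _ "F v"]) (auto simp: GF strict_monoD[OF smF] field_simps)
    qed (use pq E GFE in auto)
    have fin: "emeasure lborel E < \<infinity>"
    proof -
      have "emeasure lborel E \<le> emeasure lborel {-real m..real m}" by (rule emeasure_mono) (auto simp: E_def)
      also have "\<dots> < \<infinity>" by simp
      finally show ?thesis .
    qed
    have "emeasure lborel E \<le> ennreal (1 / q) * (ennreal p * emeasure lborel E)"
      using 2 1 GFE by (metis mult_left_mono order_trans zero_le)
    moreover have "ennreal (1 / q) * (ennreal p * ennreal (measure lborel E)) = ennreal (1/q * (p * measure lborel E))"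
      using pq by (simp only: ennreal_mult' zero_le_divide_iff zero_le_one less_imp_le simp_thms)
    moreover have "emeasure lborel E = ennreal (measure lborel E)"
      using fin by (simp add: emeasure_eq_ennreal_measure)
    ultimately have *: "ennreal (measure lborel E) \<le> ennreal (1/q * (p * measure lborel E))" by simp
    have "measure lborel E \<le> 1/q * (p * measure lborel E)"
      by (rule iffD1[OF ennreal_le_iff *]) (use pq in auto)
    then have "measure lborel E * (1 - p/q) \<le> 0" by (simp add: algebra_simps)
    moreover have "1 - p/q > 0" using pq by simp
    ultimately have "measure lborel E = 0" by (smt (verit) measure_nonneg mult_pos_pos)
    then have "emeasure lborel E = 0" using fin by (simp add: emeasure_eq_ennreal_measure)
    then show ?thesis using E by (auto simp: E_def)
  qed
  have "?E = (\<Union>m. ?E \<inter> {-real m..real m})"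
  proof -
    have "\<exists>m. x \<in> {-real m..real m}" for x
      using real_arch_simple[of "\<bar>x\<bar>"] by (auto simp: abs_le_iff) (meson minus_le_iff)
    then have "(\<Union>m. {-real m..real m}) = UNIV" by blast
    then show ?thesis by (simp only: Int_UN_distrib[symmetric] Int_UNIV_right)
  qed
  moreover have "(\<Union>m. ?E \<inter> {-real m..real m}) \<in> null_sets lborel" using bd by (rule null_sets_UN)
  ultimately show ?thesis by simp
qed

text \<open>Adding (L + 1) x turns f into an increasing bi-Lipschitz function with slopes between 1
  and 2 L + 1, so positive rationals p < q detect every oscillation of the slopes. Off a countable
  union of null sets the slopes over short straddling intervals therefore converge.\<close>

lemma lipschitz_real_differentiable_AE:
  fixes f :: "real \<Rightarrow> real"
  assumes "L-lipschitz_on UNIV f"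
  shows "AE x in lborel. f differentiable at x"
proof -
  have L: "L \<ge> 0" using assms lipschitz_on_nonneg by blast
  define F where "F x = f x + (L + 1) * x" for x
  define K where "K = 2 * L + 1"
  have fl: "\<bar>f v - f u\<bar> \<le> L * (v - u)" if "u \<le> v" for u v
    using lipschitz_onD[OF assms, of v u] that by (simp add: dist_real_def)
  have lo: "v - u \<le> F v - F u" if "u \<le> v" for u v
    using fl[OF that] by (auto simp: F_def algebra_simps abs_if split: if_splits)
  have up: "F v - F u \<le> K * (v - u)" if "u \<le> v" for u v
    using fl[OF that] by (auto simp: F_def K_def algebra_simps abs_if split: if_splits)
  have contf: "continuous_on UNIV f" using assms by (rule lipschitz_on_continuous_on)
  then have contF: "isCont F x" for x
    unfolding F_def by (auto intro!: continuous_intros simp: continuous_on_eq_continuous_at)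
  define B where "B p q = {x. (\<forall>d>0. \<exists>u v. u < x \<and> x < v \<and> v - u < d \<and> F v - F u < p * (v - u)) \<and>
             (\<forall>d>0. \<exists>u v. u < x \<and> x < v \<and> v - u < d \<and> F v - F u > q * (v - u))}" for p q :: real
  have ae: "AE x in lborel. \<forall>(p::rat) (q::rat). 0 < p \<and> p < q \<longrightarrow> x \<notin> B (of_rat p) (of_rat q)"
  proof (subst AE_all_countable, intro allI, subst AE_all_countable, intro allI)
    fix p q :: rat
    show "AE x in lborel. 0 < p \<and> p < q \<longrightarrow> x \<notin> B (of_rat p) (of_rat q)"
    proof (cases "0 < p \<and> p < q")
      case True
      then have "B (of_rat p) (of_rat q) \<in> null_sets lborel"
        unfolding B_def by (intro bilipschitz_oscillation_null[OF lo up]) (auto simp: of_rat_less)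
      then show ?thesis by (auto dest: AE_not_in)
    qed auto
  qed
  have diff: "f differentiable at x"
    if nb: "\<forall>(p::rat) (q::rat). 0 < p \<and> p < q \<longrightarrow> x \<notin> B (of_rat p) (of_rat q)" for x
  proof -
    \<comment> \<open>\<open>P\<close> collects the numbers that bound all sufficiently short
      straddling slopes from below. Its supremum is the lower derivative; two rationals between
      \<open>D\<close> and \<open>D + e\<close> show that the upper one agrees with it.\<close>
    define P where "P = {p. \<exists>d>0. \<forall>u v. u < x \<and> x < v \<and> v - u < d \<longrightarrow> p * (v - u) \<le> F v - F u}"
    define D where "D = Sup P"
    have P1: "1 \<in> P" unfolding P_def using lo by (auto intro!: exI[of _ 1])
    have PK: "p \<le> K" if p: "p \<in> P" for p
    proof -
      obtain d where d: "d > 0" "\<forall>u v. u < x \<and> x < v \<and> v - u < d \<longrightarrow> p * (v - u) \<le> F v - F u"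
        using p unfolding P_def by blast
      have "p * ((x + d/3) - (x - d/3)) \<le> F (x + d/3) - F (x - d/3)"
        using d(1) by (intro d(2)[rule_format]) auto
      also have "\<dots> \<le> K * ((x + d/3) - (x - d/3))" using d(1) by (intro up) auto
      finally show ?thesis using d(1) by (simp add: mult_le_cancel_right)
    qed
    have bdd: "bdd_above P" using PK by (rule bdd_aboveI)
    have D1: "1 \<le> D" unfolding D_def by (rule cSup_upper[OF P1 bdd])
    have lower: "\<exists>d>0. \<forall>u v. u < x \<and> x < v \<and> v - u < d \<longrightarrow> (D - e) * (v - u) \<le> F v - F u" if "e > 0" for e
    proof -
      have "D - e < Sup P" using that by (simp add: D_def)
      then obtain p where p: "p \<in> P" "D - e < p" using less_cSup_iff[of P "D - e"] P1 bdd by blast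
      then obtain d where d: "d > 0" "\<forall>u v. u < x \<and> x < v \<and> v - u < d \<longrightarrow> p * (v - u) \<le> F v - F u"
        unfolding P_def by blast
      show ?thesis
      proof (intro exI[of _ d] conjI allI impI)
        fix u v assume uv: "u < x \<and> x < v \<and> v - u < d"
        have "(D - e) * (v - u) \<le> p * (v - u)" using p uv by (intro mult_right_mono) auto
        also have "\<dots> \<le> F v - F u" using d uv by blast
        finally show "(D - e) * (v - u) \<le> F v - F u" .
      qed (use d in auto)
    qed
    have upper: "\<exists>d>0. \<forall>u v. u < x \<and> x < v \<and> v - u < d \<longrightarrow> F v - F u \<le> (D + e) * (v - u)" if e: "e > 0" for e
    proof (rule ccontr)
      assume neg: "\<not> ?thesis"
      obtain p where p: "D < of_rat p" "of_rat p < D + e" using of_rat_dense[of D "D + e"] e by auto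
      obtain q where q: "of_rat p < (of_rat q :: real)" "of_rat q < D + e" using of_rat_dense[OF p(2)] by auto
      have "x \<notin> B (of_rat p) (of_rat q)"
        using nb p q D1 by (metis le_less_trans less_le_trans of_rat_less order_less_trans zero_less_of_rat_iff zero_less_one)
      moreover have "\<forall>d>0. \<exists>u v. u < x \<and> x < v \<and> v - u < d \<and> F v - F u > of_rat q * (v - u)"
      proof (intro allI impI)
        fix d :: real assume "d > 0"
        then obtain u v where uv: "u < x" "x < v" "v - u < d" "F v - F u > (D + e) * (v - u)"
          using neg by (force simp: not_le)
        have "of_rat q * (v - u) \<le> (D + e) * (v - u)" using q uv by (intro mult_right_mono) auto
        then have "F v - F u > of_rat q * (v - u)" using uv(4) by linarith
        then show "\<exists>u v. u < x \<and> x < v \<and> v - u < d \<and> F v - F u > of_rat q * (v - u)" using uv by blast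
      qed
      ultimately obtain d where d: "d > 0" "\<forall>u v. u < x \<and> x < v \<and> v - u < d \<longrightarrow> \<not> F v - F u < of_rat p * (v - u)"
        unfolding B_def by blast
      then have "of_rat p \<in> P" unfolding P_def by (auto simp: not_less)
      then have "of_rat p \<le> D" unfolding D_def using bdd by (rule cSup_upper)
      then show False using p by simp
    qed
    have "(F has_real_derivative D) (at x)"
      unfolding has_field_derivative_def has_derivative_at_within
    proof (intro conjI bounded_linear_mult_right)
      show "((\<lambda>y. (F y - F x - D * (y - x)) /\<^sub>R norm (y - x)) \<longlongrightarrow> 0) (at x)"
      proof (rule LIM_I)
        fix r :: real assume r: "r > 0"
        obtain d1 where d1: "d1 > 0" "\<forall>u v. u < x \<and> x < v \<and> v - u < d1 \<longrightarrow> (D - r/2) * (v - u) \<le> F v - F u"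
          using lower[of "r/2"] r by auto
        obtain d2 where d2: "d2 > 0" "\<forall>u v. u < x \<and> x < v \<and> v - u < d2 \<longrightarrow> F v - F u \<le> (D + r/2) * (v - u)"
          using upper[of "r/2"] r by auto
        define d where "d = min d1 d2"
        have d: "d > 0" using d1 d2 by (simp add: d_def)
        have strad: "\<bar>F v - F u - D * (v - u)\<bar> \<le> r/2 * (v - u)" if "u < x" "x < v" "v - u < d" for u v
        proof -
          have "(D - r/2) * (v - u) \<le> F v - F u" "F v - F u \<le> (D + r/2) * (v - u)"
            using d1(2) d2(2) that by (auto simp: d_def)
          then show ?thesis unfolding abs_le_iff distrib_right left_diff_distrib by linarith
        qed
        \<comment> \<open>One-sided difference quotients are limits of straddling ones: the other
          endpoint moves to x, by continuity of \<open>F\<close>.\<close>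
        have right: "\<bar>F v - F x - D * (v - x)\<bar> \<le> r/2 * (v - x)" if "x < v" "v - x < d" for v
        proof (rule tendsto_le[of "at_left x"])
          show "((\<lambda>u. \<bar>F v - F u - D * (v - u)\<bar>) \<longlongrightarrow> \<bar>F v - F x - D * (v - x)\<bar>) (at_left x)"
            using contF[of x] by (intro tendsto_intros) (auto simp: isCont_def filterlim_at_split)
          show "((\<lambda>u. r/2 * (v - u)) \<longlongrightarrow> r/2 * (v - x)) (at_left x)" by (intro tendsto_intros)
          have "\<forall>\<^sub>F u in at_left x. u \<in> {v - d<..<x}" using that by (intro eventually_at_left_real) auto
          then show "\<forall>\<^sub>F u in at_left x. \<bar>F v - F u - D * (v - u)\<bar> \<le> r/2 * (v - u)"
            by eventually_elim (use strad that in auto)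
        qed auto
        have left: "\<bar>F x - F u - D * (x - u)\<bar> \<le> r/2 * (x - u)" if "u < x" "x - u < d" for u
        proof (rule tendsto_le[of "at_right x"])
          show "((\<lambda>v. \<bar>F v - F u - D * (v - u)\<bar>) \<longlongrightarrow> \<bar>F x - F u - D * (x - u)\<bar>) (at_right x)"
            using contF[of x] by (intro tendsto_intros) (auto simp: isCont_def filterlim_at_split)
          show "((\<lambda>v. r/2 * (v - u)) \<longlongrightarrow> r/2 * (x - u)) (at_right x)" by (intro tendsto_intros)
          have "\<forall>\<^sub>F v in at_right x. v \<in> {x<..<u + d}" using that by (intro eventually_at_right_real) auto
          then show "\<forall>\<^sub>F v in at_right x. \<bar>F v - F u - D * (v - u)\<bar> \<le> r/2 * (v - u)"
            by eventually_elim (use strad that in auto)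
        qed auto
        show "\<exists>s>0. \<forall>y. y \<noteq> x \<and> norm (y - x) < s \<longrightarrow>
           norm ((F y - F x - D * (y - x)) /\<^sub>R norm (y - x) - 0) < r"
        proof (intro exI[of _ d] conjI allI impI)
          fix y assume y: "y \<noteq> x \<and> norm (y - x) < d"
          have "\<bar>F y - F x - D * (y - x)\<bar> \<le> r/2 * \<bar>y - x\<bar>"
          proof (cases "x < y")
            case True then show ?thesis using right[of y] y by (simp add: algebra_simps)
          next
            case False
            have "F y - F x - D * (y - x) = - (F x - F y - D * (x - y))" by (simp add: algebra_simps)
            then show ?thesis using left[of y] y False by (simp only: abs_minus) auto
          qed
          also have "\<dots> < r * \<bar>y - x\<bar>" using y r by simp
          finally show "norm ((F y - F x - D * (y - x)) /\<^sub>R norm (y - x) - 0) < r"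
            using y by (simp add: pos_divide_less_eq abs_mult divide_inverse_commute[symmetric])
        qed (use d in auto)
      qed
    qed
    then have "((\<lambda>x. F x - (L + 1) * x) has_real_derivative D - (L + 1)) (at x)"
      by (auto intro!: derivative_eq_intros)
    then have "(f has_real_derivative D - (L + 1)) (at x)" by (simp add: F_def)
    then show ?thesis by (auto simp: real_differentiable_def)
  qed
  show ?thesis using ae by eventually_elim (rule diff)
qed

lemma lipschitz_differentiable_AE:
  fixes f :: "real \<Rightarrow> 'a::euclidean_space"
  assumes "L-lipschitz_on UNIV f"
  shows "AE x in lborel. f differentiable at x"
proof -
  have "AE x in lborel. \<forall>b\<in>Basis. (\<lambda>x. f x \<bullet> b) differentiable at x"
  proof (rule AE_finite_allI)
    fix b :: 'a assume b: "b \<in> Basis"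
    have "L-lipschitz_on UNIV (\<lambda>x. f x \<bullet> b)"
    proof (rule lipschitz_onI)
      fix x y
      have "dist (f x \<bullet> b) (f y \<bullet> b) = \<bar>(f x - f y) \<bullet> b\<bar>" by (simp add: dist_real_def inner_diff_left)
      also have "\<dots> \<le> dist (f x) (f y)" unfolding dist_norm using b by (rule Basis_le_norm)
      also have "\<dots> \<le> L * dist x y" by (rule lipschitz_onD[OF assms]) auto
      finally show "dist (f x \<bullet> b) (f y \<bullet> b) \<le> L * dist x y" .
    qed (rule lipschitz_on_nonneg[OF assms])
    then show "AE x in lborel. (\<lambda>x. f x \<bullet> b) differentiable at x" by (rule lipschitz_real_differentiable_AE)
  qed auto
  then show ?thesis by eventually_elim (subst differentiable_componentwise_within, simp)
qed

text \<open>The steps 1 / (n + 1) leave a sequence, as measurability of the derivative and dominated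
  convergence require.\<close>

lemma has_vector_derivative_imp_quotient_sequence:
  fixes f :: "real \<Rightarrow> 'a::real_normed_vector"
  assumes "(f has_vector_derivative D) (at x)"
  shows "(\<lambda>n. real (Suc n) *\<^sub>R (f (x + 1 / real (Suc n)) - f x)) \<longlonglongrightarrow> D"
proof -
  have "((\<lambda>h. (f (x + h) - f x - h *\<^sub>R D) /\<^sub>R norm h) \<longlongrightarrow> 0) (at 0)"
  proof (rule tendsto_norm_zero_cancel)
    have "((\<lambda>h. norm (f (x + h) - f x - h *\<^sub>R D) / norm h) \<longlongrightarrow> 0) (at 0)"
      using assms unfolding has_vector_derivative_def has_derivative_at by simp
    then show "((\<lambda>h. norm ((f (x + h) - f x - h *\<^sub>R D) /\<^sub>R norm h)) \<longlongrightarrow> 0) (at 0)"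
      by (simp add: divide_inverse_commute)
  qed
  moreover have "filterlim (\<lambda>n. 1 / real (Suc n) :: real) (at 0) sequentially"
    using LIMSEQ_Suc[OF lim_1_over_n] by (auto simp: filterlim_at)
  ultimately have "(\<lambda>n. (f (x + 1 / real (Suc n)) - f x - (1 / real (Suc n)) *\<^sub>R D) /\<^sub>R norm (1 / real (Suc n))) \<longlonglongrightarrow> 0"
    by (rule filterlim_compose)
  then have "(\<lambda>n. real (Suc n) *\<^sub>R (f (x + 1 / real (Suc n)) - f x) - D) \<longlonglongrightarrow> 0"
    by (simp add: scaleR_diff_right del: of_nat_Suc)
  then show ?thesis by (rule LIM_zero_cancel)
qed

section \<open>Bounded and Lipschitz functions on an interval\<close>

text \<open>Membership in \<open>L\<^sup>\<infinity>(0,l)\<close>, phrased through a bounded Borel representative so that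
  AE-modifications and products need no completeness argument.\<close>
definition Linf :: "real \<Rightarrow> (real \<Rightarrow> 'a::euclidean_space) \<Rightarrow> bool" where
  "Linf l f \<longleftrightarrow> (\<exists>h\<in>borel_measurable borel. (\<exists>C. \<forall>s. norm (h s) \<le> C) \<and>
     (AE s in lborel. s \<in> {0..l} \<longrightarrow> f s = h s))"

lemma LinfI:
  assumes "h \<in> borel_measurable borel" "\<And>s. norm (h s) \<le> C" "AE s in lborel. s \<in> {0..l} \<longrightarrow> f s = h s"
  shows "Linf l f"
  using assms unfolding Linf_def by blast

lemma LinfE:
  assumes "Linf l f"
  obtains h C where "h \<in> borel_measurable borel" "\<And>s. norm (h s) \<le> C" "AE s in lborel. s \<in> {0..l} \<longrightarrow> f s = h s"
  using assms unfolding Linf_def by blast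

lemma Linf_cong_AE:
  assumes "Linf l f" "AE s in lborel. s \<in> {0..l} \<longrightarrow> g s = f s"
  shows "Linf l g"
proof -
  obtain h C where h: "h \<in> borel_measurable borel" "\<And>s. norm (h s) \<le> C" "AE s in lborel. s \<in> {0..l} \<longrightarrow> f s = h s"
    using LinfE[OF assms(1)] by blast
  have "AE s in lborel. s \<in> {0..l} \<longrightarrow> g s = h s" using h(3) assms(2) by eventually_elim auto
  with h(1,2) show ?thesis by (rule LinfI)
qed

lemma Linf_bounded_bilinear:
  fixes prod :: "'a::euclidean_space \<Rightarrow> 'b::euclidean_space \<Rightarrow> 'c::euclidean_space"
  assumes p: "bounded_bilinear prod" and f: "Linf l f" and g: "Linf l g"
  shows "Linf l (\<lambda>s. prod (f s) (g s))"
proof -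
  obtain h C where h: "h \<in> borel_measurable borel" "\<And>s. norm (h s) \<le> C" "AE s in lborel. s \<in> {0..l} \<longrightarrow> f s = h s"
    using LinfE[OF f] by blast
  obtain k D where k: "k \<in> borel_measurable borel" "\<And>s. norm (k s) \<le> D" "AE s in lborel. s \<in> {0..l} \<longrightarrow> g s = k s"
    using LinfE[OF g] by blast
  obtain K where K: "K \<ge> 0" "\<And>a b. norm (prod a b) \<le> norm a * norm b * K"
    using bounded_bilinear.nonneg_bounded[OF p] by blast
  show ?thesis
  proof (rule LinfI)
    show "(\<lambda>s. prod (h s) (k s)) \<in> borel_measurable borel"
      by (rule borel_measurable_continuous_Pair[OF h(1) k(1)])
         (intro bounded_bilinear.continuous_on[OF p] continuous_intros)
    show "norm (prod (h s) (k s)) \<le> C * D * K" for s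
    proof -
      have "norm (h s) * norm (k s) * K \<le> C * D * K"
        using h(2)[of s] k(2)[of s] K(1) norm_ge_zero[of "h s"] norm_ge_zero[of "k s"]
        by (intro mult_right_mono mult_mono order_trans[OF norm_ge_zero h(2)]) auto
      then show ?thesis using K(2) order_trans by blast
    qed
    show "AE s in lborel. s \<in> {0..l} \<longrightarrow> prod (f s) (g s) = prod (h s) (k s)"
      using h(3) k(3) by eventually_elim auto
  qed
qed

lemma Linf_add:
  assumes f: "Linf l f" and g: "Linf l g"
  shows "Linf l (\<lambda>s. f s + g s)"
proof -
  obtain h C where h: "h \<in> borel_measurable borel" "\<And>s. norm (h s) \<le> C" "AE s in lborel. s \<in> {0..l} \<longrightarrow> f s = h s"
    using LinfE[OF f] by blast
  obtain k D where k: "k \<in> borel_measurable borel" "\<And>s. norm (k s) \<le> D" "AE s in lborel. s \<in> {0..l} \<longrightarrow> g s = k s"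
    using LinfE[OF g] by blast
  show ?thesis
  proof (rule LinfI)
    show "(\<lambda>s. h s + k s) \<in> borel_measurable borel" using h(1) k(1) by simp
    show "norm (h s + k s) \<le> C + D" for s using h(2)[of s] k(2)[of s] norm_triangle_ineq[of "h s" "k s"] by linarith
    show "AE s in lborel. s \<in> {0..l} \<longrightarrow> f s + g s = h s + k s"
      using h(3) k(3) by eventually_elim auto
  qed
qed

lemma Linf_const: "Linf l (\<lambda>s. c)"
  by (rule LinfI[of "\<lambda>s. c" "norm c"]) auto

lemmas Linf_scaleR = Linf_bounded_bilinear[OF bounded_bilinear_scaleR]
lemma Linf_mult: "Linf l f \<Longrightarrow> Linf l g \<Longrightarrow> Linf l (\<lambda>s. f s * g s :: real)"
  by (rule Linf_bounded_bilinear[OF bounded_bilinear_mult])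
lemmas Linf_inner = Linf_bounded_bilinear[OF bounded_bilinear_inner]

lemma Linf_minus: "Linf l f \<Longrightarrow> Linf l (\<lambda>s. - f s)"
  using Linf_scaleR[OF Linf_const[of l "-1"], of f] by simp

lemma Linf_diff: "Linf l f \<Longrightarrow> Linf l g \<Longrightarrow> Linf l (\<lambda>s. f s - g s)"
  using Linf_add[OF _ Linf_minus, of l f g] by simp

lemma Linf_continuous:
  fixes f :: "real \<Rightarrow> 'a::euclidean_space"
  assumes "continuous_on {0..l} f"
  shows "Linf l f"
proof -
  have "compact (f ` {0..l})" using assms by (rule compact_continuous_image) simp
  then obtain C where C: "\<forall>x\<in>f ` {0..l}. norm x \<le> C" using compact_imp_bounded bounded_iff by blast
  show ?thesis
  proof (rule LinfI)
    show "(\<lambda>s. indicator {0..l} s *\<^sub>R f s) \<in> borel_measurable borel"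
      by (rule borel_measurable_continuous_on_indicator[OF _ assms]) simp
    show "norm (indicator {0..l} s *\<^sub>R f s) \<le> max C 0" for s
      using C by (auto simp: indicator_def le_max_iff_disj)
  qed auto
qed

lemma Linf_integrable:
  fixes f :: "real \<Rightarrow> 'a::euclidean_space"
  assumes "Linf l f" "0 \<le> a" "b \<le> l"
  shows "f integrable_on {a..b}"
proof -
  obtain h C where h: "h \<in> borel_measurable borel" "\<And>s. norm (h s) \<le> C" "AE s in lborel. s \<in> {0..l} \<longrightarrow> f s = h s"
    using LinfE[OF assms(1)] by blast
  have "h absolutely_integrable_on {a..b}"
  proof (rule measurable_bounded_by_integrable_imp_absolutely_integrable)
    show "h \<in> borel_measurable (lebesgue_on {a..b})"
      using h(1) by (intro measurable_restrict_space1 measurable_completion) simp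
    show "(\<lambda>_. C) integrable_on {a..b}" by (rule integrable_const_ivl)
  qed (use h(2) in auto)
  then obtain y where "(h has_integral y) {a..b}" by (auto simp: absolutely_integrable_on_def integrable_on_def)
  moreover have "AE s in lborel. s \<in> {a..b} \<longrightarrow> f s = h s" using h(3) by eventually_elim (use assms(2,3) in auto)
  ultimately show ?thesis using has_integral_AE by (metis integrable_on_def)
qed

lemma integral_cong_AE_interval:
  fixes f :: "real \<Rightarrow> 'a::euclidean_space"
  assumes "AE s in lborel. s \<in> S \<longrightarrow> f s = g s"
  shows "integral S f = integral S g"
  using has_integral_AE[OF assms] by (simp add: integral_def integrable_on_def)

section \<open>Lipschitz functions as primitives of their derivatives\<close>

text \<open>Freezing the end values extends f to the whole line with the same Lipschitz constant, so
  that two-sided derivatives and the quotients at s + 1 / (n + 1) make sense up to the ends of the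
  interval.\<close>

lemma W1inf_clamp:
  assumes "W1inf l f" "l \<ge> 0"
  obtains C where "C-lipschitz_on UNIV (\<lambda>s. f (max 0 (min l s)))"
proof -
  obtain C where C: "C-lipschitz_on {0..l} f" using assms(1) unfolding W1inf_def by blast
  have "C-lipschitz_on UNIV (\<lambda>s. f (max 0 (min l s)))"
  proof (rule lipschitz_onI)
    fix x y :: real
    have "dist (f (max 0 (min l x))) (f (max 0 (min l y))) \<le> C * dist (max 0 (min l x)) (max 0 (min l y))"
      using assms(2) by (intro lipschitz_onD[OF C]) auto
    also have "\<dots> \<le> C * dist x y" using lipschitz_on_nonneg[OF C] by (intro mult_left_mono) (auto simp: dist_real_def)
    finally show "dist (f (max 0 (min l x))) (f (max 0 (min l y))) \<le> C * dist x y" .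
  qed (rule lipschitz_on_nonneg[OF C])
  then show ?thesis by (rule that)
qed

lemma W1inf_continuous: "W1inf l f \<Longrightarrow> continuous_on {0..l} f"
  unfolding W1inf_def using lipschitz_on_continuous_on by blast

lemma W1inf_Dl_clamp_AE:
  fixes f :: "real \<Rightarrow> 'a::euclidean_space"
  assumes "W1inf l f" "l > 0"
  shows "AE s in lborel. s \<in> {0..l} \<longrightarrow> ((\<lambda>s. f (max 0 (min l s))) has_vector_derivative Dl l f s) (at s)"
proof -
  obtain C where C: "C-lipschitz_on UNIV (\<lambda>s. f (max 0 (min l s)))" using W1inf_clamp assms by (metis less_imp_le)
  have "AE s in lborel. (\<lambda>s. f (max 0 (min l s))) differentiable at s"
    by (rule lipschitz_differentiable_AE[OF C])
  then show ?thesis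
  proof eventually_elim
    case (elim s)
    show ?case
    proof
      assume s: "s \<in> {0..l}"
      obtain D where D: "((\<lambda>s. f (max 0 (min l s))) has_vector_derivative D) (at s)"
        using elim vector_derivative_works by blast
      have "((\<lambda>s. f (max 0 (min l s))) has_vector_derivative D) (at s within {0..l})"
        using D has_vector_derivative_at_within by blast
      then have "(f has_vector_derivative D) (at s within {0..l})"
        by (rule has_vector_derivative_transform[OF s, rotated]) auto
      moreover have "Dl l f s = D" unfolding Dl_def
        using s assms(2) calculation by (intro vector_derivative_within_closed_interval) auto
      ultimately show "((\<lambda>s. f (max 0 (min l s))) has_vector_derivative Dl l f s) (at s)" using D by simp
    qed
  qed
qed

lemma W1inf_Dl_AE:
  fixes f :: "real \<Rightarrow> 'a::euclidean_space"
  assumes "W1inf l f" "l > 0"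
  shows "AE s in lborel. s \<in> {0..l} \<longrightarrow> (f has_vector_derivative Dl l f s) (at s within {0..l})"
  using W1inf_Dl_clamp_AE[OF assms]
proof eventually_elim
  case (elim s)
  show ?case
  proof
    assume s: "s \<in> {0..l}"
    have "((\<lambda>s. f (max 0 (min l s))) has_vector_derivative Dl l f s) (at s within {0..l})"
      using elim s has_vector_derivative_at_within by blast
    then show "(f has_vector_derivative Dl l f s) (at s within {0..l})"
      by (rule has_vector_derivative_transform[OF s, rotated]) auto
  qed
qed

lemma clamp_difference_quotient_bound:
  assumes C: "C-lipschitz_on UNIV (\<lambda>s. f (max 0 (min l s)))"
  shows "norm (real (Suc n) *\<^sub>R (f (max 0 (min l (s + 1 / real (Suc n)))) - f (max 0 (min l s)))) \<le> C"
proof -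
  have "norm (f (max 0 (min l (s + 1 / real (Suc n)))) - f (max 0 (min l s))) \<le> C * norm (s + 1 / real (Suc n) - s)"
    using lipschitz_onD[OF C, of "s + 1 / real (Suc n)" s] by (simp add: dist_norm)
  then have "real (Suc n) * norm (f (max 0 (min l (s + 1 / real (Suc n)))) - f (max 0 (min l s))) \<le> C"
    by (simp add: field_simps del: of_nat_Suc)
  then show ?thesis by simp
qed

lemma W1inf_Dl_Linf:
  fixes f :: "real \<Rightarrow> 'a::euclidean_space"
  assumes "W1inf l f" "l > 0"
  shows "Linf l (Dl l f)"
proof -
  obtain C where C: "C-lipschitz_on UNIV (\<lambda>s. f (max 0 (min l s)))" using W1inf_clamp assms by (metis less_imp_le)
  define g where "g n s = real (Suc n) *\<^sub>R (f (max 0 (min l (s + 1 / real (Suc n)))) - f (max 0 (min l s)))" for n s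
  have cf: "continuous_on UNIV (\<lambda>s. f (max 0 (min l s)))" using C by (rule lipschitz_on_continuous_on)
  have gm: "g n \<in> borel_measurable borel" for n
    unfolding g_def
    by (intro borel_measurable_continuous_onI continuous_intros
        continuous_on_compose2[OF cf, of UNIV "\<lambda>s. s + 1 / real (Suc n)"] cf) auto
  \<comment> \<open>Where the quotients diverge, \<open>lim\<close> is an unspecified but still
    measurable choice; the cutoff at \<open>C\<close> keeps the representative bounded
    there.\<close>
  define h where "h s = (if norm (lim (\<lambda>n. g n s)) \<le> C then lim (\<lambda>n. g n s) else 0)" for s
  have hm: "h \<in> borel_measurable borel"
    unfolding h_def using borel_measurable_lim_metric[OF gm] by (intro measurable_If_set measurable_If) auto
  show ?thesis
  proof (rule LinfI[OF hm])
    show "norm (h s) \<le> C" for s using lipschitz_on_nonneg[OF C] by (auto simp: h_def)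
    show "AE s in lborel. s \<in> {0..l} \<longrightarrow> Dl l f s = h s"
      using W1inf_Dl_clamp_AE[OF assms]
    proof eventually_elim
      case (elim s)
      show ?case
      proof
        assume "s \<in> {0..l}"
        then have "(\<lambda>n. g n s) \<longlonglongrightarrow> Dl l f s"
          using elim unfolding g_def by (intro has_vector_derivative_imp_quotient_sequence[where f="\<lambda>s. f (max 0 (min l s))"]) auto
        moreover from this have "norm (Dl l f s) \<le> C"
          using clamp_difference_quotient_bound[OF C] unfolding g_def by (intro LIMSEQ_le_const2[OF tendsto_norm]) auto
        ultimately show "Dl l f s = h s" using limI[of "\<lambda>n. g n s"] by (auto simp: h_def)
      qed
    qed
  qed
qed

text \<open>The difference quotients of f integrate exactly to difference quotients of a primitive
  \<open>P\<close> at t and at 0, and these tend to the values of f. The Lipschitz constant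
  dominates the integrands.\<close>

theorem W1inf_Dl_has_integral:
  fixes f :: "real \<Rightarrow> 'a::euclidean_space"
  assumes "W1inf l f" "l > 0" and t: "t \<in> {0..l}"
  shows "(Dl l f has_integral f t - f 0) {0..t}"
proof -
  obtain C where C: "C-lipschitz_on UNIV (\<lambda>s. f (max 0 (min l s)))" using W1inf_clamp assms by (metis less_imp_le)
  define fh where "fh s = f (max 0 (min l s))" for s
  have cf: "continuous_on A fh" for A
    using C lipschitz_on_continuous_on continuous_on_subset unfolding fh_def by blast
  \<comment> \<open>Starting at -1 keeps 0 in the interior, so that \<open>P\<close> has a two-sided
    derivative at 0 as well.\<close>
  define P where "P x = integral {-1..x} fh" for x
  have dP: "(P has_vector_derivative fh x) (at x)" if "-1 < x" "x < l + 2" for x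
  proof -
    have "(P has_vector_derivative fh x) (at x within {-1..l+2})"
      unfolding P_def by (rule integral_has_vector_derivative[OF cf]) (use that in auto)
    then show ?thesis using that by (simp add: at_within_Icc_at)
  qed
  define g where "g n s = real (Suc n) *\<^sub>R (fh (s + 1 / real (Suc n)) - fh s)" for n s
  define y where "y n = real (Suc n) *\<^sub>R (P (t + 1 / real (Suc n)) - P t) - real (Suc n) *\<^sub>R (P (0 + 1 / real (Suc n)) - P 0)" for n
  have gy: "(g n has_integral y n) {0..t}" for n
  proof -
    define e where "e = 1 / real (Suc n)"
    have e: "0 < e" "e \<le> 1" by (auto simp: e_def)
    have "((\<lambda>s. fh (s + e) - fh s) has_integral (P (t + e) - P t) - (P (0 + e) - P 0)) {0..t}"
    proof (rule fundamental_theorem_of_calculus)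
      fix x assume x: "x \<in> {0..t}"
      have "((\<lambda>s. s + e) has_vector_derivative 1) (at x)" by (auto intro!: derivative_eq_intros)
      moreover have "(P has_vector_derivative fh (x + e)) (at (x + e))" by (rule dP) (use x e t in auto)
      ultimately have d1: "((\<lambda>s. P (s + e)) has_vector_derivative fh (x + e)) (at x)"
        using vector_diff_chain_at[of "\<lambda>s. s + e" 1 x P "fh (x + e)"] by (simp add: o_def)
      have d2: "(P has_vector_derivative fh x) (at x)" by (rule dP) (use x t in auto)
      show "((\<lambda>s. P (s + e) - P s) has_vector_derivative fh (x + e) - fh x) (at x within {0..t})"
        by (rule has_vector_derivative_at_within[OF has_vector_derivative_diff[OF d1 d2]])
    qed (use t in auto)
    from has_integral_cmul[OF this, of "real (Suc n)"] show ?thesis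
      unfolding y_def e_def g_def[abs_def] by (simp add: scaleR_diff_right)
  qed
  have ylim: "y \<longlonglongrightarrow> f t - f 0"
  proof -
    have "y \<longlonglongrightarrow> fh t - fh 0" unfolding y_def
      using t by (intro tendsto_diff has_vector_derivative_imp_quotient_sequence dP) auto
    then show ?thesis using t by (simp add: fh_def)
  qed
  obtain N where N: "N \<in> null_sets lborel"
      "\<And>s. s \<notin> N \<Longrightarrow> s \<in> {0..l} \<longrightarrow> (fh has_vector_derivative Dl l f s) (at s)"
    using AE_E3[OF W1inf_Dl_clamp_AE[OF assms(1,2)]] unfolding fh_def by (metis DiffI UNIV_I space_borel space_lborel)
  have nN: "negligible N" using N(1) by (simp add: negligible_iff_null_sets null_sets_completionI)
  \<comment> \<open>The convergence theorem asks for convergence at every point, so quotients and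
    limit are both set to 0 on the null set \<open>N\<close>.\<close>
  define g' where "g' n s = (if s \<in> N then 0 else g n s)" for n s
  define D where "D s = (if s \<in> N then 0 else Dl l f s)" for s
  have "(D has_integral f t - f 0) {0..t}"
  proof (rule has_integral_dominated_convergence[where f=g' and y=y and h="\<lambda>_. C"])
    show "(g' n has_integral y n) {0..t}" for n
      by (rule has_integral_spike[OF nN _ gy]) (auto simp: g'_def)
    show "\<forall>s\<in>{0..t}. norm (g' n s) \<le> C" for n
      using clamp_difference_quotient_bound[OF C, of n] lipschitz_on_nonneg[OF C] by (auto simp: g'_def g_def fh_def)
    show "\<forall>s\<in>{0..t}. (\<lambda>n. g' n s) \<longlonglongrightarrow> D s"
    proof
      fix s assume s: "s \<in> {0..t}"
      show "(\<lambda>n. g' n s) \<longlonglongrightarrow> D s"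
      proof (cases "s \<in> N")
        case False
        then have "(\<lambda>n. g n s) \<longlonglongrightarrow> Dl l f s"
          unfolding g_def using N(2)[of s] s t by (intro has_vector_derivative_imp_quotient_sequence) auto
        then show ?thesis using False by (simp add: g'_def D_def)
      qed (simp add: g'_def D_def)
    qed
  qed (use ylim in auto)
  then show ?thesis by (rule has_integral_spike[OF nN, rotated]) (auto simp: D_def)
qed

text \<open>The positive and negative parts of f are densities of two finite measures on the line.
  Vanishing integrals over initial intervals give these measures equal distribution functions, so
  the measures and hence the two parts coincide; since one part is always 0, both are.\<close>

lemma Linf_real_zero_of_integral_zero:
  fixes f :: "real \<Rightarrow> real"
  assumes f: "Linf l f" and z: "\<And>t. t \<in> {0..l} \<Longrightarrow> integral {0..t} f = 0" and l: "l > 0"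
  shows "AE s in lborel. s \<in> {0..l} \<longrightarrow> f s = 0"
proof -
  obtain h C where h: "h \<in> borel_measurable borel" "\<And>s. norm (h s) \<le> C" "AE s in lborel. s \<in> {0..l} \<longrightarrow> f s = h s"
    using LinfE[OF f] by blast
  define h0 where "h0 s = indicator {0..l} s * h s" for s
  have h0m[measurable]: "h0 \<in> borel_measurable borel" using h(1) unfolding h0_def by measurable
  have int0: "set_integrable lborel A h0" if "A \<in> sets borel" for A
  proof -
    have "integrable lborel h0"
    proof (rule Bochner_Integration.integrable_bound)
      show "integrable lborel (\<lambda>s. C * indicator {0..l} s :: real)"
        by (intro integrable_mult_right integrable_real_indicator) (auto simp: emeasure_lborel_Icc_eq)
      show "AE s in lborel. norm (h0 s) \<le> norm (C * indicator {0..l} s :: real)"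
      proof (rule AE_I2)
        fix s show "norm (h0 s) \<le> norm (C * indicator {0..l} s :: real)"
          using h(2)[of s] by (simp add: h0_def indicator_def)
      qed
    qed simp
    then show ?thesis unfolding set_integrable_def using that by (intro integrable_mult_indicator) simp_all
  qed
  have zero: "(LINT s:{..x}|lborel. h0 s) = 0" for x
  proof -
    have "(LINT s:{..x}|lborel. h0 s) = (LINT s:{0..min x l}|lborel. h0 s)"
      unfolding set_lebesgue_integral_def by (rule Bochner_Integration.integral_cong) (auto simp: h0_def indicator_def)
    also have "\<dots> = integral {0..min x l} h0"
      by (rule set_borel_integral_eq_integral(2)[OF int0]) auto
    also have "\<dots> = integral {0..min x l} f"
      by (rule integral_cong_AE_interval) (use h(3) in \<open>eventually_elim, auto simp: h0_def indicator_def\<close>)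
    also have "\<dots> = 0"
    proof (cases "0 \<le> x")
      case True then show ?thesis using l by (intro z) auto
    qed auto
    finally show ?thesis .
  qed
  define M where "M \<sigma> = density lborel (\<lambda>s. ennreal (max 0 (\<sigma> * h0 s)))" for \<sigma> :: real
  have ip: "set_integrable lborel A (\<lambda>s. max 0 (\<sigma> * h0 s))" if "A \<in> sets borel" for \<sigma> A
  proof -
    have "integrable lborel h0" using int0[of UNIV] by (simp add: set_integrable_def)
    then have "integrable lborel (\<lambda>s. max 0 (\<sigma> * h0 s))" by (intro Bochner_Integration.integrable_max) auto
    then show ?thesis unfolding set_integrable_def using that by (intro integrable_mult_indicator) simp_all
  qed
  have eM: "emeasure (M \<sigma>) A = ennreal (LINT s:A|lborel. max 0 (\<sigma> * h0 s))" if A: "A \<in> sets borel" for \<sigma> A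
  proof -
    have "emeasure (M \<sigma>) A = (\<integral>\<^sup>+s. ennreal (indicator A s *\<^sub>R max 0 (\<sigma> * h0 s)) \<partial>lborel)"
      unfolding M_def using A by (subst emeasure_density) (auto intro!: nn_integral_cong simp: indicator_def)
    also have "\<dots> = ennreal (LINT s:A|lborel. max 0 (\<sigma> * h0 s))"
      unfolding set_lebesgue_integral_def
      using ip[OF A, of \<sigma>] by (intro nn_integral_eq_integral) (auto simp: set_integrable_def)
    finally show ?thesis .
  qed
  have fin: "finite_borel_measure (M \<sigma>)" for \<sigma>
  proof (intro finite_borel_measure.intro finite_borel_measure_axioms.intro finite_measureI)
    show "emeasure (M \<sigma>) (space (M \<sigma>)) \<noteq> \<infinity>" using eM[of UNIV \<sigma>] by (simp add: M_def)
    show "sets (M \<sigma>) = sets borel" by (simp add: M_def)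
  qed
  have "M 1 = M (-1)"
  proof (rule cdf_unique'[OF fin fin], rule ext)
    fix x
    have "(LINT s:{..x}|lborel. max 0 (1 * h0 s)) - (LINT s:{..x}|lborel. max 0 (-1 * h0 s))
       = (LINT s:{..x}|lborel. max 0 (1 * h0 s) - max 0 (-1 * h0 s))"
      by (rule set_integral_diff(2)[symmetric]) (rule ip, simp)+
    also have "\<dots> = (LINT s:{..x}|lborel. h0 s)"
      by (rule arg_cong[where f="set_lebesgue_integral lborel {..x}"]) auto
    finally have "(LINT s:{..x}|lborel. max 0 (1 * h0 s)) = (LINT s:{..x}|lborel. max 0 (-1 * h0 s))"
      using zero[of x] by simp
    then show "cdf (M 1) x = cdf (M (-1)) x" unfolding cdf_def measure_def by (simp add: eM)
  qed
  then have "AE s in lborel. ennreal (max 0 (1 * h0 s)) = ennreal (max 0 (-1 * h0 s))"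
    unfolding M_def by (subst (asm) sigma_finite_measure.density_unique_iff[OF lborel.sigma_finite_measure_axioms]) auto
  with h(3) show ?thesis
  proof eventually_elim
    case (elim s)
    then show ?case by (auto simp: h0_def max_def split: if_splits)
  qed
qed

lemma Linf_zero_of_integral_zero:
  fixes f :: "real \<Rightarrow> 'a::euclidean_space"
  assumes f: "Linf l f" and z: "\<And>t. t \<in> {0..l} \<Longrightarrow> integral {0..t} f = 0" and l: "l > 0"
  shows "AE s in lborel. s \<in> {0..l} \<longrightarrow> f s = 0"
proof -
  have "AE s in lborel. \<forall>b\<in>Basis. s \<in> {0..l} \<longrightarrow> f s \<bullet> b = 0"
  proof (rule AE_finite_allI)
    fix b :: 'a assume "b \<in> Basis"
    show "AE s in lborel. s \<in> {0..l} \<longrightarrow> f s \<bullet> b = 0"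
    proof (rule Linf_real_zero_of_integral_zero[OF _ _ l])
      show "Linf l (\<lambda>s. f s \<bullet> b)" by (intro Linf_inner f Linf_const)
      fix t assume t: "t \<in> {0..l}"
      then have "f integrable_on {0..t}" using f by (intro Linf_integrable) auto
      then show "integral {0..t} (\<lambda>s. f s \<bullet> b) = 0"
        using z[OF t] integral_component_eq[of f "{0..t}" b] by simp
    qed
  qed auto
  then show ?thesis by eventually_elim (auto intro: euclidean_eqI)
qed

lemma Linf_AE_bound:
  assumes "Linf l f"
  obtains C where "C \<ge> 0" "AE s in lborel. s \<in> {0..l} \<longrightarrow> norm (f s) \<le> C"
proof -
  obtain h C where h: "\<And>s. norm (h s) \<le> C" "AE s in lborel. s \<in> {0..l} \<longrightarrow> f s = h s"
    using LinfE[OF assms] by blast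
  have "AE s in lborel. s \<in> {0..l} \<longrightarrow> norm (f s) \<le> C" using h(2) by eventually_elim (use h(1) in auto)
  moreover have "C \<ge> 0" using h(1)[of 0] norm_ge_zero order_trans by blast
  ultimately show ?thesis using that by blast
qed

lemma primitive_dist_le:
  fixes f w :: "real \<Rightarrow> 'a::euclidean_space"
  assumes w: "Linf l w" and f: "\<And>t. t \<in> {0..l} \<Longrightarrow> f t = f 0 + integral {0..t} w"
    and C: "AE s in lborel. s \<in> {0..l} \<longrightarrow> norm (w s) \<le> C" "C \<ge> 0"
  shows "C-lipschitz_on {0..l} f"
proof (rule lipschitz_on_leI[OF _ C(2)])
  fix x y assume xy: "x \<in> {0..l}" "y \<in> {0..l}" "x \<le> y"
  obtain h where h: "AE s in lborel. s \<in> {0..l} \<longrightarrow> w s = h s" "\<And>s. norm (h s) \<le> C"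
  proof
    show "AE s in lborel. s \<in> {0..l} \<longrightarrow> w s = (if norm (w s) \<le> C then w s else 0)"
      using C(1) by eventually_elim auto
    show "norm (if norm (w s) \<le> C then w s else 0) \<le> C" for s using C(2) by auto
  qed
  have "integral {0..x} w + integral {x..y} w = integral {0..y} w"
    using xy by (intro Henstock_Kurzweil_Integration.integral_combine Linf_integrable[OF w]) auto
  then have e: "f y - f x = integral {x..y} w" using f[of x] f[of y] xy by (simp add: algebra_simps)
  have ae: "AE s in lborel. s \<in> {x..y} \<longrightarrow> w s = h s" using h(1) by eventually_elim (use xy in auto)
  have "w integrable_on {x..y}" using xy by (intro Linf_integrable[OF w]) auto
  then have "(w has_integral f y - f x) {x..y}" using e by (simp add: has_integral_iff)
  then have "(h has_integral f y - f x) {x..y}" using has_integral_AE[OF ae] by simp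
  then have "norm (f y - f x) \<le> C * (y - x)"
    using has_integral_bound_real[OF C(2) finite.emptyI, of h "f y - f x" x y] h(2) xy by simp
  then show "dist (f x) (f y) \<le> C * dist x y"
    using xy by (simp add: dist_norm norm_minus_commute)
qed

text \<open>\<open>Dl l f\<close> and \<open>w\<close> integrate to the same value over every
  initial interval, which forces equality almost everywhere. This is the converse of
  \<open>W1inf_Dl_has_integral\<close>.\<close>

lemma primitive_W1inf:
  fixes f w :: "real \<Rightarrow> 'a::euclidean_space"
  assumes w: "Linf l w" and f: "\<And>t. t \<in> {0..l} \<Longrightarrow> f t = f 0 + integral {0..t} w" and l: "l > 0"
  shows "W1inf l f" "AE s in lborel. s \<in> {0..l} \<longrightarrow> Dl l f s = w s"
proof -
  obtain C where C: "C \<ge> 0" "AE s in lborel. s \<in> {0..l} \<longrightarrow> norm (w s) \<le> C" using Linf_AE_bound[OF w] by blast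
  show W: "W1inf l f" unfolding W1inf_def using primitive_dist_le[OF w f C(2,1)] by blast
  have "AE s in lborel. s \<in> {0..l} \<longrightarrow> Dl l f s - w s = 0"
  proof (rule Linf_zero_of_integral_zero[OF _ _ l])
    show "Linf l (\<lambda>s. Dl l f s - w s)" by (intro Linf_diff W1inf_Dl_Linf W l w)
    fix t assume t: "t \<in> {0..l}"
    have 1: "(Dl l f has_integral f t - f 0) {0..t}" by (rule W1inf_Dl_has_integral[OF W l t])
    have 2: "(w has_integral integral {0..t} w) {0..t}"
      by (rule integrable_integral[OF Linf_integrable[OF w]]) (use t in auto)
    show "integral {0..t} (\<lambda>s. Dl l f s - w s) = 0"
      using integral_unique[OF has_integral_diff[OF 1 2]] f[OF t] by simp
  qed
  then show "AE s in lborel. s \<in> {0..l} \<longrightarrow> Dl l f s = w s" by eventually_elim auto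
qed

lemma Dl_eqI:
  fixes f :: "real \<Rightarrow> 'a::euclidean_space"
  assumes "(f has_vector_derivative D) (at s within {0..l})" "s \<in> {0..l}" "l > 0"
  shows "Dl l f s = D"
  unfolding Dl_def using assms by (intro vector_derivative_within_closed_interval) auto

lemma W1inf_bounded_bilinear:
  fixes prod :: "'a::euclidean_space \<Rightarrow> 'b::euclidean_space \<Rightarrow> 'c::euclidean_space"
  assumes p: "bounded_bilinear prod" and f: "W1inf l f" and g: "W1inf l g" and l: "l > 0"
  shows "W1inf l (\<lambda>s. prod (f s) (g s))"
    and "AE s in lborel. s \<in> {0..l} \<longrightarrow> Dl l (\<lambda>s. prod (f s) (g s)) s = prod (f s) (Dl l g s) + prod (Dl l f s) (g s)"
proof -
  obtain A where A: "A-lipschitz_on {0..l} f" using f unfolding W1inf_def by blast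
  obtain B where B: "B-lipschitz_on {0..l} g" using g unfolding W1inf_def by blast
  obtain K where K: "K \<ge> 0" "\<And>a b. norm (prod a b) \<le> norm a * norm b * K"
    using bounded_bilinear.nonneg_bounded[OF p] by blast
  obtain F where F: "\<And>s. s \<in> {0..l} \<Longrightarrow> norm (f s) \<le> F" "F \<ge> 0"
  proof -
    have "bounded (f ` {0..l})" using W1inf_continuous[OF f] compact_continuous_image compact_imp_bounded by blast
    then obtain F where "\<forall>s\<in>{0..l}. norm (f s) \<le> F" unfolding bounded_iff by blast
    then show ?thesis using that[of "max F 0"] by (auto simp: le_max_iff_disj)
  qed
  obtain G where G: "\<And>s. s \<in> {0..l} \<Longrightarrow> norm (g s) \<le> G" "G \<ge> 0"
  proof -
    have "bounded (g ` {0..l})" using W1inf_continuous[OF g] compact_continuous_image compact_imp_bounded by blast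
    then obtain F where "\<forall>s\<in>{0..l}. norm (g s) \<le> F" unfolding bounded_iff by blast
    then show ?thesis using that[of "max F 0"] by (auto simp: le_max_iff_disj)
  qed
  have "(F * B * K + A * G * K)-lipschitz_on {0..l} (\<lambda>s. prod (f s) (g s))"
  proof (rule lipschitz_onI)
    fix x y assume xy: "x \<in> {0..l}" "y \<in> {0..l}"
    have e: "prod (f x) (g x) - prod (f y) (g y) = prod (f x) (g x - g y) + prod (f x - f y) (g y)"
      by (simp add: bounded_bilinear.diff_left[OF p] bounded_bilinear.diff_right[OF p])
    have "norm (prod (f x) (g x) - prod (f y) (g y)) \<le> norm (f x) * norm (g x - g y) * K + norm (f x - f y) * norm (g y) * K"
      unfolding e by (rule order_trans[OF norm_triangle_ineq add_mono[OF K(2) K(2)]])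
    also have "\<dots> \<le> F * (B * dist x y) * K + (A * dist x y) * G * K"
      using F G K(1) lipschitz_onD[OF A xy] lipschitz_onD[OF B xy] xy lipschitz_on_nonneg[OF A] lipschitz_on_nonneg[OF B]
      by (intro add_mono mult_right_mono mult_mono) (auto simp: dist_norm)
    finally show "dist (prod (f x) (g x)) (prod (f y) (g y)) \<le> (F * B * K + A * G * K) * dist x y"
      by (simp add: dist_norm algebra_simps)
  qed (use F(2) G(2) K(1) lipschitz_on_nonneg[OF A] lipschitz_on_nonneg[OF B] in auto)
  then show "W1inf l (\<lambda>s. prod (f s) (g s))" unfolding W1inf_def by blast
  show "AE s in lborel. s \<in> {0..l} \<longrightarrow> Dl l (\<lambda>s. prod (f s) (g s)) s = prod (f s) (Dl l g s) + prod (Dl l f s) (g s)"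
    using W1inf_Dl_AE[OF f l] W1inf_Dl_AE[OF g l]
  proof eventually_elim
    case (elim s)
    show ?case
    proof
      assume s: "s \<in> {0..l}"
      have "((\<lambda>s. prod (f s) (g s)) has_vector_derivative prod (f s) (Dl l g s) + prod (Dl l f s) (g s)) (at s within {0..l})"
        using elim s by (intro bounded_bilinear.has_vector_derivative[OF p]) auto
      then show "Dl l (\<lambda>s. prod (f s) (g s)) s = prod (f s) (Dl l g s) + prod (Dl l f s) (g s)"
        using s l by (rule Dl_eqI)
    qed
  qed
qed

lemma integration_by_parts_W1inf:
  fixes prod :: "'a::euclidean_space \<Rightarrow> 'b::euclidean_space \<Rightarrow> 'c::euclidean_space"
  assumes p: "bounded_bilinear prod" and f: "W1inf l f" and g: "W1inf l g" and l: "l > 0"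
  shows "((\<lambda>s. prod (f s) (Dl l g s) + prod (Dl l f s) (g s)) has_integral prod (f l) (g l) - prod (f 0) (g 0)) {0..l}"
  using W1inf_Dl_has_integral[OF W1inf_bounded_bilinear(1)[OF p f g l] l, of l] l
    has_integral_AE[OF W1inf_bounded_bilinear(2)[OF p f g l]] by auto

text \<open>Jordan decomposition: with \<open>V\<close> the variation function, both
  \<open>V\<close> and \<open>V - \<alpha>\<close> are monotone, and monotone functions are
  Borel.\<close>

lemma bounded_variation_on_Linf:
  assumes bv: "bounded_variation_on \<alpha> 0 l" and l: "l > 0"
  shows "Linf l \<alpha>"
proof -
  define S where "S x = {s. \<exists>m t. t 0 = 0 \<and> t m = x \<and> (\<forall>i<m. t i \<le> t (Suc i)) \<and> s = (\<Sum>i<m. \<bar>\<alpha> (t (Suc i)) - \<alpha> (t i)\<bar>)}" for x :: real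
  obtain B where B: "s \<le> B" if "s \<in> S l" for s
  proof -
    have le: "ereal s \<le> total_variation \<alpha> 0 l" if "s \<in> S l" for s
      using that unfolding total_variation_def S_def by (auto intro!: SUP_upper2)
    have "total_variation \<alpha> 0 l < \<infinity>" using bv by (simp add: bounded_variation_on_def)
    then obtain B where "total_variation \<alpha> 0 l \<le> ereal B" by (cases "total_variation \<alpha> 0 l") auto
    then have "s \<le> B" if "s \<in> S l" for s using le[OF that] by (metis ereal_less_eq(3) order_trans)
    then show ?thesis using that by blast
  qed
  \<comment> \<open>Appending one point to a partition yields monotonicity of \<open>V\<close>,
    monotonicity of \<open>V - \<alpha>\<close> and finiteness of \<open>V\<close> at once.\<close>
  have ext: "s + \<bar>\<alpha> y - \<alpha> x\<bar> \<in> S y" if s: "s \<in> S x" and xy: "x \<le> y" for s x y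
  proof -
    obtain m t where t: "t 0 = 0" "t m = x" "\<forall>i<m. t i \<le> t (Suc i)" "s = (\<Sum>i<m. \<bar>\<alpha> (t (Suc i)) - \<alpha> (t i)\<bar>)"
      using s unfolding S_def by blast
    define t' where "t' = t(Suc m := y)"
    have "(\<Sum>i<Suc m. \<bar>\<alpha> (t' (Suc i)) - \<alpha> (t' i)\<bar>) = s + \<bar>\<alpha> y - \<alpha> x\<bar>"
      using t by (simp add: t'_def)
    moreover have "t' 0 = 0" "t' (Suc m) = y" using t by (auto simp: t'_def)
    moreover have "\<forall>i<Suc m. t' i \<le> t' (Suc i)" using t xy by (auto simp: t'_def less_Suc_eq)
    ultimately show ?thesis unfolding S_def by (intro CollectI exI[of _ "Suc m"] exI[of _ t']) auto
  qed
  have bdd: "bdd_above (S x)" if "x \<le> l" for x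
  proof (rule bdd_aboveI)
    fix s assume "s \<in> S x"
    then show "s \<le> B" using B[OF ext[OF _ that]] by fastforce
  qed
  have z: "0 \<in> S 0" unfolding S_def by (intro CollectI exI[of _ 0] exI[of _ "\<lambda>_. 0"]) auto
  have ne: "S x \<noteq> {}" if "0 \<le> x" for x using ext[OF z that] by blast
  define V where "V x = Sup (S x)" for x
  have V: "V x + \<bar>\<alpha> y - \<alpha> x\<bar> \<le> V y" if "0 \<le> x" "x \<le> y" "y \<le> l" for x y
  proof -
    have "V x \<le> V y - \<bar>\<alpha> y - \<alpha> x\<bar>" unfolding V_def
    proof (rule cSup_least)
      fix s assume "s \<in> S x"
      then have "s + \<bar>\<alpha> y - \<alpha> x\<bar> \<le> Sup (S y)" using ext that bdd by (intro cSup_upper) auto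
      then show "s \<le> Sup (S y) - \<bar>\<alpha> y - \<alpha> x\<bar>" by simp
    qed (use ne that in auto)
    then show ?thesis by simp
  qed
  have mV: "mono_on {0..l} V" by (rule mono_onI) (use V in fastforce)
  have mVa: "mono_on {0..l} (\<lambda>x. V x - \<alpha> x)"
  proof (rule mono_onI)
    fix r s assume "r \<in> {0..l}" "s \<in> {0..l}" "r \<le> s"
    then show "V r - \<alpha> r \<le> V s - \<alpha> s" using V[of r s] by auto
  qed
  have "(\<lambda>x. V x - (V x - \<alpha> x)) \<in> borel_measurable (restrict_space borel {0..l})"
    by (rule borel_measurable_diff[OF borel_measurable_mono_on_fnc[OF mV] borel_measurable_mono_on_fnc[OF mVa]])
  then have m: "(\<lambda>x. indicator {0..l} x *\<^sub>R \<alpha> x) \<in> borel_measurable borel"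
    by (simp add: borel_measurable_restrict_space_iff)
  have bd: "\<bar>\<alpha> x\<bar> \<le> \<bar>\<alpha> 0\<bar> + B" if "x \<in> {0..l}" for x
  proof -
    have "(0 + \<bar>\<alpha> x - \<alpha> 0\<bar>) + \<bar>\<alpha> l - \<alpha> x\<bar> \<le> B" using that by (intro B ext z) auto
    then show ?thesis by (auto simp: abs_if split: if_splits)
  qed
  have B0: "0 \<le> B" using bd[of 0] l by auto
  show ?thesis
    by (rule LinfI[OF m, of "\<bar>\<alpha> 0\<bar> + B"]) (use bd B0 in \<open>auto simp: indicator_def\<close>)
qed

section \<open>Test functions and weak derivatives\<close>

text \<open>\<open>smooth\<close> asks for the whole sequence of derivatives; a class closed under
  differentiation supplies it by iteration, without explicit formulas.\<close>

lemma smooth_coinduct: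
  assumes f: "f \<in> S" and step: "\<And>g. g \<in> S \<Longrightarrow> \<exists>g'\<in>S. \<forall>s. (g has_vector_derivative g' s) (at s)"
  shows "smooth f"
proof -
  obtain d where d: "\<And>g. g \<in> S \<Longrightarrow> d g \<in> S \<and> (\<forall>s. (g has_vector_derivative d g s) (at s))"
    using step by metis
  have "(d ^^ k) f \<in> S" for k by (induction k) (use f d in auto)
  then show ?thesis unfolding smooth_def
    by (intro exI[of _ "\<lambda>k. (d ^^ k) f"]) (use d in auto)
qed

lemma smooth_primitive:
  assumes "smooth f" "\<And>s. (F has_vector_derivative f s) (at s)"
  shows "smooth F"
proof -
  obtain Ds where Ds: "Ds 0 = f" "\<And>k s. (Ds k has_vector_derivative Ds (Suc k) s) (at s)"
    using assms(1) unfolding smooth_def by blast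
  show ?thesis unfolding smooth_def
    by (intro exI[of _ "\<lambda>k. case k of 0 \<Rightarrow> F | Suc j \<Rightarrow> Ds j"]) (use Ds assms(2) in \<open>auto split: nat.split\<close>)
qed

lemma smooth_bounded_linear:
  assumes "smooth f" "bounded_linear h"
  shows "smooth (\<lambda>s. h (f s))"
proof -
  obtain Ds where Ds: "Ds 0 = f" "\<And>k s. (Ds k has_vector_derivative Ds (Suc k) s) (at s)"
    using assms(1) unfolding smooth_def by blast
  show ?thesis unfolding smooth_def
    by (intro exI[of _ "\<lambda>k s. h (Ds k s)"])
       (use Ds in \<open>auto intro: bounded_linear.has_vector_derivative[OF assms(2)]\<close>)
qed

lemma smooth_diff:
  assumes "smooth f" "smooth g"
  shows "smooth (\<lambda>s. f s - g s)"
proof -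
  obtain F where F: "F 0 = f" "\<And>k s. (F k has_vector_derivative F (Suc k) s) (at s)"
    using assms(1) unfolding smooth_def by blast
  obtain G where G: "G 0 = g" "\<And>k s. (G k has_vector_derivative G (Suc k) s) (at s)"
    using assms(2) unfolding smooth_def by blast
  show ?thesis unfolding smooth_def
    by (intro exI[of _ "\<lambda>k s. F k s - G k s"])
       (use F G in \<open>auto intro: has_vector_derivative_diff\<close>)
qed

lemma smooth_affine:
  fixes f :: "real \<Rightarrow> 'a::real_normed_vector"
  assumes "smooth f"
  shows "smooth (\<lambda>s. f (c * s + d))"
proof -
  obtain Ds where Ds: "Ds 0 = f" "\<And>k s. (Ds k has_vector_derivative Ds (Suc k) s) (at s)"
    using assms(1) unfolding smooth_def by blast
  have "((\<lambda>s. c ^ k *\<^sub>R Ds k (c * s + d)) has_vector_derivative c ^ Suc k *\<^sub>R Ds (Suc k) (c * s + d)) (at s)" for k s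
  proof -
    have "((\<lambda>s. c * s + d) has_vector_derivative c) (at s)" by (auto intro!: derivative_eq_intros simp: has_real_derivative_iff_has_vector_derivative[symmetric])
    from vector_diff_chain_at[OF this Ds(2)[of k "c * s + d"]]
    have "((\<lambda>s. Ds k (c * s + d)) has_vector_derivative c *\<^sub>R Ds (Suc k) (c * s + d)) (at s)" by (simp add: o_def)
    from bounded_linear.has_vector_derivative[OF bounded_linear_scaleR_right[of "c ^ k"] this]
    show ?thesis by (simp add: mult.commute)
  qed
  then show ?thesis unfolding smooth_def
    by (intro exI[of _ "\<lambda>k s. c ^ k *\<^sub>R Ds k (c * s + d)"]) (auto simp: Ds(1))
qed

text \<open>Finite sums of products \<open>F i * G j\<close>, indexed by lists of pairs, are closed
  under differentiation: each pair (i, j) is replaced by (i + 1, j) and (i, j + 1). Lists admit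
  repetitions, so no binomial coefficients appear.\<close>

lemma smooth_mult:
  fixes f g :: "real \<Rightarrow> real"
  assumes "smooth f" "smooth g"
  shows "smooth (\<lambda>s. f s * g s)"
proof -
  obtain F where F: "F 0 = f" "\<And>k s. (F k has_real_derivative F (Suc k) s) (at s)"
    using assms(1) unfolding smooth_def has_real_derivative_iff_has_vector_derivative by blast
  obtain G where G: "G 0 = g" "\<And>k s. (G k has_real_derivative G (Suc k) s) (at s)"
    using assms(2) unfolding smooth_def has_real_derivative_iff_has_vector_derivative by blast
  define P where "P L s = sum_list (map (\<lambda>(i, j). F i s * G j s) L)" for L s
  define d where "d L = concat (map (\<lambda>(i, j). [(Suc i, j), (i, Suc j)]) L)" for L :: "(nat \<times> nat) list"
  have "(P L has_real_derivative P (d L) s) (at s)" for L s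
  proof (induction L)
    case Nil then show ?case by (simp add: P_def[abs_def] d_def)
  next
    case (Cons p L)
    obtain i j where p: "p = (i, j)" by (cases p)
    have "((\<lambda>s. F i s * G j s) has_real_derivative F (Suc i) s * G j s + F i s * G (Suc j) s) (at s)"
      using F(2)[of i s] G(2)[of j s] by (auto intro!: derivative_eq_intros)
    from DERIV_add[OF this Cons.IH] show ?case
      by (simp add: P_def[abs_def] d_def p algebra_simps)
  qed
  then show ?thesis
    by (intro smooth_coinduct[of _ "range P"])
       (auto simp: has_real_derivative_iff_has_vector_derivative F(1) G(1) P_def[abs_def]
         intro!: image_eqI[of _ _ "[(0,0)]"])
qed

section \<open>Cutoff functions with compact support\<close>

definition flat_exp :: "real \<Rightarrow> real" where
  "flat_exp x = (if x > 0 then exp (- (1 / x)) else 0)"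

lemma poly_div_exp_tendsto_0: "((\<lambda>y. poly p y / exp y) \<longlongrightarrow> (0::real)) at_top"
proof -
  have "((\<lambda>y. \<Sum>i\<le>degree p. coeff p i * (y ^ i / exp y)) \<longlongrightarrow> (\<Sum>i\<le>degree p. coeff p i * 0)) at_top"
    by (intro tendsto_sum tendsto_mult tendsto_const tendsto_power_div_exp_0)
  then show ?thesis by (simp add: poly_altdef sum_divide_distrib)
qed

text \<open>Functions equal to p(1 / x) exp(-1 / x) on the positive axis and 0 elsewhere, with p a
  polynomial, are closed under differentiation: in y = 1 / x the derivative has the polynomial y^2
  (p - p'), which is \<open>q p\<close>. At 0 the difference quotient from the right is y p(y) / exp
  y, whence \<open>pCons 0 p\<close>.\<close>

lemma smooth_flat_exp: "smooth flat_exp"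
proof -
  define P where "P p x = (if x > 0 then poly p (1 / x) * exp (- (1 / x)) else (0::real))" for p x
  define q where "q p = [:0, 0, 1:] * (p - pderiv p)" for p :: "real poly"
  have "(P p has_real_derivative P (q p) x) (at x)" for p x
  proof -
    consider "x > 0" | "x < 0" | "x = 0" by linarith
    then show ?thesis
    proof cases
      case 1
      have "((\<lambda>x. poly p (1 / x) * exp (- (1 / x))) has_real_derivative P (q p) x) (at x)"
        using 1 by (auto intro!: derivative_eq_intros simp: P_def q_def field_simps power2_eq_square)
      moreover have "\<forall>\<^sub>F y in nhds x. poly p (1 / y) * exp (- (1 / y)) = P p y"
        using eventually_nhds_in_open[of "{0<..}" x] 1 by (auto simp: P_def elim!: eventually_mono)
      ultimately show ?thesis by (subst (asm) DERIV_cong_ev[OF refl _ refl]) auto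
    next
      case 2
      have "((\<lambda>x. 0) has_real_derivative P (q p) x) (at x)" using 2 by (simp add: P_def)
      moreover have "\<forall>\<^sub>F y in nhds x. 0 = P p y"
        using eventually_nhds_in_open[of "{..<0}" x] 2 by (auto simp: P_def elim!: eventually_mono)
      ultimately show ?thesis by (subst (asm) DERIV_cong_ev[OF refl _ refl]) auto
    next
      case 3
      have "((\<lambda>y. poly (pCons 0 p) y / exp y) \<longlongrightarrow> 0) at_top" by (rule poly_div_exp_tendsto_0)
      then have "((\<lambda>h. poly (pCons 0 p) (inverse h) / exp (inverse h)) \<longlongrightarrow> 0) (at_right 0)"
        by (rule filterlim_compose[OF _ filterlim_inverse_at_top_right])
      moreover have "\<forall>\<^sub>F h in at_right 0. poly (pCons 0 p) (inverse h) / exp (inverse h) = P p h / h"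
        using eventually_at_right_less[of 0] by eventually_elim (simp add: P_def exp_minus field_simps)
      ultimately have "((\<lambda>h. P p h / h) \<longlongrightarrow> 0) (at_right 0)" by (rule Lim_transform_eventually)
      moreover have "((\<lambda>h. P p h / h) \<longlongrightarrow> 0) (at_left 0)"
        by (rule Lim_transform_eventually[OF tendsto_const])
           (auto simp: eventually_at_filter P_def)
      ultimately have "((\<lambda>h. P p h / h) \<longlongrightarrow> 0) (at 0)" by (simp add: filterlim_split_at)
      then show ?thesis using 3 by (simp add: DERIV_def P_def)
    qed
  qed
  moreover have "flat_exp = P 1" by (auto simp: flat_exp_def P_def)
  ultimately show ?thesis
    by (intro smooth_coinduct[of _ "range P"]) (auto simp: has_real_derivative_iff_has_vector_derivative)
qed

lemma flat_exp_bounds: "0 \<le> flat_exp x" "flat_exp x \<le> 1" "x \<le> 0 \<Longrightarrow> flat_exp x = 0"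
  by (auto simp: flat_exp_def)

lemma flat_exp_tendsto_1: "(flat_exp \<longlongrightarrow> 1) at_top"
proof -
  have "((\<lambda>x. exp (- (1 / x))) \<longlongrightarrow> exp (- 0)) (at_top :: real filter)"
    by (intro tendsto_intros tendsto_divide_0[OF tendsto_const] filterlim_at_top_imp_at_infinity filterlim_ident)
  moreover have "\<forall>\<^sub>F x in at_top. exp (- (1 / x)) = flat_exp x"
    using eventually_gt_at_top[of "0::real"] by eventually_elim (simp add: flat_exp_def)
  ultimately show ?thesis using Lim_transform_eventually by fastforce
qed

lemma test_funI:
  assumes "smooth f" "0 < a" "b < l" "\<And>s. s \<notin> {a..b} \<Longrightarrow> f s = 0"
  shows "test_fun l f"
  using assms unfolding test_fun_def by blast

lemma ex_test_fun_approximating_indicator: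
  assumes l: "l > 0" and t: "t \<in> {0..l}"
  obtains \<phi> :: "nat \<Rightarrow> real \<Rightarrow> real" where "\<And>n. test_fun l (\<phi> n)" "\<And>n s. 0 \<le> \<phi> n s \<and> \<phi> n s \<le> 1"
    "\<And>n s. s \<notin> {0<..<t} \<Longrightarrow> \<phi> n s = 0" "\<And>s. s \<in> {0<..<t} \<Longrightarrow> (\<lambda>n. \<phi> n s) \<longlonglongrightarrow> 1"
proof -
  \<comment> \<open>The margin is positive, so the support is compact in (0, l), yet
    \<open>n * \<delta> n\<close> stays below l; hence both arguments of \<open>flat_exp\<close>
    grow like n at each point of (0, t).\<close>
  define \<delta> where "\<delta> n = l / (real n + 2)" for n
  define \<phi> where "\<phi> n s = flat_exp (real n * s + (- real n * \<delta> n)) * flat_exp (- real n * s + real n * (t - \<delta> n))" for n s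
  have d0: "0 < \<delta> n" for n using l by (simp add: \<delta>_def)
  have z: "\<phi> n s = 0" if "s \<notin> {\<delta> n..t - \<delta> n}" for n s
  proof -
    have "real n * s + (- real n * \<delta> n) = real n * (s - \<delta> n)" "- real n * s + real n * (t - \<delta> n) = real n * (t - \<delta> n - s)"
      by (simp_all add: algebra_simps)
    moreover have "s - \<delta> n \<le> 0 \<or> t - \<delta> n - s \<le> 0" using that by auto
    ultimately show ?thesis unfolding \<phi>_def using flat_exp_bounds(3) by (auto simp: mult_nonneg_nonpos)
  qed
  show ?thesis
  proof (rule that)
    show "test_fun l (\<phi> n)" for n
    proof (rule test_funI[OF _ d0[of n]])
      show "smooth (\<phi> n)" unfolding \<phi>_def[abs_def] by (intro smooth_mult smooth_affine smooth_flat_exp)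
      show "t - \<delta> n < l" using d0[of n] t by auto
    qed (rule z)
    show "0 \<le> \<phi> n s \<and> \<phi> n s \<le> 1" for n s
      unfolding \<phi>_def using flat_exp_bounds(1,2) by (auto intro: mult_le_one)
    show "\<phi> n s = 0" if "s \<notin> {0<..<t}" for n s using z[of s n] that d0[of n] by auto
    show "(\<lambda>n. \<phi> n s) \<longlonglongrightarrow> 1" if s: "s \<in> {0<..<t}" for s
    proof -
      have lin: "filterlim (\<lambda>n. - l + c * real n) at_top sequentially" if "c > 0" for c
        by (rule filterlim_tendsto_add_at_top[OF tendsto_const
              filterlim_tendsto_pos_mult_at_top[OF tendsto_const that filterlim_real_sequentially]])
      have le: "real n * \<delta> n \<le> l" for n using l by (simp add: \<delta>_def field_simps)
      have 1: "filterlim (\<lambda>n. real n * s + (- real n * \<delta> n)) at_top sequentially"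
        using lin[of s] s le by (rule_tac filterlim_at_top_mono) (auto intro!: always_eventually)
      have 2: "filterlim (\<lambda>n. - real n * s + real n * (t - \<delta> n)) at_top sequentially"
        using lin[of "t - s"] s le by (rule_tac filterlim_at_top_mono) (auto intro!: always_eventually simp: algebra_simps)
      have "(\<lambda>n. \<phi> n s) \<longlonglongrightarrow> 1 * 1" unfolding \<phi>_def
        by (intro tendsto_mult filterlim_compose[OF flat_exp_tendsto_1] 1 2)
      then show ?thesis by simp
    qed
  qed
qed

lemma test_fun_W1inf:
  fixes \<xi> :: "real \<Rightarrow> 'a::euclidean_space"
  assumes t: "test_fun l \<xi>" and l: "l > 0"
  shows "W1inf l \<xi>" "\<xi> 0 = 0" "\<xi> l = 0"
    "s \<in> {0..l} \<Longrightarrow> Dl l \<xi> s = vector_derivative \<xi> (at s)"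
    "(\<xi> has_vector_derivative vector_derivative \<xi> (at x)) (at x)"
    "continuous_on A (\<lambda>s. vector_derivative \<xi> (at s))"
    "continuous_on A \<xi>"
proof -
  obtain Ds where Ds: "Ds 0 = \<xi>" "\<And>k s. (Ds k has_vector_derivative Ds (Suc k) s) (at s)"
    using t unfolding test_fun_def smooth_def by blast
  obtain a b where ab: "0 < a" "b < l" "\<And>s. s \<notin> {a..b} \<Longrightarrow> \<xi> s = 0" using t unfolding test_fun_def by blast
  have d1: "(\<xi> has_vector_derivative Ds 1 x) (at x)" for x using Ds(2)[of 0 x] Ds(1) by simp
  have vd: "vector_derivative \<xi> (at x) = Ds 1 x" for x using d1 by (rule vector_derivative_at)
  have cD: "continuous_on A (Ds k)" for k A
    using Ds(2)[THEN has_vector_derivative_continuous] by (simp add: continuous_at_imp_continuous_on)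
  show "\<xi> 0 = 0" "\<xi> l = 0" using ab(1,2) by (auto intro!: ab(3))
  show d: "(\<xi> has_vector_derivative vector_derivative \<xi> (at x)) (at x)" for x using d1 vd by simp
  show "continuous_on A (\<lambda>s. vector_derivative \<xi> (at s))" unfolding vd using cD[of A 1] by simp
  show "continuous_on A \<xi>" using cD[of A 0] Ds(1) by simp
  show "s \<in> {0..l} \<Longrightarrow> Dl l \<xi> s = vector_derivative \<xi> (at s)"
    by (rule Dl_eqI[OF has_vector_derivative_at_within[OF d] _ l])
  show "W1inf l \<xi>"
  proof (rule primitive_W1inf(1)[OF Linf_continuous[OF cD[of _ 1]] _ l])
    fix t assume t: "t \<in> {0..l}"
    have "(Ds 1 has_integral \<xi> t - \<xi> 0) {0..t}"
      proof (rule fundamental_theorem_of_calculus)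
      show "(\<xi> has_vector_derivative Ds 1 x) (at x within {0..t})" for x
        by (rule has_vector_derivative_at_within[OF d1])
    qed (use t in auto)
    then show "\<xi> t = \<xi> 0 + integral {0..t} (Ds 1)" by (simp add: integral_unique)
  qed
qed

lemma integral_test_fun_limit:
  fixes f :: "real \<Rightarrow> real"
  assumes f: "Linf l f" and t: "t \<in> {0..l}"
    and \<phi>: "\<And>n. continuous_on {0..l} (\<phi> n)" "\<And>n s. 0 \<le> \<phi> n s \<and> \<phi> n s \<le> 1"
    "\<And>n s. s \<notin> {0<..<t} \<Longrightarrow> \<phi> n s = 0" "\<And>s. s \<in> {0<..<t} \<Longrightarrow> (\<lambda>n. \<phi> n s) \<longlonglongrightarrow> 1"
  shows "(\<lambda>n. integral {0..l} (\<lambda>s. f s * \<phi> n s)) \<longlonglongrightarrow> integral {0..t} f"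
proof -
  obtain h C where h: "h \<in> borel_measurable borel" "\<And>s. norm (h s) \<le> C" "AE s in lborel. s \<in> {0..l} \<longrightarrow> f s = h s"
    using LinfE[OF f] by blast
  have hL: "Linf l h" using h by (intro LinfI[OF h(1,2)]) auto
  have 1: "integral {0..l} (\<lambda>s. f s * \<phi> n s) = integral {0..l} (\<lambda>s. h s * \<phi> n s)" for n
    by (rule integral_cong_AE_interval) (use h(3) in \<open>eventually_elim, auto\<close>)
  define k where "k s = indicator {0<..<t} s * h s" for s
  have "(\<lambda>n. integral {0..l} (\<lambda>s. h s * \<phi> n s)) \<longlonglongrightarrow> integral {0..l} k"
  proof (rule dominated_convergence(2)[where h="\<lambda>_. C"])
    show "(\<lambda>s. h s * \<phi> n s) integrable_on {0..l}" for n
      by (rule Linf_integrable[OF Linf_mult[OF hL Linf_continuous[OF \<phi>(1)]]]) auto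
    show "norm (h s * \<phi> n s) \<le> C" if "s \<in> {0..l}" for n s
    proof -
      have "norm (h s * \<phi> n s) \<le> norm (h s) * 1"
        unfolding norm_mult using \<phi>(2)[of n s] by (intro mult_left_mono) auto
      then show ?thesis using h(2)[of s] by simp
    qed
    show "(\<lambda>n. h s * \<phi> n s) \<longlonglongrightarrow> k s" if "s \<in> {0..l}" for s
    proof (cases "s \<in> {0<..<t}")
      case True
      have "(\<lambda>n. h s * \<phi> n s) \<longlonglongrightarrow> h s * 1" by (intro tendsto_intros \<phi>(4) True)
      then show ?thesis using True by (simp add: k_def)
    next
      case False
      then show ?thesis using \<phi>(3)[OF False] by (simp add: k_def)
    qed
  qed (rule integrable_const_ivl)
  moreover have "integral {0..l} k = integral {0..t} f"
  proof -
    have "integral {0..t} f = integral {0..t} h"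
      by (rule integral_cong_AE_interval) (use h(3) in \<open>eventually_elim, use t in auto\<close>)
    also have "\<dots> = integral {0<..<t} h" by (simp add: integral_open_interval_real)
    also have "\<dots> = integral {0..l} (\<lambda>s. if s \<in> {0<..<t} then h s else 0)"
    proof -
      have "{0<..<t} \<inter> {0..l} = {0<..<t}" using t by auto
      then show ?thesis by (simp only: integral_restrict_Int)
    qed
    also have "\<dots> = integral {0..l} k" by (rule integral_cong) (auto simp: k_def indicator_def)
    finally show ?thesis by simp
  qed
  ultimately show ?thesis by (simp add: 1)
qed

section \<open>Fundamental lemma and weak derivatives\<close>

lemma fundamental_lemma_calculus_of_variations:
  fixes f :: "real \<Rightarrow> real"
  assumes f: "Linf l f" and l: "l > 0"
    and z: "\<And>\<phi>. test_fun l \<phi> \<Longrightarrow> integral {0..l} (\<lambda>s. f s * \<phi> s) = 0"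
  shows "AE s in lborel. s \<in> {0..l} \<longrightarrow> f s = 0"
proof (rule Linf_zero_of_integral_zero[OF f _ l])
  fix t assume t: "t \<in> {0..l}"
  obtain \<phi> :: "nat \<Rightarrow> real \<Rightarrow> real" where \<phi>: "\<And>n. test_fun l (\<phi> n)" "\<And>n s. 0 \<le> \<phi> n s \<and> \<phi> n s \<le> 1"
    "\<And>n s. s \<notin> {0<..<t} \<Longrightarrow> \<phi> n s = 0" "\<And>s. s \<in> {0<..<t} \<Longrightarrow> (\<lambda>n. \<phi> n s) \<longlonglongrightarrow> 1"
    using ex_test_fun_approximating_indicator[OF l t] by blast
  have "(\<lambda>n. integral {0..l} (\<lambda>s. f s * \<phi> n s)) \<longlonglongrightarrow> integral {0..t} f"
    by (rule integral_test_fun_limit[OF f t test_fun_W1inf(7)[OF \<phi>(1) l] \<phi>(2,3,4)])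
  then show "integral {0..t} f = 0" using z[OF \<phi>(1)] by (simp add: LIMSEQ_const_iff)
qed

text \<open>Mean zero is exactly what makes the primitive vanish again to the right of the
  support.\<close>

lemma integral_mean_zero_test_fun:
  fixes f :: "real \<Rightarrow> real"
  assumes f: "test_fun l f" and z: "integral {0..l} f = 0" and l: "l > 0"
  obtains \<xi> where "test_fun l \<xi>" "\<And>s. vector_derivative \<xi> (at s) = f s"
proof -
  obtain a b where ab: "0 < a" "b < l" "\<And>s. s \<notin> {a..b} \<Longrightarrow> f s = 0" using f unfolding test_fun_def by blast
  have cf: "continuous_on A f" for A by (rule test_fun_W1inf(7)[OF f l])
  define \<xi> where "\<xi> s = integral {-1..s} f" for s
  have z1: "\<xi> s = 0" if "s < a" for s
  proof -
    have "integral {-1..s} f = integral {-1..s} (\<lambda>_. 0)" by (rule integral_cong) (use that ab(3) in auto)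
    then show ?thesis by (simp add: \<xi>_def)
  qed
  have z2: "\<xi> s = 0" if "b < s" for s
  proof (cases "s < a")
    case False
    have i: "(f has_integral integral {a..b} f) {a..b}"
      by (intro integrable_integral integrable_continuous_real cf)
    have "(f has_integral integral {a..b} f) {-1..s}" "(f has_integral integral {a..b} f) {0..l}"
      by (rule has_integral_on_superset[OF i]; use ab that in auto)+
    then show ?thesis using z unfolding \<xi>_def by (metis integral_unique)
  qed (use z1 in auto)
  have d: "(\<xi> has_vector_derivative f s) (at s)" for s
  proof (cases "s < a")
    case True
    have "((\<lambda>_. 0) has_vector_derivative f s) (at s)" using ab(3)[of s] True by simp
    then show ?thesis
      by (rule has_vector_derivative_transform_within_open[of _ _ _ "{..<a}"]) (use True z1 in auto)
  next
    case False
    have "(\<xi> has_vector_derivative f s) (at s within {-1..s+1})"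
      unfolding \<xi>_def[abs_def] by (rule integral_has_vector_derivative[OF cf]) (use False ab(1) in auto)
    then show ?thesis using False ab(1) by (simp add: at_within_Icc_at)
  qed
  have "test_fun l \<xi>"
  proof (rule test_funI[OF _ ab(1,2)])
    show "smooth \<xi>" using f d unfolding test_fun_def by (blast intro: smooth_primitive)
    show "\<xi> s = 0" if "s \<notin> {a..b}" for s using z1[of s] z2[of s] that by (auto simp: not_le)
  qed
  with that show ?thesis using d vector_derivative_at by blast
qed

lemma test_fun_bounded_linear:
  assumes "test_fun l f" "bounded_linear h"
  shows "test_fun l (\<lambda>s. h (f s))"
  using assms smooth_bounded_linear[of f h] unfolding test_fun_def by (metis linear_0 bounded_linear.linear)

lemma test_fun_diff:
  assumes "test_fun l f" "test_fun l g"
  shows "test_fun l (\<lambda>s. f s - g s)"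
proof -
  obtain a b where ab: "0 < a" "b < l" "\<And>s. s \<notin> {a..b} \<Longrightarrow> f s = 0" using assms(1) unfolding test_fun_def by blast
  obtain c d where cd: "0 < c" "d < l" "\<And>s. s \<notin> {c..d} \<Longrightarrow> g s = 0" using assms(2) unfolding test_fun_def by blast
  show ?thesis
  proof (rule test_funI[of _ "min a c" "max b d"])
    show "smooth (\<lambda>s. f s - g s)" using assms unfolding test_fun_def by (blast intro: smooth_diff)
    show "f s - g s = 0" if "s \<notin> {min a c..max b d}" for s
    proof -
      have "s \<notin> {a..b}" "s \<notin> {c..d}" using that by auto
      then show ?thesis using ab(3) cd(3) by simp
    qed
  qed (use ab cd in auto)
qed

text \<open>Fix a test function \<psi> of integral 1. Every test function \<theta> differs from a
  multiple of \<psi> by the derivative of a test function, so testing f with \<theta> gives the same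
  as testing the constant c, the integral of f \<psi>.\<close>

lemma du_Bois_Reymond_real:
  fixes f :: "real \<Rightarrow> real"
  assumes f: "Linf l f" and l: "l > 0"
    and z: "\<And>\<xi>. test_fun l \<xi> \<Longrightarrow> integral {0..l} (\<lambda>s. f s * vector_derivative \<xi> (at s)) = 0"
  obtains c where "AE s in lborel. s \<in> {0..l} \<longrightarrow> f s = c"
proof -
  obtain \<phi> :: "nat \<Rightarrow> real \<Rightarrow> real" where \<phi>: "\<And>n. test_fun l (\<phi> n)" "\<And>n s. 0 \<le> \<phi> n s \<and> \<phi> n s \<le> 1"
    "\<And>n s. s \<notin> {0<..<l} \<Longrightarrow> \<phi> n s = 0" "\<And>s. s \<in> {0<..<l} \<Longrightarrow> (\<lambda>n. \<phi> n s) \<longlonglongrightarrow> 1"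
    using ex_test_fun_approximating_indicator[OF l, of l] l by auto
  have "(\<lambda>n. integral {0..l} (\<lambda>s. 1 * \<phi> n s)) \<longlonglongrightarrow> integral {0..l} (\<lambda>_. 1 :: real)"
    by (rule integral_test_fun_limit[OF Linf_const _ test_fun_W1inf(7)[OF \<phi>(1) l] \<phi>(2,3,4)]) (use l in auto)
  then have "\<forall>\<^sub>F n in sequentially. integral {0..l} (\<phi> n) > 0"
    using l by (intro order_tendstoD(1)[of _ l]) auto
  then obtain n where n: "integral {0..l} (\<phi> n) > 0" by (auto dest: eventually_happens)
  define \<psi> where "\<psi> s = \<phi> n s / integral {0..l} (\<phi> n)" for s
  have \<psi>: "test_fun l \<psi>" unfolding \<psi>_def[abs_def]
    by (rule test_fun_bounded_linear[OF \<phi>(1) bounded_linear_divide])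
  have i\<psi>: "integral {0..l} \<psi> = 1" using n by (simp add: \<psi>_def[abs_def])
  define c where "c = integral {0..l} (\<lambda>s. f s * \<psi> s)"
  have "AE s in lborel. s \<in> {0..l} \<longrightarrow> f s - c = 0"
  proof (rule fundamental_lemma_calculus_of_variations[OF _ l])
    show "Linf l (\<lambda>s. f s - c)" by (intro Linf_diff f Linf_const)
    fix \<theta> :: "real \<Rightarrow> real" assume \<theta>: "test_fun l \<theta>"
    define m where "m = integral {0..l} \<theta>"
    have int: "\<theta> integrable_on {0..l}" "\<psi> integrable_on {0..l}"
      using test_fun_W1inf(7)[OF \<theta> l] test_fun_W1inf(7)[OF \<psi> l] integrable_continuous_real by blast+
    have int2: "(\<lambda>s. f s * \<theta> s) integrable_on {0..l}" "(\<lambda>s. f s * \<psi> s) integrable_on {0..l}"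
      by (rule Linf_integrable[OF Linf_mult[OF f Linf_continuous[OF test_fun_W1inf(7)[OF _ l]]]]; use \<theta> \<psi> in auto)+
    have cm: "(\<lambda>s. c * h s) integrable_on {0..l}" if "h integrable_on {0..l}" for c and h :: "real \<Rightarrow> real"
      using integrable_cmul[OF that, of c] by simp
    have t: "test_fun l (\<lambda>s. \<theta> s - m * \<psi> s)"
      by (intro test_fun_diff \<theta> test_fun_bounded_linear[OF \<psi> bounded_linear_mult_right])
    have "integral {0..l} (\<lambda>s. \<theta> s - m * \<psi> s) = m - m * 1"
      using int(1) cm[OF int(2), of m] by (subst integral_diff) (auto simp: m_def i\<psi>)
    then obtain \<xi> where \<xi>: "test_fun l \<xi>" "\<And>s. vector_derivative \<xi> (at s) = \<theta> s - m * \<psi> s"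
      using integral_mean_zero_test_fun[OF t _ l] by auto
    have "0 = integral {0..l} (\<lambda>s. f s * \<theta> s - m * (f s * \<psi> s))"
      using z[OF \<xi>(1)] by (simp add: \<xi>(2) algebra_simps)
    also have "\<dots> = integral {0..l} (\<lambda>s. f s * \<theta> s) - m * c"
      using int2(1) cm[OF int2(2), of m] by (subst integral_diff) (auto simp: c_def)
    also have "\<dots> = integral {0..l} (\<lambda>s. f s * \<theta> s - c * \<theta> s)"
      using cm[OF int(1), of c] int2(1) by (subst integral_diff) (auto simp: m_def)
    finally show "integral {0..l} (\<lambda>s. (f s - c) * \<theta> s) = 0" by (simp add: algebra_simps)
  qed
  then have "AE s in lborel. s \<in> {0..l} \<longrightarrow> f s = c" by eventually_elim auto
  then show ?thesis by (rule that)
qed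

lemma indefinite_integral_W1inf:
  fixes w :: "real \<Rightarrow> 'a::euclidean_space"
  assumes w: "Linf l w" and l: "l > 0"
  shows "W1inf l (\<lambda>t. c + integral {0..t} w)"
    "AE s in lborel. s \<in> {0..l} \<longrightarrow> Dl l (\<lambda>t. c + integral {0..t} w) s = w s"
  by (rule primitive_W1inf[OF w _ l], simp)+

text \<open>Subtracting the primitive \<open>W\<close> of \<open>w\<close> leaves, in each
  coordinate, a function with vanishing weak derivative, which is constant by du Bois-Reymond. The
  representative is \<open>W\<close> plus the vector of these constants.\<close>

theorem weak_derivative_W1inf:
  fixes f w :: "real \<Rightarrow> 'a::euclidean_space"
  assumes f: "Linf l f" and w: "Linf l w" and l: "l > 0"
    and z: "\<And>\<xi>. test_fun l \<xi> \<Longrightarrow> integral {0..l} (\<lambda>s. f s \<bullet> vector_derivative \<xi> (at s) + w s \<bullet> \<xi> s) = 0"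
  obtains V where "W1inf l V" "AE s in lborel. s \<in> {0..l} \<longrightarrow> V s = f s" "AE s in lborel. s \<in> {0..l} \<longrightarrow> Dl l V s = w s"
proof -
  define W where "W t = 0 + integral {0..t} w" for t
  have W: "W1inf l W" "AE s in lborel. s \<in> {0..l} \<longrightarrow> Dl l W s = w s"
    using indefinite_integral_W1inf[OF w l, of 0] unfolding W_def[abs_def] by blast+
  have WL: "Linf l W" by (rule Linf_continuous[OF W1inf_continuous[OF W(1)]])
  have "\<exists>c. AE s in lborel. s \<in> {0..l} \<longrightarrow> (f s - W s) \<bullet> b = c" for b :: 'a
  proof (rule du_Bois_Reymond_real[OF _ l])
    show "Linf l (\<lambda>s. (f s - W s) \<bullet> b)" by (intro Linf_inner Linf_diff f WL Linf_const)
    fix \<phi> :: "real \<Rightarrow> real" assume \<phi>: "test_fun l \<phi>"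
    define \<xi> where "\<xi> s = \<phi> s *\<^sub>R b" for s
    have \<xi>: "test_fun l \<xi>" unfolding \<xi>_def[abs_def]
      by (rule test_fun_bounded_linear[OF \<phi> bounded_linear_scaleR_left])
    define d where "d s = vector_derivative \<phi> (at s)" for s
    have d: "vector_derivative \<xi> (at s) = d s *\<^sub>R b" for s
      unfolding \<xi>_def[abs_def] d_def
      by (intro vector_derivative_at bounded_linear.has_vector_derivative[OF bounded_linear_scaleR_left] test_fun_W1inf(5)[OF \<phi> l])
    have dL: "Linf l d" unfolding d_def[abs_def] by (intro Linf_continuous test_fun_W1inf(6)[OF \<phi> l])
    have \<phi>L: "Linf l \<phi>" by (intro Linf_continuous test_fun_W1inf(7)[OF \<phi> l])
    have bp: "((\<lambda>s. W s \<bullet> Dl l \<xi> s + Dl l W s \<bullet> \<xi> s) has_integral W l \<bullet> \<xi> l - W 0 \<bullet> \<xi> 0) {0..l}"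
      by (rule integration_by_parts_W1inf[OF bounded_bilinear_inner W(1) test_fun_W1inf(1)[OF \<xi> l] l])
    have ae: "AE s in lborel. s \<in> {0..l} \<longrightarrow> W s \<bullet> Dl l \<xi> s + Dl l W s \<bullet> \<xi> s = (W s \<bullet> b) * d s + (w s \<bullet> b) * \<phi> s"
      using W(2) by eventually_elim (use test_fun_W1inf(4)[OF \<xi> l] d in \<open>auto simp: \<xi>_def\<close>)
    have 1: "((\<lambda>s. (W s \<bullet> b) * d s + (w s \<bullet> b) * \<phi> s) has_integral 0) {0..l}"
      using iffD1[OF has_integral_AE[OF ae] bp] test_fun_W1inf(2,3)[OF \<xi> l] by simp
    have "(\<lambda>s. (f s \<bullet> b) * d s + (w s \<bullet> b) * \<phi> s) integrable_on {0..l}"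
      by (rule Linf_integrable[of l], intro Linf_add Linf_mult Linf_inner f w Linf_const dL \<phi>L) auto
    moreover have "integral {0..l} (\<lambda>s. (f s \<bullet> b) * d s + (w s \<bullet> b) * \<phi> s) = 0"
      using z[OF \<xi>] unfolding d by (simp add: \<xi>_def mult.commute)
    ultimately have 2: "((\<lambda>s. (f s \<bullet> b) * d s + (w s \<bullet> b) * \<phi> s) has_integral 0) {0..l}"
      by (simp add: has_integral_iff)
    show "integral {0..l} (\<lambda>s. ((f s - W s) \<bullet> b) * vector_derivative \<phi> (at s)) = 0"
      using integral_unique[OF has_integral_diff[OF 2 1]] by (simp add: d_def inner_diff_left algebra_simps)
  qed blast
  then obtain c where c: "\<And>b::'a. AE s in lborel. s \<in> {0..l} \<longrightarrow> (f s - W s) \<bullet> b = c b" by metis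
  define v where "v = (\<Sum>b\<in>Basis. c b *\<^sub>R b)"
  have "AE s in lborel. \<forall>b\<in>Basis. s \<in> {0..l} \<longrightarrow> (f s - W s) \<bullet> b = c b"
    by (rule AE_finite_allI) (use c in auto)
  then have ae: "AE s in lborel. s \<in> {0..l} \<longrightarrow> v + W s = f s"
  proof eventually_elim
    case (elim s)
    show ?case
    proof
      assume s: "s \<in> {0..l}"
      have "f s - W s = (\<Sum>b\<in>Basis. ((f s - W s) \<bullet> b) *\<^sub>R b)" by (simp only: euclidean_representation)
      also have "\<dots> = v" unfolding v_def by (rule sum.cong) (use elim s in simp_all)
      finally show "v + W s = f s" by (simp add: algebra_simps)
    qed
  qed
  show ?thesis
  proof (rule that[of "\<lambda>t. v + integral {0..t} w"])
    show "AE s in lborel. s \<in> {0..l} \<longrightarrow> v + integral {0..s} w = f s" using ae by (simp add: W_def)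
  qed (rule indefinite_integral_W1inf[OF w l])+
qed

lemma W1inf_weak_derivative:
  fixes V :: "real \<Rightarrow> 'a::euclidean_space"
  assumes V: "W1inf l V" and l: "l > 0" and \<xi>: "test_fun l \<xi>"
  shows "((\<lambda>s. V s \<bullet> vector_derivative \<xi> (at s) + Dl l V s \<bullet> \<xi> s) has_integral 0) {0..l}"
proof -
  have "((\<lambda>s. V s \<bullet> Dl l \<xi> s + Dl l V s \<bullet> \<xi> s) has_integral V l \<bullet> \<xi> l - V 0 \<bullet> \<xi> 0) {0..l}"
    by (rule integration_by_parts_W1inf[OF bounded_bilinear_inner V test_fun_W1inf(1)[OF \<xi> l] l])
  then have "((\<lambda>s. V s \<bullet> Dl l \<xi> s + Dl l V s \<bullet> \<xi> s) has_integral 0) {0..l}"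
    using test_fun_W1inf(2,3)[OF \<xi> l] by simp
  then show ?thesis
    by (rule has_integral_eq[rotated]) (simp add: test_fun_W1inf(4)[OF \<xi> l])
qed

section \<open>From almost everywhere to everywhere; derivatives at zeros\<close>

lemma AE_interval_continuous_le:
  fixes f :: "real \<Rightarrow> real"
  assumes f: "continuous_on {0..l} f" and ae: "AE s in lborel. s \<in> {0..l} \<longrightarrow> f s \<le> 0" and l: "l > 0"
    and s: "s \<in> {0..l}"
  shows "f s \<le> 0"
proof (rule ccontr)
  assume "\<not> f s \<le> 0"
  then have "f s > 0" by simp
  then obtain d where d: "d > 0" "\<And>t. t \<in> {0..l} \<Longrightarrow> dist t s < d \<Longrightarrow> dist (f t) (f s) < f s"
    using f s unfolding continuous_on_iff by meson
  define a where "a = max 0 (s - d)"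
  define b where "b = min l (s + d)"
  have ab: "a < b" using s d l by (auto simp: a_def b_def)
  have pos: "f t > 0" if "t \<in> {a<..<b}" for t
  proof -
    have "dist (f t) (f s) < f s" using that by (intro d(2)) (auto simp: a_def b_def dist_real_def abs_less_iff)
    then show ?thesis by (simp add: dist_real_def abs_less_iff)
  qed
  have "AE t in lborel. t \<notin> {a<..<b}"
    using ae
  proof eventually_elim
    case (elim t)
    have "t \<in> {0..l}" if "t \<in> {a<..<b}" using that by (auto simp: a_def b_def)
    then show ?case using elim pos[of t] by auto
  qed
  then have "{a<..<b} \<in> null_sets lborel" by (subst (asm) AE_iff_null_sets[symmetric]) auto
  then show False using ab by (auto simp: null_sets_def)
qed

lemma AE_interval_continuous_eq:
  fixes f g :: "real \<Rightarrow> 'a::real_normed_vector"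
  assumes "continuous_on {0..l} f" "continuous_on {0..l} g" "AE s in lborel. s \<in> {0..l} \<longrightarrow> f s = g s" "l > 0" "s \<in> {0..l}"
  shows "f s = g s"
proof -
  have "norm (f s - g s) \<le> 0"
  proof (rule AE_interval_continuous_le[of l "\<lambda>s. norm (f s - g s)"])
    show "AE s in lborel. s \<in> {0..l} \<longrightarrow> norm (f s - g s) \<le> 0" using assms(3) by eventually_elim auto
  qed (use assms in \<open>auto intro!: continuous_intros\<close>)
  then show ?thesis by simp
qed

lemma integral_mono_AE_Linf:
  fixes f g :: "real \<Rightarrow> real"
  assumes "Linf l f" "Linf l g" "AE s in lborel. s \<in> {0..l} \<longrightarrow> f s \<le> g s"
  shows "integral {0..l} f \<le> integral {0..l} g"
proof -
  have ae: "AE s in lborel. s \<in> {0..l} \<longrightarrow> f s = min (f s) (g s)" using assms(3) by eventually_elim auto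
  have 1: "integral {0..l} f = integral {0..l} (\<lambda>s. min (f s) (g s))" by (rule integral_cong_AE_interval[OF ae])
  have "Linf l (\<lambda>s. min (f s) (g s))" by (rule Linf_cong_AE[OF assms(1)]) (use ae in \<open>eventually_elim, auto\<close>)
  then have "integral {0..l} (\<lambda>s. min (f s) (g s)) \<le> integral {0..l} g"
    using assms(2) by (intro integral_le Linf_integrable[of l]) auto
  then show ?thesis using 1 by simp
qed

lemma Linf_norm:
  assumes "Linf l f"
  shows "Linf l (\<lambda>s. norm (f s))"
proof -
  obtain h C where h: "h \<in> borel_measurable borel" "\<And>s. norm (h s) \<le> C" "AE s in lborel. s \<in> {0..l} \<longrightarrow> f s = h s"
    using LinfE[OF assms] by blast
  show ?thesis
  proof (rule LinfI)
    show "(\<lambda>s. norm (h s)) \<in> borel_measurable borel" using h(1) by simp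
    show "norm (norm (h s)) \<le> C" for s using h(2)[of s] by simp
    show "AE s in lborel. s \<in> {0..l} \<longrightarrow> norm (f s) = norm (h s)" using h(3) by eventually_elim auto
  qed
qed

lemma Linf_reciprocal:
  fixes f :: "real \<Rightarrow> real"
  assumes "Linf l f" and b: "\<And>s. s \<in> {0..l} \<Longrightarrow> \<bar>1 / f s\<bar> \<le> C"
  shows "Linf l (\<lambda>s. 1 / f s)"
proof -
  obtain h where h: "h \<in> borel_measurable borel" "AE s in lborel. s \<in> {0..l} \<longrightarrow> f s = h s"
    using LinfE[OF assms(1)] by blast
  show ?thesis
  proof (rule LinfI)
    show "(\<lambda>s. if \<bar>1 / h s\<bar> \<le> C then 1 / h s else 0) \<in> borel_measurable borel" using h(1) by measurable
    show "norm (if \<bar>1 / h s\<bar> \<le> C then 1 / h s else 0) \<le> max C 0" for s by auto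
    show "AE s in lborel. s \<in> {0..l} \<longrightarrow> 1 / f s = (if \<bar>1 / h s\<bar> \<le> C then 1 / h s else 0)"
      using h(2)
    proof eventually_elim
      case (elim s)
      then show ?case using b[of s] by auto
    qed
  qed
qed

lemma W1inf_constant_Dl_AE:
  fixes f :: "real \<Rightarrow> 'a::euclidean_space"
  assumes "\<And>s. s \<in> {0..l} \<Longrightarrow> f s = c" "l > 0" "s \<in> {0..l}"
  shows "Dl l f s = 0"
proof (rule Dl_eqI[OF _ assms(3,2)])
  show "(f has_vector_derivative 0) (at s within {0..l})"
    by (rule has_vector_derivative_transform[OF assms(3) _ has_vector_derivative_const]) (use assms in auto)
qed

lemma orthogonal_Dl_AE:
  fixes f g :: "real \<Rightarrow> 'a::euclidean_space"
  assumes f: "W1inf l f" and g: "W1inf l g" and c: "\<And>s. s \<in> {0..l} \<Longrightarrow> f s \<bullet> g s = c" and l: "l > 0"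
  shows "AE s in lborel. s \<in> {0..l} \<longrightarrow> f s \<bullet> Dl l g s + Dl l f s \<bullet> g s = 0"
  using W1inf_bounded_bilinear(2)[OF bounded_bilinear_inner f g l]
  by eventually_elim (use W1inf_constant_Dl_AE[of l "\<lambda>s. f s \<bullet> g s" c, OF c l] in auto)

lemma vector_derivative_zero_at_interior_min:
  fixes g :: "real \<Rightarrow> real"
  assumes g: "\<And>t. t \<in> {0..l} \<Longrightarrow> g t \<ge> 0" and s: "0 < s" "s < l" "g s = 0"
    and d: "(g has_vector_derivative d) (at s within {0..l})"
  shows "d = 0"
proof -
  have "(g has_real_derivative d) (at s)"
    using d s by (simp add: at_within_Icc_at has_real_derivative_iff_has_vector_derivative)
  then show ?thesis
    by (rule DERIV_local_min[of _ _ _ "min s (l - s)"]) (use s g in \<open>auto simp: abs_less_iff\<close>)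
qed

text \<open>The point s is an interior minimum of g and, for every coordinate direction b, of the
  nonnegative function c g + V \<bullet> b. This handles the points where g vanishes and the
  equations cannot be divided by it.\<close>

lemma vector_derivative_zero_of_norm_le:
  fixes V :: "real \<Rightarrow> 'a::euclidean_space" and g :: "real \<Rightarrow> real"
  assumes V: "\<And>t. t \<in> {0..l} \<Longrightarrow> norm (V t) \<le> c * g t" and c: "c > 0"
    and s: "0 < s" "s < l" "g s = 0"
    and dg: "(g has_vector_derivative d) (at s within {0..l})"
    and dV: "(V has_vector_derivative D) (at s within {0..l})"
  shows "d = 0 \<and> D = 0"
proof
  have g0: "g t \<ge> 0" if "t \<in> {0..l}" for t
    using order_trans[OF norm_ge_zero V[OF that]] c by (simp add: zero_le_mult_iff)
  show d: "d = 0" by (rule vector_derivative_zero_at_interior_min[OF g0 s dg])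
  have Vs: "V s = 0" using V[of s] s by simp
  show "D = 0"
  proof (rule euclidean_eqI)
    fix b :: 'a assume b: "b \<in> Basis"
    have "((\<lambda>t. c * g t + V t \<bullet> b) has_vector_derivative c * d + D \<bullet> b) (at s within {0..l})"
      by (intro has_vector_derivative_add bounded_linear.has_vector_derivative[OF bounded_linear_mult_right]
          bounded_linear.has_vector_derivative[OF bounded_linear_inner_left] dg dV)
    then have "c * d + D \<bullet> b = 0"
    proof (rule vector_derivative_zero_at_interior_min[rotated -1])
      fix t assume "t \<in> {0..l}"
      then show "0 \<le> c * g t + V t \<bullet> b" using Basis_le_norm[OF b, of "V t"] V[of t] by linarith
    qed (use s Vs in auto)
    then show "D \<bullet> b = 0 \<bullet> b" using d by simp
  qed
qed

section \<open>Admissible curves\<close>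

text \<open>Gram-Schmidt for an orthogonal pair whose first vector is a unit vector. For W = 0 the
  quotient is 0 by the convention for division by zero, and the formula stays correct.\<close>

lemma proj_perp_orthogonal:
  fixes V W x :: "'a::euclidean_space"
  assumes V: "norm V = 1" and VW: "V \<bullet> W = 0"
  shows "proj_perp V W x = x - (x \<bullet> V) *\<^sub>R V - ((x \<bullet> W) / (W \<bullet> W)) *\<^sub>R W"
proof -
  define U where "U = {u. \<forall>z\<in>span {V, W}. u \<bullet> z = 0}"
  have VV: "V \<bullet> V = 1" using V by (simp add: norm_eq_1)
  have U: "u \<in> U \<longleftrightarrow> u \<bullet> V = 0 \<and> u \<bullet> W = 0" for u
  proof
    assume "u \<bullet> V = 0 \<and> u \<bullet> W = 0"
    then show "u \<in> U" unfolding U_def using orthogonal_to_span[of _ "{V, W}" u]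
      by (auto simp: orthogonal_def inner_commute)
  qed (auto simp: U_def span_base)
  define p where "p = x - (x \<bullet> V) *\<^sub>R V - ((x \<bullet> W) / (W \<bullet> W)) *\<^sub>R W"
  have pU: "p \<in> U" unfolding U p_def using VV VW
    by (cases "W = 0") (auto simp: inner_diff_left inner_diff_right inner_commute)
  have orth: "(x - p) \<bullet> u = 0" if "u \<in> U" for u
    using that unfolding U p_def by (simp add: inner_add_left inner_add_right inner_commute)
  have "(THE p. p \<in> U \<and> (\<forall>u\<in>U. (x - p) \<bullet> u = 0)) = p"
  proof (rule the_equality)
    fix q assume q: "q \<in> U \<and> (\<forall>u\<in>U. (x - q) \<bullet> u = 0)"
    have "p - q \<in> U" using pU q by (simp add: U inner_diff_left)
    then have "(x - q) \<bullet> (p - q) - (x - p) \<bullet> (p - q) = 0" using q orth by simp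
    then have "(p - q) \<bullet> (p - q) = 0" by (simp add: inner_diff_left)
    then show "q = p" by simp
  qed (use pU orth in auto)
  then show ?thesis unfolding proj_perp_def U_def[symmetric] Let_def p_def .
qed

lemma admissible_tangent:
  assumes a: "admissible l a1 a2 T1 T2 \<gamma>" and l: "l > 0"
  shows "W1inf l (Dl l \<gamma>)" "s \<in> {0..l} \<Longrightarrow> (\<gamma> has_vector_derivative Dl l \<gamma> s) (at s within {0..l})"
    "s \<in> {0..l} \<Longrightarrow> norm (Dl l \<gamma> s) = 1" "Dl l \<gamma> 0 = T1" "Dl l \<gamma> l = T2"
    "(Dl l \<gamma> has_integral a2 - a1) {0..l}"
    "AE s in lborel. s \<in> {0..l} \<longrightarrow> Dl l \<gamma> s \<bullet> Dl l (Dl l \<gamma>) s = 0"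
proof -
  obtain S where S: "\<And>s. s \<in> {0..l} \<Longrightarrow> (\<gamma> has_vector_derivative S s) (at s within {0..l})" "W1inf l S"
    using a unfolding admissible_def W2inf_def by blast
  have eq: "Dl l \<gamma> s = S s" if "s \<in> {0..l}" for s by (rule Dl_eqI[OF S(1)[OF that] that l])
  show W: "W1inf l (Dl l \<gamma>)" using S(2) eq unfolding W1inf_def lipschitz_on_def by simp
  show d: "s \<in> {0..l} \<Longrightarrow> (\<gamma> has_vector_derivative Dl l \<gamma> s) (at s within {0..l})" for s using S eq by simp
  show n: "s \<in> {0..l} \<Longrightarrow> norm (Dl l \<gamma> s) = 1" for s using a by (simp add: admissible_def)
  show "Dl l \<gamma> 0 = T1" "Dl l \<gamma> l = T2" using a by (auto simp: admissible_def)
  show "(Dl l \<gamma> has_integral a2 - a1) {0..l}"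
    using fundamental_theorem_of_calculus[of 0 l \<gamma> "Dl l \<gamma>"] d l a by (auto simp: admissible_def)
  have "AE s in lborel. s \<in> {0..l} \<longrightarrow> Dl l \<gamma> s \<bullet> Dl l (Dl l \<gamma>) s + Dl l (Dl l \<gamma>) s \<bullet> Dl l \<gamma> s = 0"
    by (rule orthogonal_Dl_AE[OF W W _ l, of 1]) (use n in \<open>simp add: norm_eq_1\<close>)
  then show "AE s in lborel. s \<in> {0..l} \<longrightarrow> Dl l \<gamma> s \<bullet> Dl l (Dl l \<gamma>) s = 0"
    by eventually_elim (simp add: inner_commute)
qed

text \<open>The extended-real essential supremum is nonnegative because the interval has positive
  measure, and finite because the integrand is bounded. So \<open>real_of_ereal\<close> loses
  nothing, and only these bounds are used afterwards.\<close>

lemma Kalpha_bounds: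
  fixes \<gamma> :: "real \<Rightarrow> real^'n"
  assumes l: "l > 0" and \<alpha>: "Linf l \<alpha>" "\<And>s. s \<in> {0..l} \<Longrightarrow> \<alpha> s \<ge> 0" and W: "W1inf l (Dl l \<gamma>)"
  shows "0 \<le> Kalpha l \<alpha> \<gamma>"
    and "AE s in lborel. s \<in> {0..l} \<longrightarrow> \<alpha> s * norm (Dl l (Dl l \<gamma>) s) \<le> Kalpha l \<alpha> \<gamma>"
    and "(AE s in lborel. s \<in> {0..l} \<longrightarrow> \<alpha> s * norm (Dl l (Dl l \<gamma>) s) \<le> c) \<Longrightarrow> Kalpha l \<alpha> \<gamma> \<le> c"
proof -
  define M where "M = lebesgue_on {0..l}"
  define f where "f s = \<alpha> s * norm (Dl l (Dl l \<gamma>) s)" for s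
  have fL: "Linf l f" unfolding f_def[abs_def] by (intro Linf_mult \<alpha>(1) Linf_norm W1inf_Dl_Linf W l)
  have AEM: "(AE s in M. P s) \<longleftrightarrow> (AE s in lborel. s \<in> {0..l} \<longrightarrow> P s)" for P
    unfolding M_def by (subst AE_restrict_space_iff) (auto simp: AE_completion_iff)
  have fm: "(\<lambda>s. ereal (f s)) \<in> borel_measurable M"
  proof -
    obtain h where h: "h \<in> borel_measurable borel" "AE s in lborel. s \<in> {0..l} \<longrightarrow> f s = h s"
      using LinfE[OF fL] by blast
    have "(\<lambda>s. indicator {0..l} s * h s) \<in> borel_measurable lebesgue"
      using h(1) by (intro measurable_completion) simp
    moreover have "AE s in lebesgue. indicator {0..l} s * h s = indicator {0..l} s * f s"
      unfolding AE_completion_iff using h(2) by eventually_elim (auto simp: indicator_def)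
    ultimately have "(\<lambda>s. indicator {0..l} s * f s) \<in> borel_measurable lebesgue" by (rule borel_measurable_AE)
    then have "(\<lambda>s. indicator {0..l} s * f s) \<in> borel_measurable M"
      unfolding M_def by (rule measurable_restrict_space1)
    then have "f \<in> borel_measurable M"
      by (rule measurable_cong[THEN iffD1, rotated]) (auto simp: M_def indicator_def)
    then show ?thesis by simp
  qed
  obtain C where C: "C \<ge> 0" "AE s in lborel. s \<in> {0..l} \<longrightarrow> norm (f s) \<le> C" using Linf_AE_bound[OF fL] by blast
  define E where "E = esssup M (\<lambda>s. ereal (f s))"
  have K: "Kalpha l \<alpha> \<gamma> = real_of_ereal E" by (simp add: Kalpha_def E_def f_def M_def)
  have up: "E \<le> ereal c" if "AE s in lborel. s \<in> {0..l} \<longrightarrow> f s \<le> c" for c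
    unfolding E_def by (rule esssup_I[OF fm]) (use that in \<open>simp add: AEM\<close>)
  have lo: "AE s in lborel. s \<in> {0..l} \<longrightarrow> ereal (f s) \<le> E"
    using esssup_AE[of "\<lambda>s. ereal (f s)" M] unfolding E_def AEM .
  have E0: "0 \<le> E"
  proof (rule ccontr)
    assume "\<not> 0 \<le> E"
    have ne: "\<not> ereal (f s) \<le> E" if "s \<in> {0..l}" for s
    proof
      assume "ereal (f s) \<le> E"
      moreover have "0 \<le> ereal (f s)" using \<alpha>(2)[OF that] by (simp add: f_def)
      ultimately show False using \<open>\<not> 0 \<le> E\<close> order_trans by blast
    qed
    have "AE s in lborel. s \<in> {0..l} \<longrightarrow> (1::real) \<le> 0"
      using lo by eventually_elim (use ne in auto)
    from AE_interval_continuous_le[OF _ this l, of 0] l show False by auto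
  qed
  have "AE s in lborel. s \<in> {0..l} \<longrightarrow> f s \<le> C" using C(2) by eventually_elim auto
  then have "E \<le> ereal C" by (rule up)
  then have Er: "E = ereal (Kalpha l \<alpha> \<gamma>)" using E0 unfolding K by (cases E) auto
  show "0 \<le> Kalpha l \<alpha> \<gamma>" using E0 Er by simp
  show "AE s in lborel. s \<in> {0..l} \<longrightarrow> \<alpha> s * norm (Dl l (Dl l \<gamma>) s) \<le> Kalpha l \<alpha> \<gamma>"
    using lo unfolding Er f_def by simp
  show "Kalpha l \<alpha> \<gamma> \<le> c" if "AE s in lborel. s \<in> {0..l} \<longrightarrow> \<alpha> s * norm (Dl l (Dl l \<gamma>) s) \<le> c"
    using up[of c] that unfolding Er f_def by simp
qed

section \<open>Sufficiency of the multiplier equations\<close>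

text \<open>V is the Lipschitz representative of \<open>g \<alpha> T'\<close>.\<close>
definition strong_multiplier ::
  "real \<Rightarrow> (real \<Rightarrow> real) \<Rightarrow> (real \<Rightarrow> real^'n) \<Rightarrow> real \<Rightarrow> real^'n \<Rightarrow> (real \<Rightarrow> real) \<Rightarrow> (real \<Rightarrow> real^'n) \<Rightarrow> bool" where
  "strong_multiplier l \<alpha> T k lam g V \<longleftrightarrow> W1inf l g \<and> W1inf l V \<and>
    (AE s in lborel. s \<in> {0..l} \<longrightarrow> V s = (g s * \<alpha> s) *\<^sub>R Dl l T s) \<and>
    (AE s in lborel. s \<in> {0..l} \<longrightarrow> Dl l V s = (Dl l g s * \<alpha> s) *\<^sub>R Dl l T s
        - (g s * k\<^sup>2 / \<alpha> s) *\<^sub>R T s + k\<^sup>2 *\<^sub>R proj_perp (T s) (Dl l T s) lam) \<and>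
    (AE s in lborel. s \<in> {0..l} \<longrightarrow> Dl l g s = \<alpha> s * (lam \<bullet> Dl l T s))"

lemma Linf_proj_perp:
  fixes T D :: "real \<Rightarrow> 'a::euclidean_space"
  assumes T: "Linf l T" and D: "Linf l D"
    and n: "\<And>s. s \<in> {0..l} \<Longrightarrow> norm (T s) = 1" and TD: "AE s in lborel. s \<in> {0..l} \<longrightarrow> T s \<bullet> D s = 0"
  shows "Linf l (\<lambda>s. proj_perp (T s) (D s) x)"
proof -
  \<comment> \<open>The quotient alone may be unbounded near zeros of \<open>D\<close>; by
    Cauchy-Schwarz the whole term is bounded by the norm of x.\<close>
  have 1: "Linf l (\<lambda>s. ((x \<bullet> D s) / (D s \<bullet> D s)) *\<^sub>R D s)"
  proof -
    obtain h where h: "h \<in> borel_measurable borel" "AE s in lborel. s \<in> {0..l} \<longrightarrow> D s = h s"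
      using LinfE[OF D] by blast
    show ?thesis
    proof (rule LinfI)
      show "(\<lambda>s. ((x \<bullet> h s) / (h s \<bullet> h s)) *\<^sub>R h s) \<in> borel_measurable borel" using h(1) by measurable
      show "norm (((x \<bullet> h s) / (h s \<bullet> h s)) *\<^sub>R h s) \<le> norm x" for s
      proof (cases "h s = 0")
        case False
        have "\<bar>x \<bullet> h s\<bar> * norm (h s) \<le> norm x * norm (h s) * norm (h s)"
          by (intro mult_right_mono Cauchy_Schwarz_ineq2) auto
        then show ?thesis using False
          by (simp add: abs_mult divide_le_eq dot_square_norm power2_eq_square mult.assoc)
      qed simp
      show "AE s in lborel. s \<in> {0..l} \<longrightarrow> ((x \<bullet> D s) / (D s \<bullet> D s)) *\<^sub>R D s = ((x \<bullet> h s) / (h s \<bullet> h s)) *\<^sub>R h s"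
        using h(2) by eventually_elim auto
    qed
  qed
  have "Linf l (\<lambda>s. x - (x \<bullet> T s) *\<^sub>R T s - ((x \<bullet> D s) / (D s \<bullet> D s)) *\<^sub>R D s)"
    by (intro Linf_diff Linf_const Linf_scaleR Linf_inner T 1)
  then show ?thesis
    by (rule Linf_cong_AE) (use TD in \<open>eventually_elim, auto simp: proj_perp_orthogonal n\<close>)
qed

locale weighted_interval =
  fixes l :: real and \<alpha> :: "real \<Rightarrow> real"
  assumes l: "l > 0" and \<alpha>_pos: "\<And>s. s \<in> {0..l} \<Longrightarrow> \<alpha> s > 0"
    and \<alpha>L: "Linf l \<alpha>" and \<alpha>rL: "Linf l (\<lambda>s. 1 / \<alpha> s)"

locale weighted_curve = weighted_interval +
  fixes a1 a2 T1 T2 :: "real^'n" and \<gamma> :: "real \<Rightarrow> real^'n"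
  assumes T1: "norm T1 = 1" and T2: "norm T2 = 1"
    and adm: "admissible l a1 a2 T1 T2 \<gamma>"
begin

definition T where "T = Dl l \<gamma>"
definition D where "D = Dl l T"
definition k where "k = Kalpha l \<alpha> \<gamma>"

lemma TW: "W1inf l T" and T_norm: "s \<in> {0..l} \<Longrightarrow> norm (T s) = 1" and T0: "T 0 = T1" and Tl: "T l = T2"
  and T_int: "(T has_integral a2 - a1) {0..l}" and TD: "AE s in lborel. s \<in> {0..l} \<longrightarrow> T s \<bullet> D s = 0"
  and T_deriv: "s \<in> {0..l} \<Longrightarrow> (\<gamma> has_vector_derivative T s) (at s within {0..l})"
  using admissible_tangent[OF adm l] unfolding T_def D_def by auto

lemma TL: "Linf l T" and DL: "Linf l D"
  using Linf_continuous[OF W1inf_continuous[OF TW]] W1inf_Dl_Linf[OF TW l] by (auto simp: D_def)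

lemma T_self: "s \<in> {0..l} \<Longrightarrow> T s \<bullet> T s = 1"
  using T_norm by (simp add: norm_eq_1)

lemma k_nonneg: "0 \<le> k" and k_AE: "AE s in lborel. s \<in> {0..l} \<longrightarrow> \<alpha> s * norm (D s) \<le> k"
  using Kalpha_bounds(1,2)[OF l \<alpha>L _ TW[unfolded T_def]] \<alpha>_pos less_imp_le unfolding k_def D_def T_def by blast+

text \<open>The first weak equation says precisely that the bounded function \<open>w\<close> is the
  weak derivative of \<open>f\<close>, that is of \<open>g \<alpha> T'\<close>, which therefore has
  a Lipschitz representative. From here on only identities almost everywhere are handled.\<close>

lemma weak_iff_strong:
  assumes gW: "W1inf l g"
  shows "((\<forall>\<xi>::real \<Rightarrow> real^'n. test_fun l \<xi> \<longrightarrow>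
          integral {0..l} (\<lambda>s. g s * \<alpha> s * (D s \<bullet> vector_derivative \<xi> (at s))
              + Dl l g s * \<alpha> s * (D s \<bullet> \<xi> s)
              - g s * k\<^sup>2 / \<alpha> s * (T s \<bullet> \<xi> s)
              + k\<^sup>2 * (proj_perp (T s) (D s) lam \<bullet> \<xi> s)) = 0) \<and>
       (\<forall>\<phi>::real \<Rightarrow> real. test_fun l \<phi> \<longrightarrow>
          integral {0..l} (\<lambda>s. Dl l g s * \<phi> s - \<alpha> s * (lam \<bullet> D s) * \<phi> s) = 0))
    \<longleftrightarrow> (\<exists>V. strong_multiplier l \<alpha> T k lam g V)" (is "?A \<and> ?B \<longleftrightarrow> ?C")
proof -
  define f where "f s = (g s * \<alpha> s) *\<^sub>R D s" for s
  define w where "w s = (Dl l g s * \<alpha> s) *\<^sub>R D s - (g s * k\<^sup>2 / \<alpha> s) *\<^sub>R T s + k\<^sup>2 *\<^sub>R proj_perp (T s) (D s) lam" for s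
  define m where "m s = Dl l g s - \<alpha> s * (lam \<bullet> D s)" for s
  have gL: "Linf l g" by (rule Linf_continuous[OF W1inf_continuous[OF gW]])
  have dgL: "Linf l (Dl l g)" by (rule W1inf_Dl_Linf[OF gW l])
  have fL: "Linf l f" unfolding f_def[abs_def] by (intro Linf_scaleR Linf_mult gL \<alpha>L DL)
  have "Linf l (\<lambda>s. (Dl l g s * \<alpha> s) *\<^sub>R D s - (g s * k\<^sup>2 * (1 / \<alpha> s)) *\<^sub>R T s + k\<^sup>2 *\<^sub>R proj_perp (T s) (D s) lam)"
    by (intro Linf_add Linf_diff Linf_scaleR Linf_mult Linf_const dgL gL \<alpha>L \<alpha>rL DL TL Linf_proj_perp T_norm TD)
  then have wL: "Linf l w" by (simp add: w_def[abs_def])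
  have mL: "Linf l m" unfolding m_def[abs_def] by (intro Linf_diff Linf_mult Linf_inner Linf_const dgL \<alpha>L DL)
  have A: "?A \<longleftrightarrow> (\<forall>\<xi>::real \<Rightarrow> real^'n. test_fun l \<xi> \<longrightarrow> integral {0..l} (\<lambda>s. f s \<bullet> vector_derivative \<xi> (at s) + w s \<bullet> \<xi> s) = 0)"
    by (simp add: f_def w_def inner_add_left inner_diff_left algebra_simps)
  have B: "?B \<longleftrightarrow> (\<forall>\<phi>::real \<Rightarrow> real. test_fun l \<phi> \<longrightarrow> integral {0..l} (\<lambda>s. m s * \<phi> s) = 0)"
    by (simp add: m_def left_diff_distrib)
  have C: "?C \<longleftrightarrow> (\<exists>V. W1inf l V \<and> (AE s in lborel. s \<in> {0..l} \<longrightarrow> V s = f s) \<and> (AE s in lborel. s \<in> {0..l} \<longrightarrow> Dl l V s = w s))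
      \<and> (AE s in lborel. s \<in> {0..l} \<longrightarrow> m s = 0)"
    unfolding strong_multiplier_def f_def w_def m_def D_def[symmetric] using gW by auto
  show ?thesis
  proof
    assume AB: "?A \<and> ?B"
    obtain V where "W1inf l V" "AE s in lborel. s \<in> {0..l} \<longrightarrow> V s = f s" "AE s in lborel. s \<in> {0..l} \<longrightarrow> Dl l V s = w s"
      using weak_derivative_W1inf[OF fL wL l] AB unfolding A by blast
    moreover have "AE s in lborel. s \<in> {0..l} \<longrightarrow> m s = 0"
      using fundamental_lemma_calculus_of_variations[OF mL l] AB unfolding B by blast
    ultimately show ?C unfolding C by blast
  next
    assume ?C
    then obtain V where V: "W1inf l V" "AE s in lborel. s \<in> {0..l} \<longrightarrow> V s = f s" "AE s in lborel. s \<in> {0..l} \<longrightarrow> Dl l V s = w s"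
      and m0: "AE s in lborel. s \<in> {0..l} \<longrightarrow> m s = 0" unfolding C by blast
    have ?A unfolding A
    proof (intro allI impI)
      fix \<xi> :: "real \<Rightarrow> real^'n" assume \<xi>: "test_fun l \<xi>"
      have "integral {0..l} (\<lambda>s. f s \<bullet> vector_derivative \<xi> (at s) + w s \<bullet> \<xi> s)
          = integral {0..l} (\<lambda>s. V s \<bullet> vector_derivative \<xi> (at s) + Dl l V s \<bullet> \<xi> s)"
        by (rule integral_cong_AE_interval) (use V(2,3) in \<open>eventually_elim, auto\<close>)
      then show "integral {0..l} (\<lambda>s. f s \<bullet> vector_derivative \<xi> (at s) + w s \<bullet> \<xi> s) = 0"
        using integral_unique[OF W1inf_weak_derivative[OF V(1) l \<xi>]] by simp
    qed
    moreover have ?B unfolding B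
    proof (intro allI impI)
      fix \<phi> :: "real \<Rightarrow> real"
      have "integral {0..l} (\<lambda>s. m s * \<phi> s) = integral {0..l} (\<lambda>s. 0)"
        by (rule integral_cong_AE_interval) (use m0 in \<open>eventually_elim, auto\<close>)
      then show "integral {0..l} (\<lambda>s. m s * \<phi> s) = 0" by simp
    qed
    ultimately show "?A \<and> ?B" by blast
  qed
qed

text \<open>On \<open>{g = 0}\<close> both \<open>g'\<close> and \<open>V'\<close> vanish, so \<open>\<lambda> = \<plusminus>T\<close> there; on \<open>{g > 0}\<close> differentiating
  \<open>V \<bullet> T = 0\<close> gives \<open>\<alpha> |T'| = k\<close>. In both cases the projection disappears from the equation.\<close>
lemma strong_multiplier_reduced:
  assumes S: "strong_multiplier l \<alpha> T k lam g V" and k: "k > 0" and g0: "\<And>s. s \<in> {0..l} \<Longrightarrow> g s \<ge> 0"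
  shows "\<And>s. s \<in> {0..l} \<Longrightarrow> V s \<bullet> T s = 0" "\<And>s. s \<in> {0..l} \<Longrightarrow> norm (V s) \<le> k * g s"
    "AE s in lborel. s \<in> {0..l} \<longrightarrow> Dl l V s = k\<^sup>2 *\<^sub>R (lam - (lam \<bullet> T s) *\<^sub>R T s) - (g s * k\<^sup>2 / \<alpha> s) *\<^sub>R T s"
proof -
  have gW: "W1inf l g" and VW: "W1inf l V"
    and Vf: "AE s in lborel. s \<in> {0..l} \<longrightarrow> V s = (g s * \<alpha> s) *\<^sub>R D s"
    and dV: "AE s in lborel. s \<in> {0..l} \<longrightarrow> Dl l V s = (Dl l g s * \<alpha> s) *\<^sub>R D s
        - (g s * k\<^sup>2 / \<alpha> s) *\<^sub>R T s + k\<^sup>2 *\<^sub>R proj_perp (T s) (D s) lam"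
    and dg: "AE s in lborel. s \<in> {0..l} \<longrightarrow> Dl l g s = \<alpha> s * (lam \<bullet> D s)"
    using S unfolding strong_multiplier_def D_def by auto
  have VT: "V s \<bullet> T s = 0" if s: "s \<in> {0..l}" for s
  proof (rule AE_interval_continuous_eq[of l "\<lambda>s. V s \<bullet> T s" "\<lambda>_. 0", OF _ _ _ l s])
    show "AE s in lborel. s \<in> {0..l} \<longrightarrow> V s \<bullet> T s = 0"
      using Vf TD by eventually_elim (auto simp: inner_commute)
  qed (auto intro!: continuous_intros W1inf_continuous[OF VW] W1inf_continuous[OF TW])
  then show "\<And>s. s \<in> {0..l} \<Longrightarrow> V s \<bullet> T s = 0" .
  have VT': "AE s in lborel. s \<in> {0..l} \<longrightarrow> V s \<bullet> D s + Dl l V s \<bullet> T s = 0"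
    using orthogonal_Dl_AE[OF VW TW VT l] by (simp add: D_def)
  have nV: "norm (V s) \<le> k * g s" if s: "s \<in> {0..l}" for s
  proof -
    have "norm (V s) - k * g s \<le> 0"
    proof (rule AE_interval_continuous_le[of l "\<lambda>s. norm (V s) - k * g s", OF _ _ l s])
      show "AE s in lborel. s \<in> {0..l} \<longrightarrow> norm (V s) - k * g s \<le> 0"
        using Vf k_AE
      proof eventually_elim
        case (elim s)
        show ?case
        proof
          assume s: "s \<in> {0..l}"
          have "norm (V s) = g s * (\<alpha> s * norm (D s))" using elim s g0[OF s] \<alpha>_pos[OF s] by (simp add: abs_mult)
          also have "\<dots> \<le> g s * k" using elim s g0[OF s] by (intro mult_left_mono) auto
          finally show "norm (V s) - k * g s \<le> 0" by (simp add: mult.commute)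
        qed
      qed
    qed (auto intro!: continuous_intros W1inf_continuous[OF VW] W1inf_continuous[OF gW])
    then show ?thesis by simp
  qed
  then show "\<And>s. s \<in> {0..l} \<Longrightarrow> norm (V s) \<le> k * g s" .
  \<comment> \<open>Zeros of g at the two ends are not interior minima, so these points are
    discarded.\<close>
  have ends: "AE s in lborel. s \<noteq> 0 \<and> s \<noteq> l" using AE_lborel_singleton[of 0] AE_lborel_singleton[of l] by eventually_elim auto
  show "AE s in lborel. s \<in> {0..l} \<longrightarrow> Dl l V s = k\<^sup>2 *\<^sub>R (lam - (lam \<bullet> T s) *\<^sub>R T s) - (g s * k\<^sup>2 / \<alpha> s) *\<^sub>R T s"
    using Vf dV dg TD VT' W1inf_Dl_AE[OF gW l] W1inf_Dl_AE[OF VW l] ends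
  proof eventually_elim
    case (elim s)
    show ?case
    proof
      assume s: "s \<in> {0..l}"
      have \<alpha>: "\<alpha> s > 0" by (rule \<alpha>_pos[OF s])
      define P where "P = proj_perp (T s) (D s) lam"
      have TDs: "T s \<bullet> D s = 0" using elim s by blast
      have P: "P = lam - (lam \<bullet> T s) *\<^sub>R T s - ((lam \<bullet> D s) / (D s \<bullet> D s)) *\<^sub>R D s"
        unfolding P_def by (rule proj_perp_orthogonal[OF T_norm[OF s] TDs])
      have dVs: "Dl l V s = (Dl l g s * \<alpha> s) *\<^sub>R D s - (g s * k\<^sup>2 / \<alpha> s) *\<^sub>R T s + k\<^sup>2 *\<^sub>R P"
        unfolding P_def using elim s by blast
      have dgs: "Dl l g s = \<alpha> s * (lam \<bullet> D s)" using elim s by blast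
      have "(Dl l g s * \<alpha> s) *\<^sub>R D s + k\<^sup>2 *\<^sub>R P = k\<^sup>2 *\<^sub>R (lam - (lam \<bullet> T s) *\<^sub>R T s)"
      proof (cases "g s = 0")
        case True
        have "Dl l g s = 0 \<and> Dl l V s = 0"
          by (rule vector_derivative_zero_of_norm_le[of l V k g s]) (use nV k elim s True in auto)
        then have "Dl l g s = 0" "P = 0" "lam \<bullet> D s = 0" using dVs dgs True k \<alpha> by auto
        then show ?thesis using P by simp
      next
        case False
        have "P \<bullet> T s = 0" unfolding P using T_self[OF s] TDs by (simp add: inner_diff_left inner_diff_right inner_commute)
        then have "Dl l V s \<bullet> T s = - (g s * k\<^sup>2 / \<alpha> s)"
          unfolding dVs using T_self[OF s] TDs by (simp add: inner_diff_left inner_diff_right inner_add_left inner_add_right inner_commute)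
        moreover have "V s \<bullet> D s = g s * \<alpha> s * (D s \<bullet> D s)" using elim s by simp
        ultimately have "g s * \<alpha> s * (D s \<bullet> D s) = g s * k\<^sup>2 / \<alpha> s" using elim s by auto
        then have e: "\<alpha> s * \<alpha> s * (D s \<bullet> D s) = k\<^sup>2" using False \<alpha> by (simp add: field_simps)
        then have D0: "D s \<bullet> D s \<noteq> 0" using k by auto
        \<comment> \<open>Once \<open>\<alpha> |T'|\<close> equals k, the term
          \<open>g' \<alpha> T'\<close> is k^2 times the component of \<open>lam\<close> along
          \<open>T'\<close>, exactly what the projection had removed.\<close>
        have "Dl l g s * \<alpha> s = k\<^sup>2 * ((lam \<bullet> D s) / (D s \<bullet> D s))"
          unfolding e[symmetric] dgs using D0 by simp
        then show ?thesis unfolding P by (simp add: scaleR_diff_right)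
      qed
      then show "Dl l V s = k\<^sup>2 *\<^sub>R (lam - (lam \<bullet> T s) *\<^sub>R T s) - (g s * k\<^sup>2 / \<alpha> s) *\<^sub>R T s"
        unfolding dVs by (simp add: algebra_simps)
    qed
  qed
qed

lemma inf_elastica_of_k_zero:
  assumes "k = 0"
  shows "inf_elastica l \<alpha> a1 a2 T1 T2 \<gamma>"
  unfolding inf_elastica_def
proof (intro conjI exI[of _ 0] allI impI adm)
  fix \<gamma>' assume "admissible l a1 a2 T1 T2 \<gamma>'"
  then have "0 \<le> Kalpha l \<alpha> \<gamma>'"
    using Kalpha_bounds(1)[OF l \<alpha>L _ admissible_tangent(1)[OF _ l]] \<alpha>_pos less_imp_le by blast
  then show "Kalpha l \<alpha> \<gamma> \<le> Kalpha l \<alpha> \<gamma>' + 0 / 2 * integral {0..l} (\<lambda>s. (norm (Dl l \<gamma>' s - Dl l \<gamma> s))\<^sup>2)"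
    using assms by (simp add: k_def)
qed

text \<open>Integrate \<open>V \<bullet> \<tau>'\<close> by parts for a competing tangent \<open>\<tau>\<close> and use
  \<open>T \<bullet> \<tau> = 1 - |T - \<tau>|\<^sup>2 / 2\<close>; the term linear in \<open>\<tau> - T\<close> drops out because both integrals agree.\<close>
lemma inf_elastica_of_strong_multiplier:
  assumes S: "strong_multiplier l \<alpha> T k lam g V" and k: "k > 0" and g0: "\<And>s. s \<in> {0..l} \<Longrightarrow> g s \<ge> 0"
    and gn: "s0 \<in> {0..l}" "g s0 \<noteq> 0" and lam: "norm lam = 1"
  shows "inf_elastica l \<alpha> a1 a2 T1 T2 \<gamma>"
proof -
  have gW: "W1inf l g" and VW: "W1inf l V" using S unfolding strong_multiplier_def by auto
  have red: "\<And>s. s \<in> {0..l} \<Longrightarrow> V s \<bullet> T s = 0" "\<And>s. s \<in> {0..l} \<Longrightarrow> norm (V s) \<le> k * g s"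
    "AE s in lborel. s \<in> {0..l} \<longrightarrow> Dl l V s = k\<^sup>2 *\<^sub>R (lam - (lam \<bullet> T s) *\<^sub>R T s) - (g s * k\<^sup>2 / \<alpha> s) *\<^sub>R T s"
    using strong_multiplier_reduced[OF S k] g0 by blast+
  have gL: "Linf l g" by (rule Linf_continuous[OF W1inf_continuous[OF gW]])
  obtain A where A: "A \<ge> 0" "AE s in lborel. s \<in> {0..l} \<longrightarrow> norm (\<alpha> s) \<le> A" using Linf_AE_bound[OF \<alpha>L] by blast
  have gaL: "Linf l (\<lambda>s. g s * (1 / \<alpha> s))" by (intro Linf_mult gL \<alpha>rL)
  obtain G where G: "G \<ge> 0" "AE s in lborel. s \<in> {0..l} \<longrightarrow> norm (g s * (1 / \<alpha> s)) \<le> G" using Linf_AE_bound[OF gaL] by blast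
  define I where "I = integral {0..l} (\<lambda>s. g s * (1 / \<alpha> s))"
  have I: "I > 0"
  proof -
    have Ap: "A + 1 > 0" using A by simp
    \<comment> \<open>The weight 1 / \<alpha> need not be continuous; replacing it by the smaller
      constant 1 / (A + 1) leaves a continuous nonnegative integrand with one nonzero value.\<close>
    have "integral {0..l} (\<lambda>s. g s * (1 / (A + 1))) \<le> I"
      unfolding I_def
    proof (rule integral_mono_AE_Linf[OF _ gaL])
      show "Linf l (\<lambda>s. g s * (1 / (A + 1)))" by (intro Linf_mult gL Linf_const)
      show "AE s in lborel. s \<in> {0..l} \<longrightarrow> g s * (1 / (A + 1)) \<le> g s * (1 / \<alpha> s)"
        using A(2)
      proof eventually_elim
        case (elim s)
        show ?case
        proof
          assume s: "s \<in> {0..l}"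
          have "1 / (A + 1) \<le> 1 / \<alpha> s" using elim s \<alpha>_pos[OF s] by (intro divide_left_mono) auto
          then show "g s * (1 / (A + 1)) \<le> g s * (1 / \<alpha> s)" using g0[OF s] by (rule mult_left_mono)
        qed
      qed
    qed
    moreover have "integral {0..l} (\<lambda>s. g s * (1 / (A + 1))) \<noteq> 0"
    proof (subst integral_eq_0_iff)
      show "continuous_on {0..l} (\<lambda>s. g s * (1 / (A + 1)))" by (intro continuous_intros W1inf_continuous[OF gW])
      show "\<not> (\<forall>x\<in>{0..l}. g x * (1 / (A + 1)) = 0)" using gn Ap by auto
    qed (use l g0 Ap in auto)
    moreover have "integral {0..l} (\<lambda>s. g s * (1 / (A + 1))) \<ge> 0"
      using g0 Ap by (intro Henstock_Kurzweil_Integration.integral_nonneg Linf_integrable[OF Linf_mult[OF gL Linf_const]]) auto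
    ultimately show ?thesis by linarith
  qed
  \<comment> \<open>The final estimate reads k I (k - k') \<le> ((k^2 + k^2 G) / 2) times the
    integral of \<open>q\<close>; division by k I gives this constant.\<close>
  define M where "M = (k\<^sup>2 + k\<^sup>2 * G) / (k * I)"
  show ?thesis unfolding inf_elastica_def
  proof (intro conjI exI[of _ M] allI impI adm)
    fix \<gamma>' :: "real \<Rightarrow> real^'n" assume adm': "admissible l a1 a2 T1 T2 \<gamma>'"
    define \<tau> where "\<tau> = Dl l \<gamma>'"
    define \<delta> where "\<delta> = Dl l \<tau>"
    define k' where "k' = Kalpha l \<alpha> \<gamma>'"
    note t = admissible_tangent[OF adm' l, folded \<tau>_def, folded \<delta>_def]
    have k': "AE s in lborel. s \<in> {0..l} \<longrightarrow> \<alpha> s * norm (\<delta> s) \<le> k'" "0 \<le> k'"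
      using Kalpha_bounds(1,2)[OF l \<alpha>L _ t(1)[unfolded \<tau>_def]] \<alpha>_pos less_imp_le unfolding k'_def \<delta>_def \<tau>_def by blast+
    have \<tau>L: "Linf l \<tau>" and \<delta>L: "Linf l \<delta>"
      using Linf_continuous[OF W1inf_continuous[OF t(1)]] W1inf_Dl_Linf[OF t(1) l] by (auto simp: \<delta>_def)
    define q where "q s = (norm (\<tau> s - T s))\<^sup>2" for s
    have qL: "Linf l q" unfolding q_def[abs_def] power2_eq_square by (intro Linf_mult Linf_norm Linf_diff \<tau>L TL)
    have VL: "Linf l V" by (rule Linf_continuous[OF W1inf_continuous[OF VW]])
    have parts: "((\<lambda>s. V s \<bullet> \<delta> s + Dl l V s \<bullet> \<tau> s) has_integral 0) {0..l}"
    proof -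
      have "((\<lambda>s. V s \<bullet> \<delta> s + Dl l V s \<bullet> \<tau> s) has_integral V l \<bullet> \<tau> l - V 0 \<bullet> \<tau> 0) {0..l}"
        unfolding \<delta>_def by (rule integration_by_parts_W1inf[OF bounded_bilinear_inner VW t(1) l])
      moreover have "V l \<bullet> \<tau> l = 0" "V 0 \<bullet> \<tau> 0 = 0" using red(1)[of l] red(1)[of 0] t(4,5) T0 Tl l by auto
      ultimately show ?thesis by simp
    qed
    \<comment> \<open>A pointwise upper bound: the first term joins
      \<open>V \<bullet> \<delta> \<le> k k' g / \<alpha>\<close> with the contribution
      \<open>- k\<^sup>2 g / \<alpha>\<close> of \<open>V'\<close>, the second integrates to 0, and
      the third collects the errors in \<open>q\<close>, using lam \<bullet> T \<le> 1 and g /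
      \<alpha> \<le> G.\<close>
    define r where "r s = (k * k' - k\<^sup>2) * (g s * (1 / \<alpha> s)) + k\<^sup>2 * (lam \<bullet> (\<tau> s - T s)) + (k\<^sup>2 + k\<^sup>2 * G) / 2 * q s" for s
    have "integral {0..l} (\<lambda>s. V s \<bullet> \<delta> s + Dl l V s \<bullet> \<tau> s) \<le> integral {0..l} r"
    proof (rule integral_mono_AE_Linf)
      show "Linf l (\<lambda>s. V s \<bullet> \<delta> s + Dl l V s \<bullet> \<tau> s)" by (intro Linf_add Linf_inner VL \<delta>L \<tau>L W1inf_Dl_Linf[OF VW l])
      show "Linf l r" unfolding r_def[abs_def] by (intro Linf_add Linf_mult Linf_inner Linf_diff Linf_const gaL \<tau>L TL qL gL \<alpha>rL)
      show "AE s in lborel. s \<in> {0..l} \<longrightarrow> V s \<bullet> \<delta> s + Dl l V s \<bullet> \<tau> s \<le> r s"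
        using red(3) k'(1) G(2)
      proof eventually_elim
        case (elim s)
        show ?case
        proof
          assume s: "s \<in> {0..l}"
          have \<alpha>: "\<alpha> s > 0" by (rule \<alpha>_pos[OF s])
          define ga where "ga = g s * (1 / \<alpha> s)"
          have ga: "0 \<le> ga" "ga \<le> G" using elim(3) s g0[OF s] \<alpha> by (auto simp: ga_def)
          have \<delta>: "norm (\<delta> s) \<le> k' * (1 / \<alpha> s)" using elim(2) s \<alpha> by (simp add: field_simps)
          have "V s \<bullet> \<delta> s \<le> norm (V s) * norm (\<delta> s)" by (rule norm_cauchy_schwarz)
          also have "\<dots> \<le> (k * g s) * (k' * (1 / \<alpha> s))"
            using red(2)[OF s] \<delta> k g0[OF s] by (intro mult_mono) auto
          finally have 1: "V s \<bullet> \<delta> s \<le> k * k' * ga" by (simp add: ga_def algebra_simps)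
          have \<tau>\<tau>: "\<tau> s \<bullet> \<tau> s = 1" using t(3)[OF s] by (simp add: norm_eq_1)
          have T\<tau>: "T s \<bullet> \<tau> s = 1 - q s / 2"
            using T_self[OF s] \<tau>\<tau> by (simp add: q_def power2_norm_eq_inner inner_diff_left inner_diff_right inner_commute diff_divide_distrib)
          have "\<bar>lam \<bullet> T s\<bar> \<le> norm lam * norm (T s)" by (rule Cauchy_Schwarz_ineq2)
          then have lT: "lam \<bullet> T s \<le> 1" using lam T_norm[OF s] by simp
          have q0: "q s \<ge> 0" by (simp add: q_def)
          have "Dl l V s \<bullet> \<tau> s = k\<^sup>2 * (lam \<bullet> \<tau> s - (lam \<bullet> T s) * (T s \<bullet> \<tau> s)) - ga * k\<^sup>2 * (T s \<bullet> \<tau> s)"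
            using elim(1) s by (simp add: ga_def inner_diff_left)
          also have "\<dots> = k\<^sup>2 * (lam \<bullet> (\<tau> s - T s)) - k\<^sup>2 * ga + k\<^sup>2 * ((lam \<bullet> T s) * q s) / 2 + k\<^sup>2 * (ga * q s) / 2"
            unfolding T\<tau> by (simp add: algebra_simps inner_diff_right)
          also have "\<dots> \<le> k\<^sup>2 * (lam \<bullet> (\<tau> s - T s)) - k\<^sup>2 * ga + k\<^sup>2 * (1 * q s) / 2 + k\<^sup>2 * (G * q s) / 2"
            using lT ga q0 by (intro add_mono divide_right_mono mult_left_mono mult_right_mono) auto
          finally have 2: "Dl l V s \<bullet> \<tau> s \<le> k\<^sup>2 * (lam \<bullet> (\<tau> s - T s)) - k\<^sup>2 * ga + k\<^sup>2 * (1 * q s) / 2 + k\<^sup>2 * (G * q s) / 2" .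
          show "V s \<bullet> \<delta> s + Dl l V s \<bullet> \<tau> s \<le> r s"
            using add_mono[OF 1 2] unfolding r_def ga_def[symmetric] by (simp add: algebra_simps add_divide_distrib)
        qed
      qed
    qed
    moreover have "integral {0..l} r = (k * k' - k\<^sup>2) * I + (k\<^sup>2 + k\<^sup>2 * G) / 2 * integral {0..l} q"
    proof (rule integral_unique)
      have 1: "((\<lambda>s. (k * k' - k\<^sup>2) * (g s * (1 / \<alpha> s))) has_integral (k * k' - k\<^sup>2) * I) {0..l}"
        unfolding I_def by (intro has_integral_mult_right integrable_integral Linf_integrable[OF gaL]) auto
      have "((\<lambda>s. \<tau> s - T s) has_integral 0) {0..l}" using has_integral_diff[OF t(6) T_int] by simp
      then have "((\<lambda>s. lam \<bullet> (\<tau> s - T s)) has_integral lam \<bullet> 0) {0..l}"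
        by (rule has_integral_linear[OF _ bounded_linear_inner_right, unfolded o_def])
      then have 2: "((\<lambda>s. k\<^sup>2 * (lam \<bullet> (\<tau> s - T s))) has_integral 0) {0..l}"
        using has_integral_mult_right[of _ 0 "{0..l}" "k\<^sup>2"] by fastforce
      have 3: "((\<lambda>s. (k\<^sup>2 + k\<^sup>2 * G) / 2 * q s) has_integral (k\<^sup>2 + k\<^sup>2 * G) / 2 * integral {0..l} q) {0..l}"
        by (intro has_integral_mult_right integrable_integral Linf_integrable[OF qL]) auto
      show "(r has_integral (k * k' - k\<^sup>2) * I + (k\<^sup>2 + k\<^sup>2 * G) / 2 * integral {0..l} q) {0..l}"
        using has_integral_add[OF has_integral_add[OF 1 2] 3] unfolding r_def[abs_def] by simp
    qed
    ultimately have "0 \<le> (k * k' - k\<^sup>2) * I + (k\<^sup>2 + k\<^sup>2 * G) / 2 * integral {0..l} q"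
      using integral_unique[OF parts] by simp
    moreover have "(k * I) * (k - k') = - ((k * k' - k\<^sup>2) * I)" by (simp add: algebra_simps power2_eq_square)
    ultimately have "(k * I) * (k - k') \<le> (k\<^sup>2 + k\<^sup>2 * G) / 2 * integral {0..l} q" by linarith
    then have "k - k' \<le> (k\<^sup>2 + k\<^sup>2 * G) / 2 * integral {0..l} q / (k * I)"
      using k I by (subst pos_le_divide_eq) (auto simp: mult.commute)
    also have "\<dots> = M / 2 * integral {0..l} q" by (simp add: M_def)
    finally show "Kalpha l \<alpha> \<gamma> \<le> Kalpha l \<alpha> \<gamma>' + M / 2 * integral {0..l} (\<lambda>s. (norm (Dl l \<gamma>' s - Dl l \<gamma> s))\<^sup>2)"
      unfolding k_def k'_def q_def[abs_def] \<tau>_def T_def by simp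
  qed
qed

end

section \<open>Skew-symmetric matrices\<close>

text \<open>The norm on matrices is the Frobenius norm here, so Cauchy-Schwarz row by row is
  enough.\<close>

lemma norm_matrix_vector_le: "norm (A *v x) \<le> norm A * norm (x :: real^'n)" for A :: "real^'n^'n"
proof (rule power2_le_imp_le)
  have "(norm (A *v x))\<^sup>2 = (\<Sum>i\<in>UNIV. (A $ i \<bullet> x)\<^sup>2)"
    unfolding power2_norm_eq_inner inner_vec_def[of "A *v x"]
    by (simp add: matrix_vector_mul_component power2_eq_square)
  also have "\<dots> \<le> (\<Sum>i\<in>UNIV. (A $ i \<bullet> A $ i) * (x \<bullet> x))"
    by (intro sum_mono Cauchy_Schwarz_ineq)
  also have "\<dots> = (norm A)\<^sup>2 * (norm x)\<^sup>2"
    unfolding power2_norm_eq_inner inner_vec_def[of A] by (simp add: sum_distrib_right)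
  finally show "(norm (A *v x))\<^sup>2 \<le> (norm A * norm x)\<^sup>2" by (simp add: power_mult_distrib)
qed simp

lemma bounded_bilinear_matrix_vector: "bounded_bilinear ((*v) :: real^'n^'n \<Rightarrow> real^'n \<Rightarrow> real^'n)"
proof
  show "\<exists>K. \<forall>(A::real^'n^'n) x. norm (A *v x) \<le> norm A * norm x * K"
    by (rule exI[of _ 1]) (simp add: norm_matrix_vector_le)
qed (simp_all add: matrix_vector_mult_add_rdistrib matrix_vector_right_distrib scaleR_matrix_vector_assoc
    matrix_vector_mult_scaleR)

definition skew :: "real^'n^'n \<Rightarrow> bool" where "skew A \<longleftrightarrow> transpose A = - A"

text \<open>The exterior product as a skew matrix of rank at most two, x y^T - y x^T.\<close>

definition wedge :: "real^'n \<Rightarrow> real^'n \<Rightarrow> real^'n^'n" where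
  "wedge x y = (\<chi> i j. x $ i * y $ j - y $ i * x $ j)"

lemma skew_inner: "skew A \<Longrightarrow> x \<bullet> (A *v y) = - (y \<bullet> (A *v x))"
proof -
  assume "skew A"
  then have "x v* A = x v* transpose (- A)" by (metis skew_def transpose_transpose)
  also have "\<dots> = - (A *v x)"
    by (simp add: bounded_bilinear.minus_left[OF bounded_bilinear_matrix_vector])
  finally show ?thesis using dot_lmul_matrix[of x A y] by (simp add: inner_commute)
qed

lemma skew_self: "skew A \<Longrightarrow> x \<bullet> (A *v x) = 0"
  using skew_inner[of A x x] by simp

lemma linear_transpose: "linear (transpose :: real^'n^'n \<Rightarrow> real^'n^'n)"
  by (rule linearI) (simp_all add: transpose_def vec_eq_iff)

lemma skew_add: "skew A \<Longrightarrow> skew B \<Longrightarrow> skew (A + B)"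
  and skew_diff: "skew A \<Longrightarrow> skew B \<Longrightarrow> skew (A - B)"
  and skew_scaleR: "skew A \<Longrightarrow> skew (c *\<^sub>R A)"
  and skew_zero: "skew 0"
  by (simp_all add: skew_def linear_add[OF linear_transpose] linear_diff[OF linear_transpose]
      linear_scale[OF linear_transpose] linear_0[OF linear_transpose])

lemma skew_wedge: "skew (wedge x y)"
  by (simp add: skew_def wedge_def transpose_def vec_eq_iff)

lemma skew_sum: "(\<And>i. i \<in> I \<Longrightarrow> skew (A i)) \<Longrightarrow> skew (\<Sum>i\<in>I. A i)"
  by (induction I rule: infinite_finite_induct) (auto intro: skew_add skew_zero)

lemma wedge_mult: "wedge x y *v z = (y \<bullet> z) *\<^sub>R x - (x \<bullet> z) *\<^sub>R y"
  by (simp add: wedge_def matrix_vector_mult_def vec_eq_iff inner_vec_def left_diff_distrib sum_subtractf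
      sum_distrib_left sum_distrib_right mult.assoc mult.left_commute) (simp add: mult.commute mult.left_commute)

text \<open>In the Frobenius inner product both halves of the wedge contribute equally, whence the
  factor 2. This converts linear functionals of a skew matrix into pairings with one fixed skew
  matrix.\<close>

lemma skew_inner_wedge: "skew B \<Longrightarrow> B \<bullet> wedge x y = 2 * (x \<bullet> (B *v y))"
proof -
  assume B: "skew B"
  have "B \<bullet> wedge x y = (\<Sum>i\<in>UNIV. \<Sum>j\<in>UNIV. B $ i $ j * (x $ i * y $ j)) - (\<Sum>i\<in>UNIV. \<Sum>j\<in>UNIV. B $ i $ j * (y $ i * x $ j))"
    by (simp add: inner_vec_def wedge_def right_diff_distrib sum_subtractf)
  also have "\<dots> = x \<bullet> (B *v y) - y \<bullet> (B *v x)"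
    by (simp add: inner_vec_def matrix_vector_mult_def sum_distrib_left mult.left_commute mult.assoc)
  also have "\<dots> = 2 * (x \<bullet> (B *v y))" using skew_inner[OF B, of y x] by simp
  finally show ?thesis .
qed

lemma bounded_bilinear_wedge: "bounded_bilinear (wedge :: real^'n \<Rightarrow> real^'n \<Rightarrow> real^'n^'n)"
proof -
  have "bilinear (wedge :: real^'n \<Rightarrow> real^'n \<Rightarrow> real^'n^'n)"
    unfolding bilinear_def
    by (auto intro!: linearI simp: wedge_def vec_eq_iff algebra_simps)
  then show ?thesis by (simp add: bilinear_conv_bounded_bilinear)
qed

section \<open>Rotated competitors\<close>

text \<open>Outside the open unit ball normalisation is the nearest-point projection onto the closed
  unit ball, a convex set, and such projections are 1-Lipschitz.\<close>

lemma dist_sgn_le: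
  fixes x y :: "'a::euclidean_space"
  assumes "norm x \<ge> 1" "norm y \<ge> 1"
  shows "dist (sgn x) (sgn y) \<le> dist x y"
proof -
  have cp: "closest_point (cball 0 1) z = sgn z" if "norm z \<ge> 1" for z :: 'a
  proof (rule closest_point_unique[symmetric])
    show "\<forall>w\<in>cball 0 1. dist z (sgn z) \<le> dist z w"
    proof
      fix w :: 'a assume w: "w \<in> cball 0 1"
      have "z \<noteq> 0" using that by auto
      then have "z - sgn z = (norm z - 1) *\<^sub>R sgn z"
        unfolding scaleR_diff_left by (simp add: sgn_div_norm)
      then have "dist z (sgn z) = norm z - 1" using that by (auto simp: dist_norm norm_sgn)
      also have "\<dots> \<le> dist z w" using w norm_triangle_ineq2[of z w] by (simp add: dist_norm)
      finally show "dist z (sgn z) \<le> dist z w" .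
    qed
  qed (use that in \<open>auto simp: norm_sgn\<close>)
  show ?thesis using closest_point_lipschitz[of "cball (0::'a) 1" x y] cp assms by simp
qed

text \<open>Difference quotients inherit the comparison of distances. Together with
  \<open>dist_sgn_le\<close> this bounds the curvature of a normalised tangent without
  differentiating the normalisation.\<close>

lemma norm_vector_derivative_le:
  fixes f :: "real \<Rightarrow> 'a::euclidean_space" and g :: "real \<Rightarrow> 'b::euclidean_space"
  assumes f: "(f has_vector_derivative f') (at s within {0..l})" and g: "(g has_vector_derivative g') (at s within {0..l})"
    and le: "\<And>x y. x \<in> {0..l} \<Longrightarrow> y \<in> {0..l} \<Longrightarrow> dist (f x) (f y) \<le> dist (g x) (g y)"
    and s: "s \<in> {0..l}" and l: "l > 0"
  shows "norm f' \<le> norm g'"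
proof -
  have lim: "((\<lambda>y. (h y - h s) /\<^sub>R (y - s)) \<longlongrightarrow> h') (at s within {0..l})"
    if "(h has_vector_derivative h') (at s within {0..l})" for h h'
  proof -
    have "((\<lambda>y. norm ((h y - h s - (y - s) *\<^sub>R h') /\<^sub>R norm (y - s))) \<longlongrightarrow> 0) (at s within {0..l})"
      using that unfolding has_vector_derivative_def has_derivative_at_within by (intro tendsto_norm_zero) simp
    then have "((\<lambda>y. norm ((h y - h s) /\<^sub>R (y - s) - h')) \<longlongrightarrow> 0) (at s within {0..l})"
    proof (rule Lim_transform_eventually)
      show "\<forall>\<^sub>F y in at s within {0..l}. norm ((h y - h s - (y - s) *\<^sub>R h') /\<^sub>R norm (y - s)) = norm ((h y - h s) /\<^sub>R (y - s) - h')"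
        unfolding eventually_at_filter
      proof (intro always_eventually allI impI)
        fix y :: real assume "y \<noteq> s"
        then have "(h y - h s) /\<^sub>R (y - s) - h' = (h y - h s - (y - s) *\<^sub>R h') /\<^sub>R (y - s)"
          by (simp add: scaleR_diff_right)
        then show "norm ((h y - h s - (y - s) *\<^sub>R h') /\<^sub>R norm (y - s)) = norm ((h y - h s) /\<^sub>R (y - s) - h')"
          by simp
      qed
    qed
    then show ?thesis by (rule LIM_zero_cancel[OF tendsto_norm_zero_cancel])
  qed
  have nt: "at s within {0..l} \<noteq> bot" using s l by (simp add: trivial_limit_within islimpt_Icc)
  show ?thesis
  proof (rule tendsto_le[OF nt tendsto_norm[OF lim[OF g]] tendsto_norm[OF lim[OF f]]])
    show "\<forall>\<^sub>F x in at s within {0..l}. norm ((f x - f s) /\<^sub>R (x - s)) \<le> norm ((g x - g s) /\<^sub>R (x - s))"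
      unfolding eventually_at_filter
    proof (intro always_eventually allI impI)
      fix x assume "x \<in> {0..l}"
      then show "norm ((f x - f s) /\<^sub>R (x - s)) \<le> norm ((g x - g s) /\<^sub>R (x - s))"
        using le[of x s] s by (auto simp: dist_norm intro!: mult_left_mono)
    qed
  qed
qed

lemma admissible_of_tangent:
  fixes \<tau> :: "real \<Rightarrow> real^'n"
  assumes \<tau>: "W1inf l \<tau>" "\<And>s. s \<in> {0..l} \<Longrightarrow> norm (\<tau> s) = 1" "\<tau> 0 = T1" "\<tau> l = T2"
    "integral {0..l} \<tau> = a2 - a1" and l: "l > 0"
  obtains \<gamma>' where "admissible l a1 a2 T1 T2 \<gamma>'" "\<And>s. s \<in> {0..l} \<Longrightarrow> Dl l \<gamma>' s = \<tau> s"
proof -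
  define \<gamma>' where "\<gamma>' s = a1 + integral {0..s} \<tau>" for s
  have d: "(\<gamma>' has_vector_derivative \<tau> s) (at s within {0..l})" if "s \<in> {0..l}" for s
  proof -
    have "((\<lambda>s. integral {0..s} \<tau>) has_vector_derivative \<tau> s) (at s within {0..l})"
      by (rule integral_has_vector_derivative[OF W1inf_continuous[OF \<tau>(1)] that])
    from has_vector_derivative_add[OF has_vector_derivative_const[of a1] this] show ?thesis
      by (simp add: \<gamma>'_def[abs_def])
  qed
  have D: "Dl l \<gamma>' s = \<tau> s" if "s \<in> {0..l}" for s by (rule Dl_eqI[OF d[OF that] that l])
  have "admissible l a1 a2 T1 T2 \<gamma>'" unfolding admissible_def
  proof (intro conjI)
    show "W2inf l \<gamma>'" unfolding W2inf_def using d \<tau>(1) by blast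
  qed (use D \<tau> l in \<open>auto simp: \<gamma>'_def\<close>)
  then show ?thesis using D that by blast
qed

lemma Dl_cong:
  assumes "\<And>s. s \<in> {0..l} \<Longrightarrow> f s = g s" "s \<in> {0..l}"
  shows "Dl l f s = Dl l g s"
proof -
  have "(f has_vector_derivative D) (at s within {0..l}) = (g has_vector_derivative D) (at s within {0..l})" for D
    by (rule iffI; rule has_vector_derivative_transform[OF assms(2)]) (use assms in auto)
  then show ?thesis by (simp add: Dl_def vector_derivative_def)
qed

text \<open>By Pythagoras |t + a|^2 = 1 + |a|^2, so normalising an orthogonal perturbation of a unit
  vector moves it only at second order.\<close>

lemma norm_sgn_diff_le:
  fixes t a :: "'a::euclidean_space"
  assumes t: "norm t = 1" and o: "t \<bullet> a = 0"
  shows "norm (t + a) \<ge> 1" "norm (sgn (t + a) - (t + a)) \<le> (norm a)\<^sup>2" "norm (sgn (t + a) - t) \<le> norm a"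
proof -
  have sq: "(norm (t + a))\<^sup>2 = 1 + (norm a)\<^sup>2"
    using t o by (simp add: power2_norm_eq_inner inner_add_left inner_add_right inner_commute norm_eq_1)
  show n1: "norm (t + a) \<ge> 1"
    by (rule power2_le_imp_le) (use sq in auto)
  have "t + a \<noteq> 0" using n1 by auto
  then have "sgn (t + a) - (t + a) = (1 - norm (t + a)) *\<^sub>R sgn (t + a)"
    unfolding scaleR_diff_left by (simp add: sgn_div_norm)
  then have "norm (sgn (t + a) - (t + a)) = norm (t + a) - 1" using n1 by (auto simp: norm_sgn)
  moreover have "norm (t + a) - 1 \<le> (norm a)\<^sup>2"
  proof -
    have "(norm (t + a))\<^sup>2 \<ge> norm (t + a) * 1" unfolding power2_eq_square using n1 by (intro mult_left_mono) auto
    then show ?thesis using sq by simp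
  qed
  ultimately show "norm (sgn (t + a) - (t + a)) \<le> (norm a)\<^sup>2" by simp
  have "sgn t = t" using t by (simp add: sgn_div_norm)
  then show "norm (sgn (t + a) - t) \<le> norm a" using dist_sgn_le[OF n1, of t] t by (simp add: dist_norm)
qed

context weighted_curve
begin

text \<open>The rotation generators A admitted as variations; \<open>\<alpha>(T' + A' T)\<close> is the first-order change of \<open>\<alpha>T'\<close>
  up to the rotation itself.\<close>
definition variation :: "real \<Rightarrow> (real \<Rightarrow> real^'n^'n) \<Rightarrow> bool" where
  "variation k' A \<longleftrightarrow> W1inf l A \<and> A 0 = 0 \<and> (\<forall>s\<in>{0..l}. skew (A s)) \<and>
     (AE s in lborel. s \<in> {0..l} \<longrightarrow> \<alpha> s * norm (D s + Dl l A s *v T s) \<le> k')"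

definition competitor :: "real \<Rightarrow> (real \<Rightarrow> real^'n^'n) \<Rightarrow> real \<Rightarrow> real^'n" where
  "competitor e A s = sgn (T s + e *\<^sub>R (A s *v T s))"

lemma competitor_estimates:
  assumes A: "skew (A s)" and a: "norm (A s) \<le> a" and e: "0 \<le> e" and s: "s \<in> {0..l}"
  shows "norm (competitor e A s) = 1"
    "norm (T s + e *\<^sub>R (A s *v T s)) \<ge> 1"
    "norm (competitor e A s - (T s + e *\<^sub>R (A s *v T s))) \<le> e\<^sup>2 * a\<^sup>2"
    "norm (competitor e A s - T s) \<le> e * a"
proof -
  define b where "b = e *\<^sub>R (A s *v T s)"
  have o: "T s \<bullet> b = 0" using skew_self[OF A] by (simp add: b_def)
  have "norm (A s *v T s) \<le> a" using norm_matrix_vector_le[of "A s" "T s"] T_norm[OF s] a by simp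
  then have b: "norm b \<le> e * a" using e by (simp add: b_def mult_left_mono)
  note n = norm_sgn_diff_le[OF T_norm[OF s] o]
  show "norm (T s + e *\<^sub>R (A s *v T s)) \<ge> 1" using n(1) by (simp add: b_def)
  then show "norm (competitor e A s) = 1" unfolding competitor_def by (auto simp: norm_sgn)
  have "(norm b)\<^sup>2 \<le> (e * a)\<^sup>2" using b by (rule power_mono) simp
  then show "norm (competitor e A s - (T s + e *\<^sub>R (A s *v T s))) \<le> e\<^sup>2 * a\<^sup>2"
    using n(2) unfolding competitor_def b_def by (simp add: power_mult_distrib)
  show "norm (competitor e A s - T s) \<le> e * a" using n(3) b unfolding competitor_def b_def by simp
qed

text \<open>Since A is skew, the cross term \<open>T' \<bullet> A T'\<close> vanishes and the bound improves to first order
  with an error of order \<open>e\<^sup>2\<close>.\<close>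
lemma competitor_curvature:
  assumes V: "variation k' A" and e: "0 \<le> e" "e \<le> 1" and k': "0 \<le> k'"
    and a: "\<And>s. s \<in> {0..l} \<Longrightarrow> norm (A s) \<le> a" "a \<ge> 0"
    and b: "AE s in lborel. s \<in> {0..l} \<longrightarrow> norm (Dl l A s) \<le> b" "b \<ge> 0"
    and am: "AE s in lborel. s \<in> {0..l} \<longrightarrow> norm (\<alpha> s) \<le> am" "am \<ge> 0"
  shows "W1inf l (competitor e A)"
    "AE s in lborel. s \<in> {0..l} \<longrightarrow> \<alpha> s * norm (Dl l (competitor e A) s)
        \<le> sqrt (((1 - e) * k + e * k')\<^sup>2 + e\<^sup>2 * (2 * am * b * a * k + a\<^sup>2 * k\<^sup>2))"
proof -
  have AW: "W1inf l A" and A0: "A 0 = 0" and As: "\<And>s. s \<in> {0..l} \<Longrightarrow> skew (A s)"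
    and Ab: "AE s in lborel. s \<in> {0..l} \<longrightarrow> \<alpha> s * norm (D s + Dl l A s *v T s) \<le> k'"
    using V unfolding variation_def by auto
  define X where "X s = T s + e *\<^sub>R (A s *v T s)" for s
  note bb = bounded_bilinear_matrix_vector
  have ATW: "W1inf l (\<lambda>s. A s *v T s)" by (rule W1inf_bounded_bilinear(1)[OF bb AW TW l])
  obtain K1 where K1: "K1-lipschitz_on {0..l} T" using TW unfolding W1inf_def by blast
  obtain K2 where K2: "K2-lipschitz_on {0..l} (\<lambda>s. A s *v T s)" using ATW unfolding W1inf_def by blast
  have XL: "(K1 + e * K2)-lipschitz_on {0..l} X"
    unfolding X_def[abs_def] using lipschitz_on_add[OF K1 lipschitz_on_cmult[OF K2, of e]] e by simp
  then have XW: "W1inf l X" unfolding W1inf_def by blast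
  have X1: "norm (X s) \<ge> 1" if "s \<in> {0..l}" for s
    using competitor_estimates(2)[where A=A and s=s and e=e, OF As a(1) e(1)] that unfolding X_def by blast
  have c: "competitor e A s = sgn (X s)" for s by (simp add: competitor_def X_def)
  have dc: "dist (competitor e A x) (competitor e A y) \<le> dist (X x) (X y)" if "x \<in> {0..l}" "y \<in> {0..l}" for x y
    unfolding c using dist_sgn_le X1 that by blast
  have "(K1 + e * K2)-lipschitz_on {0..l} (competitor e A)"
  proof (rule lipschitz_onI)
    fix x y assume xy: "x \<in> {0..l}" "y \<in> {0..l}"
    show "dist (competitor e A x) (competitor e A y) \<le> (K1 + e * K2) * dist x y"
      using dc[OF xy] lipschitz_onD[OF XL xy] by linarith
  qed (rule lipschitz_on_nonneg[OF XL])
  then show CW: "W1inf l (competitor e A)" unfolding W1inf_def by blast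
  show "AE s in lborel. s \<in> {0..l} \<longrightarrow> \<alpha> s * norm (Dl l (competitor e A) s)
        \<le> sqrt (((1 - e) * k + e * k')\<^sup>2 + e\<^sup>2 * (2 * am * b * a * k + a\<^sup>2 * k\<^sup>2))"
    using W1inf_Dl_AE[OF TW l] W1inf_Dl_AE[OF AW l] W1inf_Dl_AE[OF CW l] Ab k_AE b(1) am(1)
  proof eventually_elim
    case (elim s)
    show ?case
    proof
      assume s: "s \<in> {0..l}"
      have \<alpha>: "\<alpha> s > 0" by (rule \<alpha>_pos[OF s])
      define B where "B = Dl l A s *v T s"
      define y where "y = A s *v D s"
      have dX: "(X has_vector_derivative (D s + e *\<^sub>R B) + e *\<^sub>R y) (at s within {0..l})"
      proof -
        have "((\<lambda>s. A s *v T s) has_vector_derivative A s *v D s + Dl l A s *v T s) (at s within {0..l})"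
          using elim s unfolding D_def by (intro bounded_bilinear.has_vector_derivative[OF bb]) auto
        from has_vector_derivative_add[OF _ bounded_linear.has_vector_derivative[OF bounded_linear_scaleR_right this, of e], of T "D s"]
        show ?thesis using elim s unfolding X_def[abs_def] B_def y_def D_def by (simp add: scaleR_add_right add_ac)
      qed
      have le: "norm (Dl l (competitor e A) s) \<le> norm ((D s + e *\<^sub>R B) + e *\<^sub>R y)"
        using elim s by (intro norm_vector_derivative_le[OF _ dX dc s l]) auto
      have Dy: "D s \<bullet> y = 0" unfolding y_def by (rule skew_self[OF As[OF s]])
      have ny: "\<alpha> s * norm y \<le> a * k"
      proof -
        have "norm y \<le> a * norm (D s)"
          unfolding y_def using norm_matrix_vector_le[of "A s" "D s"] a(1)[OF s]
          by (meson mult_right_mono norm_ge_zero order_trans)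
        then have "\<alpha> s * norm y \<le> a * (\<alpha> s * norm (D s))" using \<alpha> by (simp add: mult.left_commute)
        also have "\<dots> \<le> a * k" using elim s a(2) by (intro mult_left_mono) auto
        finally show ?thesis .
      qed
      have nB: "norm B \<le> b"
        unfolding B_def using norm_matrix_vector_le[of "Dl l A s" "T s"] T_norm[OF s] elim s by auto
      \<comment> \<open>\<open>D + e B\<close> is a convex combination of \<open>D\<close>, whose
        weighted norm is at most k, and \<open>D + B\<close>, whose weighted norm is at most k'.
        This is the source of the first-order gain e (k - k').\<close>
      have "norm (D s + e *\<^sub>R B) \<le> (1 - e) * norm (D s) + e * norm (D s + B)"
      proof -
        have "D s + e *\<^sub>R B = (1 - e) *\<^sub>R D s + e *\<^sub>R (D s + B)" by (simp add: algebra_simps)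
        then have "norm (D s + e *\<^sub>R B) \<le> norm ((1 - e) *\<^sub>R D s) + norm (e *\<^sub>R (D s + B))"
          by (metis norm_triangle_ineq)
        then show ?thesis using e by simp
      qed
      then have "\<alpha> s * norm (D s + e *\<^sub>R B) \<le> (1 - e) * (\<alpha> s * norm (D s)) + e * (\<alpha> s * norm (D s + B))"
        using mult_left_mono[OF _ less_imp_le[OF \<alpha>]] by (fastforce simp: algebra_simps)
      also have "\<dots> \<le> (1 - e) * k + e * k'"
        using elim s e unfolding B_def by (intro add_mono mult_left_mono) auto
      finally have n1: "\<alpha> s * norm (D s + e *\<^sub>R B) \<le> (1 - e) * k + e * k'" .
      have "(norm ((D s + e *\<^sub>R B) + e *\<^sub>R y))\<^sup>2 = (norm (D s + e *\<^sub>R B))\<^sup>2 + e\<^sup>2 * (2 * (B \<bullet> y) + (norm y)\<^sup>2)"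
        unfolding power2_norm_eq_inner using Dy
        by (simp add: inner_add_left inner_add_right inner_commute power2_eq_square algebra_simps)
      also have "\<dots> \<le> (norm (D s + e *\<^sub>R B))\<^sup>2 + e\<^sup>2 * (2 * (b * norm y) + (norm y)\<^sup>2)"
      proof -
        have "B \<bullet> y \<le> b * norm y" using norm_cauchy_schwarz[of B y] nB by (meson mult_right_mono norm_ge_zero order_trans)
        then show ?thesis by (intro add_left_mono mult_left_mono) auto
      qed
      finally have "(\<alpha> s * norm ((D s + e *\<^sub>R B) + e *\<^sub>R y))\<^sup>2
          \<le> (\<alpha> s)\<^sup>2 * ((norm (D s + e *\<^sub>R B))\<^sup>2 + e\<^sup>2 * (2 * (b * norm y) + (norm y)\<^sup>2))"
        unfolding power_mult_distrib by (intro mult_left_mono) auto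
      also have "\<dots> = (\<alpha> s * norm (D s + e *\<^sub>R B))\<^sup>2 + e\<^sup>2 * (2 * \<alpha> s * b * (\<alpha> s * norm y) + (\<alpha> s * norm y)\<^sup>2)"
        by (simp add: power2_eq_square algebra_simps)
      also have "\<dots> \<le> ((1 - e) * k + e * k')\<^sup>2 + e\<^sup>2 * (2 * am * b * (a * k) + (a * k)\<^sup>2)"
      proof -
        have "2 * \<alpha> s * b \<le> 2 * am * b" using elim s b(2) by (intro mult_right_mono) auto
        then have t1: "2 * \<alpha> s * b * (\<alpha> s * norm y) \<le> 2 * am * b * (a * k)"
          by (rule mult_mono[OF _ ny]) (use \<alpha> b(2) am(2) in auto)
        have t2: "(\<alpha> s * norm y)\<^sup>2 \<le> (a * k)\<^sup>2" using ny by (rule power_mono) (use \<alpha> in auto)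
        have t3: "(\<alpha> s * norm (D s + e *\<^sub>R B))\<^sup>2 \<le> ((1 - e) * k + e * k')\<^sup>2" using n1 by (rule power_mono) (use \<alpha> in auto)
        show ?thesis by (intro add_mono mult_left_mono t1 t2 t3) auto
      qed
      finally have "(\<alpha> s * norm ((D s + e *\<^sub>R B) + e *\<^sub>R y))\<^sup>2
          \<le> ((1 - e) * k + e * k')\<^sup>2 + e\<^sup>2 * (2 * am * b * a * k + a\<^sup>2 * k\<^sup>2)"
        by (simp add: power_mult_distrib mult.assoc)
      then have "\<alpha> s * norm ((D s + e *\<^sub>R B) + e *\<^sub>R y)
          \<le> sqrt (((1 - e) * k + e * k')\<^sup>2 + e\<^sup>2 * (2 * am * b * a * k + a\<^sup>2 * k\<^sup>2))"
        by (rule real_le_rsqrt)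
      then show "\<alpha> s * norm (Dl l (competitor e A) s)
          \<le> sqrt (((1 - e) * k + e * k')\<^sup>2 + e\<^sup>2 * (2 * am * b * a * k + a\<^sup>2 * k\<^sup>2))"
        using mult_left_mono[OF le less_imp_le[OF \<alpha>]] by linarith
    qed
  qed
qed

end

lemma W1inf_add: "W1inf l f \<Longrightarrow> W1inf l g \<Longrightarrow> W1inf l (\<lambda>s. f s + g s)"
  unfolding W1inf_def using lipschitz_on_add by blast

lemma W1inf_const: "W1inf l (\<lambda>s. c)"
  unfolding W1inf_def by (rule exI[of _ 0]) (auto intro: lipschitz_onI)

lemma W1inf_scaleR_const:
  assumes "W1inf l f"
  shows "W1inf l (\<lambda>s. c *\<^sub>R f s)"
proof -
  obtain C where "C-lipschitz_on {0..l} f" using assms unfolding W1inf_def by blast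
  then have "(\<bar>c\<bar> * C)-lipschitz_on {0..l} (\<lambda>s. c *\<^sub>R f s)" by (rule lipschitz_on_cmult)
  then show ?thesis unfolding W1inf_def by blast
qed

lemma W1inf_sum: "finite I \<Longrightarrow> (\<And>i. i \<in> I \<Longrightarrow> W1inf l (f i)) \<Longrightarrow> W1inf l (\<lambda>s. \<Sum>i\<in>I. f i s)"
  by (induction I rule: finite_induct) (auto intro: W1inf_add W1inf_const)

lemma norm_convex_sum_le:
  assumes w: "\<And>i. i \<in> I \<Longrightarrow> w i \<ge> 0" "sum w I = 1" and x: "\<And>i. i \<in> I \<Longrightarrow> norm (x i) \<le> c"
  shows "norm (\<Sum>i\<in>I. w i *\<^sub>R x i) \<le> c"
proof -
  have "norm (\<Sum>i\<in>I. w i *\<^sub>R x i) \<le> (\<Sum>i\<in>I. w i * c)"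
    by (rule sum_norm_le) (use w x in \<open>auto intro: mult_left_mono\<close>)
  also have "\<dots> = c" using w(2) by (simp add: sum_distrib_right[symmetric])
  finally show ?thesis .
qed

lemma ex_small_improvement:
  fixes k \<delta> C N m :: real
  assumes "k > 0" "\<delta> > 0" "\<delta> \<le> k" "C \<ge> 0" "N \<ge> 0" "m > 0" "m \<le> 1"
  obtains e where "0 < e" "e \<le> m" "sqrt ((k - e * \<delta>)\<^sup>2 + e\<^sup>2 * C) + N * e\<^sup>2 < k"
proof -
  \<comment> \<open>The second bound makes the square root at most k - e \<delta> / 2, and the third
    makes N e^2 smaller than the gain e \<delta> / 2 that is left. The added ones keep the
    denominators positive.\<close>
  define e where "e = min m (min (k * \<delta> / (C + \<delta>\<^sup>2 + 1)) (\<delta> / (2 * (N + 1))))"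
  have p: "C + \<delta>\<^sup>2 + 1 > 0" "N + 1 > 0" using assms by (auto intro: add_nonneg_pos)
  have e0: "e > 0" using assms p by (simp add: e_def)
  have e1: "e \<le> 1" using assms by (simp add: e_def)
  have "e \<le> k * \<delta> / (C + \<delta>\<^sup>2 + 1)" by (simp add: e_def)
  then have "e * (C + \<delta>\<^sup>2 + 1) \<le> k * \<delta>" using p by (simp add: pos_le_divide_eq)
  then have c1: "e * (C + \<delta>\<^sup>2) \<le> k * \<delta>" using e0 by (simp add: algebra_simps)
  have "e \<le> \<delta> / (2 * (N + 1))" by (simp add: e_def)
  then have "e * (2 * (N + 1)) \<le> \<delta>" using p by (subst (asm) pos_le_divide_eq) auto
  then have c2: "N * e < \<delta> / 2" using e0 by (simp add: algebra_simps)
  have "e * \<delta> \<le> 1 * k" using e0 e1 assms by (intro mult_mono) auto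
  then have nn: "k - e * \<delta> / 2 \<ge> 0" using assms by simp
  have "(k - e * \<delta> / 2)\<^sup>2 - ((k - e * \<delta>)\<^sup>2 + e\<^sup>2 * C) = e * (k * \<delta> - e * (C + \<delta>\<^sup>2) + e * (\<delta>\<^sup>2 / 4))"
    by (simp add: power2_eq_square field_simps)
  also have "\<dots> \<ge> 0" using c1 e0 by (intro mult_nonneg_nonneg) auto
  finally have "sqrt ((k - e * \<delta>)\<^sup>2 + e\<^sup>2 * C) \<le> k - e * \<delta> / 2" using nn by (intro real_le_lsqrt) auto
  moreover have "N * e\<^sup>2 < e * \<delta> / 2"
  proof -
    have "e * (N * e) < e * (\<delta> / 2)" using c2 e0 by (rule mult_strict_left_mono)
    then show ?thesis by (simp add: power2_eq_square algebra_simps)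
  qed
  ultimately have "sqrt ((k - e * \<delta>)\<^sup>2 + e\<^sup>2 * C) + N * e\<^sup>2 < k" by linarith
  then show ?thesis using e0 that[of e] by (simp add: e_def)
qed

section \<open>The linearised endpoint map\<close>

context weighted_curve
begin

text \<open>First-order change of the integral of the tangent and of its end value. The vector
  \<open>A l *v T2\<close> is orthogonal to \<open>T2\<close>, so without a radial summand the
  second component would stay in a hyperplane and the set of endpoints could not have interior. The
  parameter \<open>c\<close> fills the missing dimension; it corresponds to a factor 1 + e c on the
  end tangent of the competitor.\<close>

definition endpoint :: "(real \<Rightarrow> real^'n^'n) \<Rightarrow> real \<Rightarrow> (real^'n) \<times> (real^'n)" where
  "endpoint A c = (integral {0..l} (\<lambda>s. A s *v T s), A l *v T2 + c *\<^sub>R T2)"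

definition endpoints :: "((real^'n) \<times> (real^'n)) set" where
  "endpoints = {endpoint A c | A c. \<exists>k'<k. 0 \<le> k' \<and> variation k' A}"

lemma matrix_vector_sum: "(\<Sum>i\<in>I. w i *\<^sub>R B i) *v x = (\<Sum>i\<in>I. w i *\<^sub>R (B i *v x))"
  for B :: "'b \<Rightarrow> real^'n^'n"
  using bounded_bilinear.sum_left[OF bounded_bilinear_matrix_vector, of "\<lambda>i. w i *\<^sub>R B i" I x]
  by (simp add: bounded_bilinear.scaleR_left[OF bounded_bilinear_matrix_vector])

lemma variation_mono: "variation k1 A \<Longrightarrow> k1 \<le> k2 \<Longrightarrow> variation k2 A"
  unfolding variation_def by (auto elim!: eventually_mono)

text \<open>The curvature bound is a norm bound on an affine function of \<open>A'\<close>, and the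
  endpoint is linear in the pair, so both respect convex combinations. Finite index sets of any size
  serve the convexity of \<open>endpoints\<close> as well as the selection over a
  cross-polytope.\<close>

lemma variation_convex_combination:
  assumes I: "finite I" and V: "\<And>i. i \<in> I \<Longrightarrow> variation k' (A i)"
    and w: "\<And>i. i \<in> I \<Longrightarrow> w i \<ge> 0" "sum w I = 1"
  shows "variation k' (\<lambda>s. \<Sum>i\<in>I. w i *\<^sub>R A i s)"
    "endpoint (\<lambda>s. \<Sum>i\<in>I. w i *\<^sub>R A i s) (\<Sum>i\<in>I. w i * c i) = (\<Sum>i\<in>I. w i *\<^sub>R endpoint (A i) (c i))"
    "AE s in lborel. s \<in> {0..l} \<longrightarrow> Dl l (\<lambda>s. \<Sum>i\<in>I. w i *\<^sub>R A i s) s = (\<Sum>i\<in>I. w i *\<^sub>R Dl l (A i) s)"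
proof -
  have W: "W1inf l (A i)" if "i \<in> I" for i using V[OF that] by (simp add: variation_def)
  have "AE s in lborel. \<forall>i\<in>I. s \<in> {0..l} \<longrightarrow> (A i has_vector_derivative Dl l (A i) s) (at s within {0..l})"
    by (rule AE_finite_allI[OF I W1inf_Dl_AE[OF W l]])
  then show dl: "AE s in lborel. s \<in> {0..l} \<longrightarrow> Dl l (\<lambda>s. \<Sum>i\<in>I. w i *\<^sub>R A i s) s = (\<Sum>i\<in>I. w i *\<^sub>R Dl l (A i) s)"
  proof eventually_elim
    case (elim s)
    show ?case
    proof
      assume s: "s \<in> {0..l}"
      show "Dl l (\<lambda>s. \<Sum>i\<in>I. w i *\<^sub>R A i s) s = (\<Sum>i\<in>I. w i *\<^sub>R Dl l (A i) s)"
        by (rule Dl_eqI[OF has_vector_derivative_sum s l],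
            rule bounded_linear.has_vector_derivative[OF bounded_linear_scaleR_right]) (use elim s in auto)
    qed
  qed
  show "variation k' (\<lambda>s. \<Sum>i\<in>I. w i *\<^sub>R A i s)" unfolding variation_def
  proof (intro conjI ballI)
    show "W1inf l (\<lambda>s. \<Sum>i\<in>I. w i *\<^sub>R A i s)" by (rule W1inf_sum[OF I W1inf_scaleR_const[OF W]])
    show "(\<Sum>i\<in>I. w i *\<^sub>R A i 0) = 0" using V by (simp add: variation_def)
    show "skew (\<Sum>i\<in>I. w i *\<^sub>R A i s)" if "s \<in> {0..l}" for s
      using V that by (auto simp: variation_def intro!: skew_sum skew_scaleR)
    have "AE s in lborel. \<forall>i\<in>I. s \<in> {0..l} \<longrightarrow> \<alpha> s * norm (D s + Dl l (A i) s *v T s) \<le> k'"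
      by (rule AE_finite_allI[OF I]) (use V in \<open>simp add: variation_def\<close>)
    with dl show "AE s in lborel. s \<in> {0..l} \<longrightarrow> \<alpha> s * norm (D s + Dl l (\<lambda>s. \<Sum>i\<in>I. w i *\<^sub>R A i s) s *v T s) \<le> k'"
    proof eventually_elim
      case (elim s)
      show ?case
      proof
        assume s: "s \<in> {0..l}"
        have \<alpha>: "\<alpha> s > 0" by (rule \<alpha>_pos[OF s])
        have "D s + Dl l (\<lambda>s. \<Sum>i\<in>I. w i *\<^sub>R A i s) s *v T s = (\<Sum>i\<in>I. w i *\<^sub>R (D s + Dl l (A i) s *v T s))"
          using elim s w(2) by (simp add: matrix_vector_sum scaleR_add_right sum.distrib scaleR_left.sum[symmetric])
        moreover have "norm (\<Sum>i\<in>I. w i *\<^sub>R (D s + Dl l (A i) s *v T s)) \<le> k' / \<alpha> s"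
          by (rule norm_convex_sum_le[OF w]) (use elim s \<alpha> in \<open>auto simp: pos_le_divide_eq mult.commute\<close>)
        ultimately show "\<alpha> s * norm (D s + Dl l (\<lambda>s. \<Sum>i\<in>I. w i *\<^sub>R A i s) s *v T s) \<le> k'"
          using \<alpha> by (simp add: pos_le_divide_eq mult.commute)
      qed
    qed
  qed
  have int: "(\<lambda>s. A i s *v T s) integrable_on {0..l}" if "i \<in> I" for i
    by (rule integrable_continuous_real[OF W1inf_continuous[OF W1inf_bounded_bilinear(1)[OF bounded_bilinear_matrix_vector W[OF that] TW l]]])
  have "integral {0..l} (\<lambda>s. (\<Sum>i\<in>I. w i *\<^sub>R A i s) *v T s) = (\<Sum>i\<in>I. w i *\<^sub>R integral {0..l} (\<lambda>s. A i s *v T s))"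
    unfolding matrix_vector_sum using int by (subst Henstock_Kurzweil_Integration.integral_sum[OF I]) (auto intro: integrable_cmul)
  then show "endpoint (\<lambda>s. \<Sum>i\<in>I. w i *\<^sub>R A i s) (\<Sum>i\<in>I. w i * c i) = (\<Sum>i\<in>I. w i *\<^sub>R endpoint (A i) (c i))"
    unfolding endpoint_def prod_eq_iff
    by (simp add: matrix_vector_sum fst_sum snd_sum scaleR_add_right sum.distrib scaleR_left.sum)
qed

lemma convex_endpoints: "convex endpoints"
proof (rule convexI)
  fix x y and u v :: real assume xy: "x \<in> endpoints" "y \<in> endpoints" and uv: "0 \<le> u" "0 \<le> v" "u + v = 1"
  obtain A c k1 where x: "x = endpoint A c" "k1 < k" "0 \<le> k1" "variation k1 A" using xy(1) unfolding endpoints_def by blast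
  obtain B d k2 where y: "y = endpoint B d" "k2 < k" "0 \<le> k2" "variation k2 B" using xy(2) unfolding endpoints_def by blast
  \<comment> \<open>Indexing by booleans specialises the finite combination to two summands.\<close>
  define F where "F i = (if i then A else B)" for i
  define w where "w i = (if i then u else v)" for i
  define e where "e i = (if i then c else d)" for i
  have V: "variation (max k1 k2) (F i)" for i using x y variation_mono by (simp add: F_def)
  note cc = variation_convex_combination[of UNIV "max k1 k2" F w, OF _ V]
  have w: "w i \<ge> 0" "sum w UNIV = 1" for i using uv by (auto simp: w_def UNIV_bool)
  have "u *\<^sub>R x + v *\<^sub>R y = endpoint (\<lambda>s. \<Sum>i\<in>UNIV. w i *\<^sub>R F i s) (\<Sum>i\<in>UNIV. w i * e i)"
    using cc(2)[OF _ w, of e] x(1) y(1) by (simp add: UNIV_bool w_def F_def e_def add.commute)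
  moreover have "variation (max k1 k2) (\<lambda>s. \<Sum>i\<in>UNIV. w i *\<^sub>R F i s)" using cc(1)[OF _ w] by simp
  moreover have "max k1 k2 < k" "0 \<le> max k1 k2" using x y by auto
  ultimately show "u *\<^sub>R x + v *\<^sub>R y \<in> endpoints" unfolding endpoints_def by blast
qed

text \<open>Three errors of second order add up: normalisation costs \<open>a\<^sup>2\<close> under
  the integral, hence \<open>l * a\<^sup>2\<close>, and \<open>a\<^sup>2\<close> once more at the
  end point; the radial factor times the displacement of the end tangent costs
  \<open>cm * a\<close>.\<close>

lemma endpoint_competitor_close:
  assumes V: "variation k' A" and e: "0 \<le> e" and a: "\<And>s. s \<in> {0..l} \<Longrightarrow> norm (A s) \<le> a" "a \<ge> 0"
    and c: "\<bar>c\<bar> \<le> cm" and W: "W1inf l (competitor e A)"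
  shows "norm ((integral {0..l} (\<lambda>s. competitor e A s - T s), (1 + e * c) *\<^sub>R competitor e A l - T2)
      - e *\<^sub>R endpoint A c) \<le> (l * a\<^sup>2 + a\<^sup>2 + cm * a) * e\<^sup>2"
proof -
  have AW: "W1inf l A" and As: "\<And>s. s \<in> {0..l} \<Longrightarrow> skew (A s)" using V unfolding variation_def by auto
  have est3: "norm (competitor e A s - (T s + e *\<^sub>R (A s *v T s))) \<le> e\<^sup>2 * a\<^sup>2"
    and est4: "norm (competitor e A s - T s) \<le> e * a" if s: "s \<in> {0..l}" for s
    using competitor_estimates(3,4)[where A=A, OF As[OF s] a(1)[OF s] e s] by blast+
  have i1: "competitor e A integrable_on {0..l}" "T integrable_on {0..l}"
    using W1inf_continuous[OF W] W1inf_continuous[OF TW] integrable_continuous_real by blast+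
  have i2: "(\<lambda>s. A s *v T s) integrable_on {0..l}"
    by (rule integrable_continuous_real[OF W1inf_continuous[OF W1inf_bounded_bilinear(1)[OF bounded_bilinear_matrix_vector AW TW l]]])
  have "((\<lambda>s. competitor e A s - T s - e *\<^sub>R (A s *v T s)) has_integral
      integral {0..l} (\<lambda>s. competitor e A s - T s) - e *\<^sub>R integral {0..l} (\<lambda>s. A s *v T s)) {0..l}"
    by (intro has_integral_diff has_integral_cmul integrable_integral integrable_diff i1 i2)
  then have 1: "norm (integral {0..l} (\<lambda>s. competitor e A s - T s) - e *\<^sub>R integral {0..l} (\<lambda>s. A s *v T s)) \<le> (e\<^sup>2 * a\<^sup>2) * l"
  proof -
    assume i: "((\<lambda>s. competitor e A s - T s - e *\<^sub>R (A s *v T s)) has_integral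
      integral {0..l} (\<lambda>s. competitor e A s - T s) - e *\<^sub>R integral {0..l} (\<lambda>s. A s *v T s)) {0..l}"
    have "norm (competitor e A s - T s - e *\<^sub>R (A s *v T s)) \<le> e\<^sup>2 * a\<^sup>2" if "s \<in> {0..l} - {}" for s
      using est3[of s] that by (simp add: diff_diff_eq)
    from has_integral_bound_real[OF _ finite.emptyI i this] show ?thesis using l by simp
  qed
  have ll: "l \<in> {0..l}" using l by simp
  have "(1 + e * c) *\<^sub>R competitor e A l - T2 - e *\<^sub>R (A l *v T2 + c *\<^sub>R T2)
      = (competitor e A l - (T l + e *\<^sub>R (A l *v T l))) + (e * c) *\<^sub>R (competitor e A l - T l)"
    by (simp add: Tl algebra_simps)
  then have "norm ((1 + e * c) *\<^sub>R competitor e A l - T2 - e *\<^sub>R (A l *v T2 + c *\<^sub>R T2))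
      \<le> norm (competitor e A l - (T l + e *\<^sub>R (A l *v T l))) + norm ((e * c) *\<^sub>R (competitor e A l - T l))"
    by (metis norm_triangle_ineq)
  also have "\<dots> \<le> e\<^sup>2 * a\<^sup>2 + (e * cm) * (e * a)"
    unfolding norm_scaleR using est3[OF ll] est4[OF ll] e c a(2)
    by (intro add_mono mult_mono) (auto simp: abs_mult intro: mult_left_mono)
  finally have 2: "norm ((1 + e * c) *\<^sub>R competitor e A l - T2 - e *\<^sub>R (A l *v T2 + c *\<^sub>R T2)) \<le> e\<^sup>2 * a\<^sup>2 + (e * cm) * (e * a)" .
  have "norm (x, y) \<le> norm x + norm y" for x y :: "real^'n" by (rule norm_Pair_le)
  then have "norm ((integral {0..l} (\<lambda>s. competitor e A s - T s), (1 + e * c) *\<^sub>R competitor e A l - T2) - e *\<^sub>R endpoint A c)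
     \<le> norm (integral {0..l} (\<lambda>s. competitor e A s - T s) - e *\<^sub>R integral {0..l} (\<lambda>s. A s *v T s))
      + norm ((1 + e * c) *\<^sub>R competitor e A l - T2 - e *\<^sub>R (A l *v T2 + c *\<^sub>R T2))"
    by (simp add: endpoint_def)
  also have "\<dots> \<le> (e\<^sup>2 * a\<^sup>2) * l + (e\<^sup>2 * a\<^sup>2 + (e * cm) * (e * a))"
    using 1 2 l by simp
  finally show ?thesis by (simp add: algebra_simps power2_eq_square)
qed

text \<open>A tangent within e a of \<open>T\<close> is charged at most (|M| / 2) l (e a)^2, which
  is the origin of \<open>N\<close>; the absolute value covers negative M. The form with tangents
  instead of curves is the one in which the competitors are built.\<close>

lemma inf_elastica_excludes_competitor:
  assumes el: "inf_elastica l \<alpha> a1 a2 T1 T2 \<gamma>"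
  obtains N where "N \<ge> 0" "\<And>\<tau> e a Q. W1inf l \<tau> \<Longrightarrow> (\<And>s. s \<in> {0..l} \<Longrightarrow> norm (\<tau> s) = 1) \<Longrightarrow> \<tau> 0 = T1 \<Longrightarrow> \<tau> l = T2 \<Longrightarrow>
    integral {0..l} \<tau> = a2 - a1 \<Longrightarrow> (AE s in lborel. s \<in> {0..l} \<longrightarrow> \<alpha> s * norm (Dl l \<tau> s) \<le> Q) \<Longrightarrow>
    (\<And>s. s \<in> {0..l} \<Longrightarrow> norm (\<tau> s - T s) \<le> e * a) \<Longrightarrow> k \<le> Q + N * a\<^sup>2 * e\<^sup>2"
proof -
  obtain M where M: "\<And>\<gamma>'. admissible l a1 a2 T1 T2 \<gamma>' \<Longrightarrow>
        Kalpha l \<alpha> \<gamma> \<le> Kalpha l \<alpha> \<gamma>' + M / 2 * integral {0..l} (\<lambda>s. (norm (Dl l \<gamma>' s - Dl l \<gamma> s))\<^sup>2)"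
    using el unfolding inf_elastica_def by blast
  show ?thesis
  proof (rule that[of "\<bar>M\<bar> / 2 * l"])
    show "\<bar>M\<bar> / 2 * l \<ge> 0" using l by simp
    fix \<tau> :: "real \<Rightarrow> real^'n" and e a Q :: real
    assume \<tau>: "W1inf l \<tau>" "\<And>s. s \<in> {0..l} \<Longrightarrow> norm (\<tau> s) = 1" "\<tau> 0 = T1" "\<tau> l = T2" "integral {0..l} \<tau> = a2 - a1"
      and Q: "AE s in lborel. s \<in> {0..l} \<longrightarrow> \<alpha> s * norm (Dl l \<tau> s) \<le> Q"
      and near: "\<And>s. s \<in> {0..l} \<Longrightarrow> norm (\<tau> s - T s) \<le> e * a"
    obtain \<gamma>' where \<gamma>': "admissible l a1 a2 T1 T2 \<gamma>'" "\<And>s. s \<in> {0..l} \<Longrightarrow> Dl l \<gamma>' s = \<tau> s"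
      using admissible_of_tangent[OF \<tau> l] by blast
    have "Kalpha l \<alpha> \<gamma>' \<le> Q"
    proof (rule Kalpha_bounds(3)[OF l \<alpha>L _ admissible_tangent(1)[OF \<gamma>'(1) l]])
      show "\<alpha> s \<ge> 0" if "s \<in> {0..l}" for s using \<alpha>_pos[OF that] by simp
      show "AE s in lborel. s \<in> {0..l} \<longrightarrow> \<alpha> s * norm (Dl l (Dl l \<gamma>') s) \<le> Q"
        using Q
      proof eventually_elim
        case (elim s)
        then show ?case using Dl_cong[of l "Dl l \<gamma>'" \<tau> s] \<gamma>'(2) by auto
      qed
    qed
    moreover have "M / 2 * integral {0..l} (\<lambda>s. (norm (Dl l \<gamma>' s - Dl l \<gamma> s))\<^sup>2) \<le> \<bar>M\<bar> / 2 * (l * (e * a)\<^sup>2)"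
    proof -
      have eq: "integral {0..l} (\<lambda>s. (norm (Dl l \<gamma>' s - Dl l \<gamma> s))\<^sup>2) = integral {0..l} (\<lambda>s. (norm (\<tau> s - T s))\<^sup>2)"
        by (rule integral_cong) (simp add: \<gamma>'(2) T_def)
      have i: "(\<lambda>s. (norm (\<tau> s - T s))\<^sup>2) integrable_on {0..l}"
        by (intro integrable_continuous_real continuous_intros W1inf_continuous[OF \<tau>(1)] W1inf_continuous[OF TW])
      have "integral {0..l} (\<lambda>s. (norm (\<tau> s - T s))\<^sup>2) \<le> integral {0..l} (\<lambda>s. (e * a)\<^sup>2)"
        by (rule integral_le[OF i]) (auto intro!: power_mono near)
      then have up: "integral {0..l} (\<lambda>s. (norm (\<tau> s - T s))\<^sup>2) \<le> l * (e * a)\<^sup>2" using l by simp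
      have lo: "0 \<le> integral {0..l} (\<lambda>s. (norm (\<tau> s - T s))\<^sup>2)"
        by (rule Henstock_Kurzweil_Integration.integral_nonneg[OF i]) simp
      have "M / 2 * integral {0..l} (\<lambda>s. (norm (\<tau> s - T s))\<^sup>2) \<le> \<bar>M\<bar> / 2 * integral {0..l} (\<lambda>s. (norm (\<tau> s - T s))\<^sup>2)"
        using lo by (intro mult_right_mono) auto
      also have "\<dots> \<le> \<bar>M\<bar> / 2 * (l * (e * a)\<^sup>2)" using up by (intro mult_left_mono) auto
      finally show ?thesis unfolding eq .
    qed
    ultimately show "k \<le> Q + (\<bar>M\<bar> / 2 * l) * a\<^sup>2 * e\<^sup>2"
      using M[OF \<gamma>'(1)] by (simp add: k_def power_mult_distrib algebra_simps)
  qed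
qed

end

section \<open>Endpoint variations\<close>

lemma finite_uniform_bound:
  assumes "finite I" "\<And>i. i \<in> I \<Longrightarrow> \<exists>c. P i c" and mono: "\<And>i c d. P i c \<Longrightarrow> c \<le> d \<Longrightarrow> P i d"
  obtains c :: real where "c \<ge> 0" "\<And>i. i \<in> I \<Longrightarrow> P i c"
proof -
  obtain f where f: "\<And>i. i \<in> I \<Longrightarrow> P i (f i)" using assms(2) by metis
  define c where "c = (\<Sum>i\<in>I. \<bar>f i\<bar>)"
  have le: "f i \<le> c" if "i \<in> I" for i
    using member_le_sum[of i I "\<lambda>i. \<bar>f i\<bar>"] that assms(1) unfolding c_def by force
  show ?thesis
  proof (rule that[of c])
    show "P i c" if "i \<in> I" for i by (rule mono[OF f[OF that] le[OF that]])
  qed (simp add: c_def sum_nonneg)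
qed

text \<open>Provides the continuous choice of variations with prescribed endpoint that Brouwer's theorem needs.\<close>
lemma cross_polytope_weights:
  fixes R :: real
  defines "I \<equiv> (Basis :: 'a::euclidean_space set) \<times> {1, -1 :: real}"
    and "w \<equiv> \<lambda>y i. 1 / (2 * real DIM('a)) + (y \<bullet> (snd i *\<^sub>R fst i)) / (2 * R)"
  assumes R: "R > 0"
  shows "norm y \<le> R / real DIM('a) \<Longrightarrow> i \<in> I \<Longrightarrow> w y i \<ge> 0"
    "sum (w y) I = 1" "(\<Sum>i\<in>I. w y i *\<^sub>R (R *\<^sub>R (snd i *\<^sub>R fst i))) = (y::'a)"
proof -
  have S: "(\<Sum>i\<in>I. h i) = (\<Sum>b\<in>Basis. h (b, 1) + h (b, -1))" for h :: "'a \<times> real \<Rightarrow> 'c::comm_monoid_add"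
  proof -
    have "sum h I = (\<Sum>b\<in>Basis. \<Sum>\<sigma>\<in>{1, -1}. h (b, \<sigma>))"
      unfolding I_def by (simp only: sum.cartesian_product case_prod_eta)
    then show ?thesis by simp
  qed
  show "sum (w y) I = 1" unfolding S w_def by simp
  show "(\<Sum>i\<in>I. w y i *\<^sub>R (R *\<^sub>R (snd i *\<^sub>R fst i))) = y"
  proof -
    have "w y (b, 1) *\<^sub>R (R *\<^sub>R (1 *\<^sub>R b)) + w y (b, -1) *\<^sub>R (R *\<^sub>R (-1 *\<^sub>R b)) = (y \<bullet> b) *\<^sub>R b" for b
      using R by (simp add: w_def scaleR_diff_left[symmetric] field_simps)
    then show ?thesis unfolding S by (simp add: euclidean_representation)
  qed
  show "w y i \<ge> 0" if y: "norm y \<le> R / real DIM('a)" and i: "i \<in> I"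
  proof -
    have "\<bar>y \<bullet> (snd i *\<^sub>R fst i)\<bar> \<le> norm y * norm (snd i *\<^sub>R fst i)" by (rule Cauchy_Schwarz_ineq2)
    also have "\<dots> = norm y" using i by (auto simp: I_def)
    finally have "- (R / real DIM('a)) \<le> y \<bullet> (snd i *\<^sub>R fst i)" using y by linarith
    then have "- (R / real DIM('a)) / (2 * R) \<le> (y \<bullet> (snd i *\<^sub>R fst i)) / (2 * R)"
      using R by (intro divide_right_mono) auto
    then show ?thesis using R by (simp add: w_def)
  qed
qed

context weighted_curve
begin

text \<open>If 0 were interior, Brouwer's theorem would correct the endpoint error of the nonlinear
  competitors, giving an admissible curve that violates the defining inequality.\<close>
lemma zero_not_interior_endpoints:
  assumes el: "inf_elastica l \<alpha> a1 a2 T1 T2 \<gamma>" and k: "k > 0"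
  shows "0 \<notin> interior endpoints"
proof
  assume "0 \<in> interior endpoints"
  then obtain R where R: "R > 0" "cball 0 R \<subseteq> endpoints" using mem_interior_cball by blast
  define I where "I = (Basis :: ((real^'n) \<times> (real^'n)) set) \<times> {1, -1 :: real}"
  define w where "w y i = 1 / (2 * real DIM((real^'n) \<times> (real^'n))) + (y \<bullet> (snd i *\<^sub>R fst i)) / (2 * R)"
    for y :: "(real^'n) \<times> (real^'n)" and i :: "((real^'n) \<times> (real^'n)) \<times> real"
  \<comment> \<open>On the ball of this radius all cross-polytope weights are nonnegative.\<close>
  define r where "r = R / real DIM((real^'n) \<times> (real^'n))"
  have r: "r > 0" unfolding r_def using R(1) by (intro divide_pos_pos) auto
  note cpw = cross_polytope_weights[OF R(1), where 'a="(real^'n) \<times> (real^'n)", folded I_def, folded w_def, folded r_def]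
  have I: "finite I" by (simp add: I_def)
  \<comment> \<open>Every vertex of the cross-polytope of radius R is the endpoint of some
    variation; being finitely many, the vertices admit common constants \<open>k'\<close>,
    \<open>a\<close>, \<open>b\<close> and \<open>cm\<close>.\<close>
  have "\<exists>A c k'. R *\<^sub>R (snd i *\<^sub>R fst i) = endpoint A c \<and> k' < k \<and> 0 \<le> k' \<and> variation k' A" if "i \<in> I" for i
  proof -
    have "norm (R *\<^sub>R (snd i *\<^sub>R fst i)) \<le> R" using that R(1) by (auto simp: I_def)
    then have "R *\<^sub>R (snd i *\<^sub>R fst i) \<in> endpoints" using R(2) by auto
    then show ?thesis unfolding endpoints_def by blast
  qed
  then obtain A c \<kappa> where A: "\<And>i. i \<in> I \<Longrightarrow> R *\<^sub>R (snd i *\<^sub>R fst i) = endpoint (A i) (c i)"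
    "\<And>i. i \<in> I \<Longrightarrow> \<kappa> i < k" "\<And>i. i \<in> I \<Longrightarrow> 0 \<le> \<kappa> i" "\<And>i. i \<in> I \<Longrightarrow> variation (\<kappa> i) (A i)" by metis
  obtain b0 :: "(real^'n) \<times> (real^'n)" where b0: "b0 \<in> Basis" using nonempty_Basis by blast
  have Ine: "I \<noteq> {}" using b0 by (auto simp: I_def)
  define k' where "k' = Max (\<kappa> ` I)"
  have k': "k' < k" "0 \<le> k'" "\<kappa> i \<le> k'" if "i \<in> I" for i
    using I Ine A(2,3) that unfolding k'_def by (auto simp: Max_ge_iff)
  have k'k: "k' < k" "0 \<le> k'" using k' Ine by blast+
  have V: "variation k' (A i)" if "i \<in> I" for i by (rule variation_mono[OF A(4)[OF that] k'(3)[OF that]])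
  have AW: "W1inf l (A i)" if "i \<in> I" for i using V[OF that] by (simp add: variation_def)
  obtain a where a: "a \<ge> 0" "\<And>i. i \<in> I \<Longrightarrow> \<forall>s\<in>{0..l}. norm (A i s) \<le> a"
  proof (rule finite_uniform_bound[OF I, of "\<lambda>i a. \<forall>s\<in>{0..l}. norm (A i s) \<le> a"])
    fix i assume "i \<in> I"
    then have "bounded (A i ` {0..l})" using W1inf_continuous[OF AW] compact_continuous_image compact_imp_bounded by blast
    then show "\<exists>c. \<forall>s\<in>{0..l}. norm (A i s) \<le> c" unfolding bounded_iff by blast
  qed (auto intro: order_trans)
  obtain b where b: "b \<ge> 0" "\<And>i. i \<in> I \<Longrightarrow> AE s in lborel. s \<in> {0..l} \<longrightarrow> norm (Dl l (A i) s) \<le> b"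
  proof (rule finite_uniform_bound[OF I, of "\<lambda>i b. AE s in lborel. s \<in> {0..l} \<longrightarrow> norm (Dl l (A i) s) \<le> b"])
    fix i assume "i \<in> I"
    then show "\<exists>c. AE s in lborel. s \<in> {0..l} \<longrightarrow> norm (Dl l (A i) s) \<le> c"
      using Linf_AE_bound[OF W1inf_Dl_Linf[OF AW l]] by metis
  qed (auto elim!: eventually_mono)
  obtain cm where cm: "cm \<ge> 0" "\<And>i. i \<in> I \<Longrightarrow> \<bar>c i\<bar> \<le> cm"
    by (rule finite_uniform_bound[OF I, of "\<lambda>i m. \<bar>c i\<bar> \<le> m"]) auto
  obtain am where am: "am \<ge> 0" "AE s in lborel. s \<in> {0..l} \<longrightarrow> norm (\<alpha> s) \<le> am" using Linf_AE_bound[OF \<alpha>L] by blast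
  obtain N where N: "N \<ge> 0" "\<And>\<tau> e a Q. W1inf l \<tau> \<Longrightarrow> (\<And>s. s \<in> {0..l} \<Longrightarrow> norm (\<tau> s) = 1) \<Longrightarrow> \<tau> 0 = T1 \<Longrightarrow> \<tau> l = T2 \<Longrightarrow>
    integral {0..l} \<tau> = a2 - a1 \<Longrightarrow> (AE s in lborel. s \<in> {0..l} \<longrightarrow> \<alpha> s * norm (Dl l \<tau> s) \<le> Q) \<Longrightarrow>
    (\<And>s. s \<in> {0..l} \<Longrightarrow> norm (\<tau> s - T s) \<le> e * a) \<Longrightarrow> k \<le> Q + N * a\<^sup>2 * e\<^sup>2"
    using inf_elastica_excludes_competitor[OF el] by blast
  define C1 where "C1 = 2 * am * b * a * k + a\<^sup>2 * k\<^sup>2"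
  define C2 where "C2 = l * a\<^sup>2 + a\<^sup>2 + cm * a"
  have C: "C1 \<ge> 0" "C2 \<ge> 0" unfolding C1_def C2_def using am a b cm k l by auto
  \<comment> \<open>The second bound gives C2 e \<le> r, so that Brouwer's map preserves the ball;
    the third gives e cm < 1, so that the radial factor 1 + e d stays positive.\<close>
  define m where "m = min 1 (min (r / (C2 + 1)) (1 / (2 * (cm + 1))))"
  have m: "m > 0" "m \<le> 1" using r C cm by (auto simp: m_def)
  obtain e where e: "0 < e" "e \<le> m" "sqrt ((k - e * (k - k'))\<^sup>2 + e\<^sup>2 * C1) + (N * a\<^sup>2) * e\<^sup>2 < k"
    using ex_small_improvement[of k "k - k'" C1 "N * a\<^sup>2" m] k k'k C N m by auto
  have e1: "e \<le> 1" using e m by linarith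
  have "e \<le> r / (C2 + 1)" using e by (simp add: m_def)
  then have "e * (C2 + 1) \<le> r" using C by (subst (asm) pos_le_divide_eq) auto
  then have eC: "C2 * e \<le> r" using e(1) by (simp add: algebra_simps)
  have "e \<le> 1 / (2 * (cm + 1))" using e by (simp add: m_def)
  then have "e * (2 * (cm + 1)) \<le> 1" using cm by (subst (asm) pos_le_divide_eq) auto
  then have ecm: "e * cm < 1" using e(1) by (simp add: algebra_simps)
  \<comment> \<open>For y in the ball the linearised endpoint of \<open>B y\<close> is exactly y,
    and \<open>B y\<close> depends on y only through affine weights, hence continuously.\<close>
  define B where "B y s = (\<Sum>i\<in>I. w y i *\<^sub>R A i s)" for y s
  define d where "d y = (\<Sum>i\<in>I. w y i * c i)" for y
  have wpos: "w y i \<ge> 0" if "y \<in> cball 0 r" "i \<in> I" for y i using cpw(1)[of y i] that by simp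
  have BV: "variation k' (B y)" and Bend: "endpoint (B y) (d y) = y"
    and Ba: "s \<in> {0..l} \<Longrightarrow> norm (B y s) \<le> a"
    and Bb: "AE s in lborel. s \<in> {0..l} \<longrightarrow> norm (Dl l (B y) s) \<le> b"
    and dm: "\<bar>d y\<bar> \<le> cm" if y: "y \<in> cball 0 r" for y s
  proof -
    note cc = variation_convex_combination[of I k' A "w y", OF I V wpos[OF y] cpw(2)]
    show "variation k' (B y)" using cc(1) unfolding B_def[abs_def] by blast
    have "endpoint (B y) (d y) = (\<Sum>i\<in>I. w y i *\<^sub>R endpoint (A i) (c i))"
      using cc(2)[where c=c] unfolding B_def[abs_def] d_def by blast
    also have "\<dots> = (\<Sum>i\<in>I. w y i *\<^sub>R (R *\<^sub>R (snd i *\<^sub>R fst i)))" by (rule sum.cong[OF refl]) (simp only: A(1))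
    finally show "endpoint (B y) (d y) = y" using cpw(3)[of y] by simp
    show "norm (B y s) \<le> a" if "s \<in> {0..l}"
      unfolding B_def by (rule norm_convex_sum_le[OF wpos[OF y] cpw(2)]) (use a(2) that in auto)
    have "AE s in lborel. \<forall>i\<in>I. s \<in> {0..l} \<longrightarrow> norm (Dl l (A i) s) \<le> b" by (rule AE_finite_allI[OF I b(2)])
    moreover have "AE s in lborel. s \<in> {0..l} \<longrightarrow> Dl l (B y) s = (\<Sum>i\<in>I. w y i *\<^sub>R Dl l (A i) s)"
      using cc(3) unfolding B_def[abs_def] by blast
    ultimately show "AE s in lborel. s \<in> {0..l} \<longrightarrow> norm (Dl l (B y) s) \<le> b"
    proof eventually_elim
      case (elim s)
      show ?case
      proof
        assume s: "s \<in> {0..l}"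
        have "norm (\<Sum>i\<in>I. w y i *\<^sub>R Dl l (A i) s) \<le> b"
          by (rule norm_convex_sum_le[OF wpos[OF y] cpw(2)]) (use elim s in auto)
        then show "norm (Dl l (B y) s) \<le> b" using elim s by simp
      qed
    qed
    have "norm (\<Sum>i\<in>I. w y i *\<^sub>R c i) \<le> cm"
      by (rule norm_convex_sum_le[OF wpos[OF y] cpw(2)]) (use cm(2) in auto)
    then show "\<bar>d y\<bar> \<le> cm" by (simp add: d_def)
  qed
  define \<tau> where "\<tau> y = competitor e (B y)" for y
  have \<tau>W: "W1inf l (\<tau> y)" and \<tau>K: "AE s in lborel. s \<in> {0..l} \<longrightarrow> \<alpha> s * norm (Dl l (\<tau> y) s) \<le> sqrt ((k - e * (k - k'))\<^sup>2 + e\<^sup>2 * C1)"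
    if y: "y \<in> cball 0 r" for y
  proof -
    note cc = competitor_curvature[OF BV[OF y] less_imp_le[OF e(1)] e1 k'k(2) Ba[OF y] a(1) Bb[OF y] b(1) am(2,1)]
    show "W1inf l (\<tau> y)" unfolding \<tau>_def by (rule cc(1))
    have "(1 - e) * k + e * k' = k - e * (k - k')" by (simp add: algebra_simps)
    then show "AE s in lborel. s \<in> {0..l} \<longrightarrow> \<alpha> s * norm (Dl l (\<tau> y) s) \<le> sqrt ((k - e * (k - k'))\<^sup>2 + e\<^sup>2 * C1)"
      using cc(2) unfolding \<tau>_def C1_def by simp
  qed
  have Bskew: "skew (B y s)" if "y \<in> cball 0 r" "s \<in> {0..l}" for y s
    using BV[OF that(1)] that(2) by (simp add: variation_def)
  define F where "F y = (integral {0..l} (\<lambda>s. \<tau> y s - T s), (1 + e * d y) *\<^sub>R \<tau> y l - T2)" for y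
  have Fclose: "norm (F y - e *\<^sub>R y) \<le> C2 * e\<^sup>2" if y: "y \<in> cball 0 r" for y
    using endpoint_competitor_close[OF BV[OF y] less_imp_le[OF e(1)] Ba[OF y] a(1) dm[OF y] \<tau>W[OF y, unfolded \<tau>_def]] Bend[OF y]
    unfolding F_def \<tau>_def C2_def by simp
  have cw: "continuous_on S (\<lambda>y. w y i)" for i S unfolding w_def by (intro continuous_intros) (use R(1) in auto)
  have cX: "continuous_on (cball 0 r \<times> {0..l}) (\<lambda>z. T (snd z) + e *\<^sub>R (B (fst z) (snd z) *v T (snd z)))"
  proof -
    have cT: "continuous_on (cball 0 r \<times> {0..l}) (\<lambda>z :: ((real^'n) \<times> (real^'n)) \<times> real. T (snd z))"
      by (rule continuous_on_compose2[OF W1inf_continuous[OF TW] continuous_on_snd]) (auto intro!: continuous_intros)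
    have cA: "continuous_on (cball 0 r \<times> {0..l}) (\<lambda>z :: ((real^'n) \<times> (real^'n)) \<times> real. A i (snd z))" if "i \<in> I" for i
      by (rule continuous_on_compose2[OF W1inf_continuous[OF AW[OF that]] continuous_on_snd]) (auto intro!: continuous_intros)
    have cw': "continuous_on (cball 0 r \<times> {0..l}) (\<lambda>z :: ((real^'n) \<times> (real^'n)) \<times> real. w (fst z) i)" for i
      by (rule continuous_on_compose2[OF cw[of UNIV]]) (auto intro!: continuous_intros)
    have cB: "continuous_on (cball 0 r \<times> {0..l}) (\<lambda>z. B (fst z) (snd z))"
      unfolding B_def by (intro continuous_on_sum continuous_on_scaleR cw' cA)
    show ?thesis
      by (intro continuous_on_add continuous_on_scaleR continuous_on_const cT
          bounded_bilinear.continuous_on[OF bounded_bilinear_matrix_vector] cB)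
  qed
  have c\<tau>: "continuous_on (cball 0 r \<times> {0..l}) (\<lambda>z. \<tau> (fst z) (snd z))"
    unfolding \<tau>_def competitor_def
  proof (rule continuous_on_sgn[OF cX], safe)
    fix y s assume ys: "y \<in> cball 0 r" "s \<in> {0..l}" and z: "T (snd (y, s)) + e *\<^sub>R (B (fst (y, s)) (snd (y, s)) *v T (snd (y, s))) = 0"
    have "norm (T s + e *\<^sub>R (B y s *v T s)) \<ge> 1"
      by (rule competitor_estimates(2)[where A="B y" and s=s, OF Bskew[OF ys] Ba[OF ys] less_imp_le[OF e(1)] ys(2)])
    then show False using z by simp
  qed
  have cF: "continuous_on (cball 0 r) F"
  proof -
    have 1: "continuous_on (cball 0 r) (\<lambda>y. integral (cbox 0 l) (\<lambda>s. \<tau> y s - T s))"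
    proof (rule integral_continuous_on_param)
      have "continuous_on (cball 0 r \<times> cbox 0 l) (\<lambda>z. \<tau> (fst z) (snd z) - T (snd z))"
        using c\<tau> by (auto intro!: continuous_on_diff continuous_on_compose2[OF W1inf_continuous[OF TW] continuous_on_snd] continuous_on_id)
      then show "continuous_on (cball 0 r \<times> cbox 0 l) (\<lambda>(y, s). \<tau> y s - T s)" by (simp add: case_prod_beta)
    qed
    have "continuous_on (cball 0 r) (\<lambda>y. \<tau> (fst (y, l)) (snd (y, l)))"
      by (rule continuous_on_compose2[OF c\<tau>, of "cball 0 r" "\<lambda>y. (y, l)"]) (use l in \<open>auto intro!: continuous_intros\<close>)
    then have 2: "continuous_on (cball 0 r) (\<lambda>y. \<tau> y l)" by simp
    show ?thesis unfolding F_def d_def using 1 by (intro continuous_intros 2 cw) auto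
  qed
  \<comment> \<open>A fixed point of y - F y / e is a zero of \<open>F\<close>. The map stays in the
    ball because \<open>F y\<close> differs from e y by at most C2 e^2 and C2 e \<le> r.\<close>
  obtain y where y: "y \<in> cball 0 r" "y - (1 / e) *\<^sub>R F y = y"
  proof (rule brouwer[of "cball (0 :: (real^'n) \<times> (real^'n)) r" "\<lambda>y. y - (1 / e) *\<^sub>R F y"])
    show "continuous_on (cball 0 r) (\<lambda>y. y - (1 / e) *\<^sub>R F y)" by (intro continuous_intros cF)
    show "(\<lambda>y. y - (1 / e) *\<^sub>R F y) \<in> cball 0 r \<rightarrow> cball 0 r"
    proof
      fix y :: "(real^'n) \<times> (real^'n)" assume y: "y \<in> cball 0 r"
      have "y - (1 / e) *\<^sub>R F y = (- (1 / e)) *\<^sub>R (F y - e *\<^sub>R y)" using e(1) by (simp add: algebra_simps)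
      then have "norm (y - (1 / e) *\<^sub>R F y) = (1 / e) * norm (F y - e *\<^sub>R y)" using e(1) by simp
      also have "\<dots> \<le> (1 / e) * (C2 * e\<^sup>2)" using Fclose[OF y] e(1) by (intro mult_left_mono) auto
      also have "\<dots> = C2 * e" using e(1) by (simp add: power2_eq_square)
      finally show "y - (1 / e) *\<^sub>R F y \<in> cball 0 r" using eC by simp
    qed
  qed (use r in auto)
  then have F0: "F y = 0" using e(1) by simp
  have ll: "l \<in> {0..l}" "0 \<in> {0..l}" using l by auto
  have n\<tau>: "norm (\<tau> y s) = 1" if "s \<in> {0..l}" for s
    unfolding \<tau>_def by (rule competitor_estimates(1)[where A="B y" and s=s, OF Bskew[OF y(1) that] Ba[OF y(1) that] less_imp_le[OF e(1)] that])
  have near: "norm (\<tau> y s - T s) \<le> e * a" if "s \<in> {0..l}" for s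
    unfolding \<tau>_def by (rule competitor_estimates(4)[where A="B y" and s=s, OF Bskew[OF y(1) that] Ba[OF y(1) that] less_imp_le[OF e(1)] that])
  \<comment> \<open>Both tangents are unit vectors, so the positive radial factor must be 1 and the
    auxiliary parameter disappears.\<close>
  have \<tau>l: "\<tau> y l = T2"
  proof -
    have eq: "(1 + e * d y) *\<^sub>R \<tau> y l = T2" using F0 by (simp add: F_def zero_prod_def)
    have "\<bar>e * d y\<bar> \<le> e * cm" using dm[OF y(1)] e(1) by (simp add: abs_mult)
    then have pos: "1 + e * d y > 0" using ecm by linarith
    have "\<bar>1 + e * d y\<bar> * norm (\<tau> y l) = 1" using arg_cong[OF eq, of norm] T2 by simp
    then have "1 + e * d y = 1" using n\<tau>[OF ll(1)] pos by simp
    then show ?thesis using eq by (metis scaleR_one)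
  qed
  have \<tau>0: "\<tau> y 0 = T1"
    using BV[OF y(1)] T1 by (simp add: variation_def \<tau>_def competitor_def T0 sgn_div_norm)
  have \<tau>i: "integral {0..l} (\<tau> y) = a2 - a1"
  proof -
    have "integral {0..l} (\<lambda>s. \<tau> y s - T s) = 0" using F0 by (simp add: F_def zero_prod_def)
    moreover have "integral {0..l} (\<lambda>s. \<tau> y s - T s) = integral {0..l} (\<tau> y) - integral {0..l} T"
      using W1inf_continuous[OF \<tau>W[OF y(1)]] W1inf_continuous[OF TW]
      by (intro integral_diff integrable_continuous_real)
    ultimately show ?thesis using integral_unique[OF T_int] by simp
  qed
  have "k \<le> sqrt ((k - e * (k - k'))\<^sup>2 + e\<^sup>2 * C1) + N * a\<^sup>2 * e\<^sup>2"
    by (rule N(2)[OF \<tau>W[OF y(1)] n\<tau> \<tau>0 \<tau>l \<tau>i \<tau>K[OF y(1)] near])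
  then show False using e(3) by simp
qed

end

section \<open>The multiplier\<close>

text \<open>With empty interior the set lies in a hyperplane a \<bullet> x = b, and the sign of b
  selects a or -a. Otherwise 0 is separated from the interior, whose closure contains the whole
  convex set.\<close>

lemma supporting_functional_at_0:
  fixes E :: "'a::euclidean_space set"
  assumes E: "convex E" and z: "0 \<notin> interior E"
  obtains a where "a \<noteq> 0" "\<And>x. x \<in> E \<Longrightarrow> 0 \<le> a \<bullet> x"
proof (cases "interior E = {}")
  case True
  obtain a b where ab: "a \<noteq> 0" "E \<subseteq> {x. a \<bullet> x = b}" using empty_interior_subset_hyperplane[OF E True] by blast
  show ?thesis
  proof (cases "b \<ge> 0")
    case True then show ?thesis using that[of a] ab by auto
  next
    case False
    show ?thesis
    proof (rule that[of "-a"])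
      show "0 \<le> - a \<bullet> x" if "x \<in> E" for x using ab(2) that False by auto
    qed (use ab in auto)
  qed
next
  case False
  obtain a where a: "a \<noteq> 0" "\<forall>x\<in>interior E. 0 \<le> a \<bullet> x"
    using separating_hyperplane_set_0[OF convex_interior[OF E] z] by blast
  have "closure (interior E) \<subseteq> {x. 0 \<le> a \<bullet> x}"
    by (rule closure_minimal) (use a(2) in \<open>auto intro: closed_halfspace_ge\<close>)
  then have "E \<subseteq> {x. 0 \<le> a \<bullet> x}" using convex_closure_interior[OF E False] closure_subset by blast
  then show ?thesis using that[of a] a(1) by auto
qed

lemma Linf_nonneg_integral_zero:
  fixes f :: "real \<Rightarrow> real"
  assumes f: "Linf l f" and nn: "AE s in lborel. s \<in> {0..l} \<longrightarrow> 0 \<le> f s" and z: "integral {0..l} f \<le> 0" and l: "l > 0"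
  shows "AE s in lborel. s \<in> {0..l} \<longrightarrow> f s = 0"
proof -
  define h where "h s = max 0 (f s)" for s
  have ae: "AE s in lborel. s \<in> {0..l} \<longrightarrow> h s = f s" using nn by eventually_elim (auto simp: h_def)
  have hL: "Linf l h" by (rule Linf_cong_AE[OF f ae])
  have hz: "integral {0..l} h \<le> 0" using z integral_cong_AE_interval[OF ae] by simp
  have "AE s in lborel. s \<in> {0..l} \<longrightarrow> h s = 0"
  proof (rule Linf_zero_of_integral_zero[OF hL _ l])
    fix t assume t: "t \<in> {0..l}"
    have i: "h integrable_on {0..t}" "h integrable_on {0..l}" using t by (auto intro!: Linf_integrable[OF hL])
    have "integral {0..t} h \<le> integral {0..l} h" by (rule integral_subset_le) (use t i in \<open>auto simp: h_def\<close>)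
    moreover have "0 \<le> integral {0..t} h" by (rule Henstock_Kurzweil_Integration.integral_nonneg[OF i(1)]) (simp add: h_def)
    ultimately show "integral {0..t} h = 0" using hz by simp
  qed
  with ae show ?thesis by eventually_elim auto
qed

lemma Linf_sgn:
  assumes "Linf l f"
  shows "Linf l (\<lambda>s. sgn (f s))"
proof -
  obtain h where h: "h \<in> borel_measurable borel" "AE s in lborel. s \<in> {0..l} \<longrightarrow> f s = h s"
    using LinfE[OF assms] by blast
  show ?thesis
  proof (rule LinfI)
    show "(\<lambda>s. inverse (norm (h s)) *\<^sub>R h s) \<in> borel_measurable borel" using h(1) by measurable
    show "norm (inverse (norm (h s)) *\<^sub>R h s) \<le> 1" for s by (cases "h s = 0") auto
    show "AE s in lborel. s \<in> {0..l} \<longrightarrow> sgn (f s) = inverse (norm (h s)) *\<^sub>R h s"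
      using h(2) by eventually_elim (auto simp: sgn_div_norm)
  qed
qed

lemma W1inf_norm:
  assumes "W1inf l f"
  shows "W1inf l (\<lambda>s. norm (f s))"
proof -
  obtain C where C: "C-lipschitz_on {0..l} f" using assms unfolding W1inf_def by blast
  have "C-lipschitz_on {0..l} (\<lambda>s. norm (f s))"
  proof (rule lipschitz_onI)
    fix x y assume xy: "x \<in> {0..l}" "y \<in> {0..l}"
    have "dist (norm (f x)) (norm (f y)) \<le> dist (f x) (f y)" by (simp add: dist_real_def dist_norm norm_triangle_ineq3)
    also have "\<dots> \<le> C * dist x y" by (rule lipschitz_onD[OF C xy])
    finally show "dist (norm (f x)) (norm (f y)) \<le> C * dist x y" .
  qed (rule lipschitz_on_nonneg[OF C])
  then show ?thesis unfolding W1inf_def by blast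
qed

lemma skew_integral:
  assumes i: "B integrable_on S" and s: "\<And>s. s \<in> S \<Longrightarrow> skew (B s)"
  shows "skew (integral S B)"
proof -
  have "bounded_linear (transpose :: real^'n^'n \<Rightarrow> real^'n^'n)"
    using linear_transpose by (simp add: linear_conv_bounded_linear)
  then have "((transpose \<circ> B) has_integral transpose (integral S B)) S"
    by (rule has_integral_linear[OF integrable_integral[OF i]])
  then have "((\<lambda>s. - B s) has_integral transpose (integral S B)) S"
    by (rule has_integral_eq[rotated]) (use s in \<open>simp add: skew_def\<close>)
  then show ?thesis
    using has_integral_neg[OF integrable_integral[OF i]] has_integral_unique unfolding skew_def by blast
qed

context weighted_curve
begin

lemma \<gamma>W: "W1inf l \<gamma>" and Dl\<gamma>: "s \<in> {0..l} \<Longrightarrow> Dl l \<gamma> s = T s"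
proof -
  show "W1inf l \<gamma>"
  proof (rule primitive_W1inf(1)[OF TL _ l])
    fix t assume t: "t \<in> {0..l}"
    have "(T has_integral \<gamma> t - \<gamma> 0) {0..t}"
    proof (rule fundamental_theorem_of_calculus)
      fix x assume "x \<in> {0..t}"
      then show "(\<gamma> has_vector_derivative T x) (at x within {0..t})"
        using t by (intro has_vector_derivative_within_subset[OF T_deriv]) auto
    qed (use t in auto)
    then show "\<gamma> t = \<gamma> 0 + integral {0..t} T" by (simp add: integral_unique)
  qed
qed (simp add: T_def)

text \<open>Integration by parts replaces the integral of \<open>A T\<close> by that of
  \<open>B (\<gamma> l - \<gamma>)\<close>, where \<open>B\<close> is the derivative of
  \<open>A\<close>. The endpoint functional becomes linear in \<open>B\<close>, which can be
  prescribed pointwise.\<close>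

lemma variation_of_generator:
  assumes B: "Linf l B" and sk: "\<And>s. s \<in> {0..l} \<Longrightarrow> skew (B s)"
    and bd: "AE s in lborel. s \<in> {0..l} \<longrightarrow> \<alpha> s * norm (D s + B s *v T s) \<le> k'"
  shows "variation k' (\<lambda>t. integral {0..t} B)"
    "((\<lambda>s. x \<bullet> (B s *v (\<gamma> l - \<gamma> s)) + y \<bullet> (B s *v T2)) has_integral
       (x, y) \<bullet> endpoint (\<lambda>t. integral {0..t} B) c - c * (y \<bullet> T2)) {0..l}"
proof -
  define A where "A t = integral {0..t} B" for t
  have AW: "W1inf l A" and dA: "AE s in lborel. s \<in> {0..l} \<longrightarrow> Dl l A s = B s"
    using indefinite_integral_W1inf[OF B l, of 0] unfolding A_def[abs_def] by simp_all
  have "variation k' A" unfolding variation_def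
  proof (intro conjI ballI)
    show "skew (A s)" if "s \<in> {0..l}" for s
      unfolding A_def using that by (intro skew_integral Linf_integrable[OF B]) (auto intro: sk)
    show "AE s in lborel. s \<in> {0..l} \<longrightarrow> \<alpha> s * norm (D s + Dl l A s *v T s) \<le> k'"
      using bd dA by eventually_elim auto
  qed (use AW in \<open>auto simp: A_def\<close>)
  then show "variation k' (\<lambda>t. integral {0..t} B)" by (simp add: A_def[abs_def])
  note bb = bounded_bilinear_matrix_vector
  have Bi: "(B has_integral A l) {0..l}" unfolding A_def by (rule integrable_integral[OF Linf_integrable[OF B]]) auto
  have lin: "((\<lambda>s. z \<bullet> (B s *v w)) has_integral z \<bullet> (A l *v w)) {0..l}" for z w :: "real^'n"
    using has_integral_linear[OF Bi bounded_linear_compose[OF bounded_linear_inner_right bounded_bilinear.bounded_linear_left[OF bb]], of z w]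
    by (simp add: o_def)
  have bp: "((\<lambda>s. A s *v Dl l \<gamma> s + Dl l A s *v \<gamma> s) has_integral A l *v \<gamma> l - A 0 *v \<gamma> 0) {0..l}"
    by (rule integration_by_parts_W1inf[OF bb AW \<gamma>W l])
  have ae: "AE s in lborel. s \<in> {0..l} \<longrightarrow> A s *v Dl l \<gamma> s + Dl l A s *v \<gamma> s = A s *v T s + B s *v \<gamma> s"
    using dA by eventually_elim (auto simp: Dl\<gamma>)
  have "A 0 *v \<gamma> 0 = 0" by (simp add: A_def)
  then have p: "((\<lambda>s. A s *v T s + B s *v \<gamma> s) has_integral A l *v \<gamma> l) {0..l}"
    using iffD1[OF has_integral_AE[OF ae] bp] by simp
  have "(\<lambda>s. A s *v T s) integrable_on {0..l}"
    by (rule integrable_continuous_real[OF W1inf_continuous[OF W1inf_bounded_bilinear(1)[OF bb AW TW l]]])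
  then have "((\<lambda>s. A s *v T s) has_integral integral {0..l} (\<lambda>s. A s *v T s)) {0..l}" by (rule integrable_integral)
  from has_integral_linear[OF has_integral_diff[OF p this] bounded_linear_inner_right, of x]
  have "((\<lambda>s. x \<bullet> (B s *v \<gamma> s)) has_integral x \<bullet> (A l *v \<gamma> l) - x \<bullet> integral {0..l} (\<lambda>s. A s *v T s)) {0..l}"
    by (simp add: o_def inner_diff_right)
  from has_integral_add[OF has_integral_diff[OF lin[of x "\<gamma> l"] this] lin[of y T2]]
  have "((\<lambda>s. x \<bullet> (B s *v \<gamma> l) - x \<bullet> (B s *v \<gamma> s) + y \<bullet> (B s *v T2)) has_integral
      x \<bullet> integral {0..l} (\<lambda>s. A s *v T s) + y \<bullet> (A l *v T2)) {0..l}" by simp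
  then show "((\<lambda>s. x \<bullet> (B s *v (\<gamma> l - \<gamma> s)) + y \<bullet> (B s *v T2)) has_integral
       (x, y) \<bullet> endpoint (\<lambda>t. integral {0..t} B) c - c * (y \<bullet> T2)) {0..l}"
    by (simp add: endpoint_def A_def[abs_def] inner_add_right inner_diff_right matrix_vector_mult_diff_distrib)
qed

text \<open>The separating functional becomes a skew matrix \<open>S\<close> with \<open>S' = - \<lambda> \<and> T\<close>. Testing with
  generators that fix T forces \<open>S = q \<and> T\<close> (a conservation law for q), and the remaining ones give
  the pointwise maximum principle \<open>|q| \<alpha> T' = - k q\<close>.\<close>
lemma adjoint_exists:
  assumes el: "inf_elastica l \<alpha> a1 a2 T1 T2 \<gamma>" and k: "k > 0"
  obtains lam mu q where "(lam, mu) \<noteq> (0, 0)" "mu \<bullet> T2 = 0" "W1inf l q"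
    "\<And>s. s \<in> {0..l} \<Longrightarrow> q s \<bullet> T s = 0"
    "\<And>s. s \<in> {0..l} \<Longrightarrow> wedge lam (\<gamma> l - \<gamma> s) + wedge mu T2 = wedge (q s) (T s)"
    "AE s in lborel. s \<in> {0..l} \<longrightarrow> norm (q s) *\<^sub>R (\<alpha> s *\<^sub>R D s) = - k *\<^sub>R q s"
    "AE s in lborel. s \<in> {0..l} \<longrightarrow> Dl l q s = - (lam - (lam \<bullet> T s) *\<^sub>R T s) - (q s \<bullet> D s) *\<^sub>R T s"
proof -
  obtain p where p: "p \<noteq> 0" "\<And>x. x \<in> endpoints \<Longrightarrow> 0 \<le> p \<bullet> x"
    using supporting_functional_at_0[OF convex_endpoints zero_not_interior_endpoints[OF el k]] by blast
  obtain lam mu where lm: "p = (lam, mu)" by (cases p)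
  note bb = bounded_bilinear_matrix_vector
  have sep: "0 \<le> p \<bullet> endpoint A c" if "variation k' A" "k' < k" "0 \<le> k'" for A c k'
    using that by (intro p(2)) (auto simp: endpoints_def)
  \<comment> \<open>This generator cancels \<open>T'\<close> completely, so even the bound 0 is
    feasible; it is the base point for tests with generators that annihilate
    \<open>T\<close>.\<close>
  define B0 where "B0 s = wedge (- D s) (T s)" for s
  have B0L: "Linf l B0" unfolding B0_def by (intro Linf_bounded_bilinear[OF bounded_bilinear_wedge] Linf_minus DL TL)
  have B0T: "AE s in lborel. s \<in> {0..l} \<longrightarrow> B0 s *v T s = - D s"
    using TD by eventually_elim (auto simp: B0_def wedge_mult T_self inner_commute)
  have muT: "mu \<bullet> T2 = 0"
  proof -
    have ae: "AE s in lborel. s \<in> {0..l} \<longrightarrow> \<alpha> s * norm (D s + B0 s *v T s) \<le> 0"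
      using B0T by eventually_elim auto
    have v: "variation 0 (\<lambda>t. integral {0..t} B0)"
      by (rule variation_of_generator(1)[OF B0L _ ae]) (simp add: B0_def skew_wedge)
    define E where "E = p \<bullet> endpoint (\<lambda>t. integral {0..t} B0) 0"
    \<comment> \<open>The radial parameter c is unrestricted, so its coefficient has to
      vanish.\<close>
    have "0 \<le> E + c * (mu \<bullet> T2)" for c
      using sep[OF v k, of c] by (simp add: E_def endpoint_def lm inner_add_right)
    from this[of "(- E - 1) / (mu \<bullet> T2)"] show ?thesis by (cases "mu \<bullet> T2 = 0") auto
  qed
  define S where "S s = wedge lam (\<gamma> l - \<gamma> s) + wedge mu T2" for s
  have dS: "(S has_vector_derivative - wedge lam (T s)) (at s within {0..l})" if s: "s \<in> {0..l}" for s
  proof -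
    have "((\<lambda>s. \<gamma> l - \<gamma> s) has_vector_derivative 0 - T s) (at s within {0..l})"
      by (intro has_vector_derivative_diff has_vector_derivative_const T_deriv s)
    from has_vector_derivative_add[OF bounded_linear.has_vector_derivative[OF bounded_bilinear.bounded_linear_right[OF bounded_bilinear_wedge] this, of lam]
        has_vector_derivative_const[of "wedge mu T2"]]
    show ?thesis unfolding S_def[abs_def]
      by (simp add: bounded_bilinear.minus_right[OF bounded_bilinear_wedge])
  qed
  have SW: "W1inf l S"
  proof -
    have "W1inf l (\<lambda>s. (-1) *\<^sub>R \<gamma> s)" by (rule W1inf_scaleR_const[OF \<gamma>W])
    then have "W1inf l (\<lambda>s. \<gamma> l - \<gamma> s)" using W1inf_add[OF W1inf_const[of l "\<gamma> l"]] by fastforce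
    then show ?thesis unfolding S_def
      by (intro W1inf_add W1inf_const W1inf_bounded_bilinear(1)[OF bounded_bilinear_wedge] l)
  qed
  have Ssk: "skew (S s)" for s unfolding S_def by (intro skew_add skew_wedge)
  \<comment> \<open>The functional on endpoints turns into the pairing of the generator with
    \<open>S\<close>, up to the factor 2 from \<open>skew_inner_wedge\<close>.\<close>
  have pair: "0 \<le> integral {0..l} (\<lambda>s. B s \<bullet> S s)"
    if B: "Linf l B" "\<And>s. s \<in> {0..l} \<Longrightarrow> skew (B s)"
      "AE s in lborel. s \<in> {0..l} \<longrightarrow> \<alpha> s * norm (D s + B s *v T s) \<le> k'" and k': "k' < k" "0 \<le> k'" for B k'
  proof -
    note v = variation_of_generator[OF B]
    have "((\<lambda>s. lam \<bullet> (B s *v (\<gamma> l - \<gamma> s)) + mu \<bullet> (B s *v T2)) has_integral p \<bullet> endpoint (\<lambda>t. integral {0..t} B) 0) {0..l}"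
      using v(2)[of lam mu 0] by (simp add: lm)
    then have "((\<lambda>s. 2 * (lam \<bullet> (B s *v (\<gamma> l - \<gamma> s)) + mu \<bullet> (B s *v T2))) has_integral 2 * (p \<bullet> endpoint (\<lambda>t. integral {0..t} B) 0)) {0..l}"
      by (rule has_integral_mult_right)
    then have "((\<lambda>s. B s \<bullet> S s) has_integral 2 * (p \<bullet> endpoint (\<lambda>t. integral {0..t} B) 0)) {0..l}"
      by (rule has_integral_eq[rotated]) (simp add: S_def inner_add_right skew_inner_wedge B(2))
    then show ?thesis using sep[OF v(1) k', of 0] by (simp add: integral_unique)
  qed
  define q where "q s = S s *v T s" for s
  have qW: "W1inf l q" unfolding q_def by (rule W1inf_bounded_bilinear(1)[OF bb SW TW l])
  have qT: "q s \<bullet> T s = 0" for s unfolding q_def using skew_self[OF Ssk, of "T s"] by (simp add: inner_commute)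
  have qL: "Linf l q" by (rule Linf_continuous[OF W1inf_continuous[OF qW]])
  \<comment> \<open>\<open>Z\<close> is the part of \<open>S\<close> that annihilates
    \<open>T\<close>. Adding a multiple of it to \<open>B0\<close> leaves the curvature unchanged;
    as the sign of the multiple is free, the integral of \<open>Z \<bullet> S\<close>, which equals
    that of |Z|^2, is zero.\<close>
  define Z where "Z s = S s - wedge (q s) (T s)" for s
  have Zsk: "skew (Z s)" for s unfolding Z_def by (intro skew_diff Ssk skew_wedge)
  have ZT: "Z s *v T s = 0" if "s \<in> {0..l}" for s
    using T_self[OF that] qT[of s]
    by (simp add: Z_def matrix_vector_mult_diff_rdistrib wedge_mult q_def[symmetric])
  have ZS: "Z s \<bullet> S s = Z s \<bullet> Z s" if "s \<in> {0..l}" for s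
  proof -
    have "Z s \<bullet> wedge (q s) (T s) = 0" using skew_inner_wedge[OF Zsk, of s "q s" "T s"] ZT[OF that] by simp
    then show ?thesis by (simp add: Z_def inner_diff_right)
  qed
  have Zc: "continuous_on {0..l} Z"
  proof -
    have "continuous_on {0..l} (\<lambda>s. wedge (q s) (T s))"
      by (intro bounded_bilinear.continuous_on[OF bounded_bilinear_wedge] W1inf_continuous[OF qW] W1inf_continuous[OF TW])
    then show ?thesis unfolding Z_def using W1inf_continuous[OF SW] by (intro continuous_on_diff)
  qed
  have SL: "Linf l S" by (rule Linf_continuous[OF W1inf_continuous[OF SW]])
  have ZL: "Linf l Z" by (rule Linf_continuous[OF Zc])
  have Z0: "Z s = 0" if s: "s \<in> {0..l}" for s
  proof -
    define a where "a = integral {0..l} (\<lambda>s. B0 s \<bullet> S s)"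
    define b where "b = integral {0..l} (\<lambda>s. Z s \<bullet> S s)"
    have "0 \<le> a + N * b" for N
    proof -
      have "0 \<le> integral {0..l} (\<lambda>s. (B0 s + N *\<^sub>R Z s) \<bullet> S s)"
      proof (rule pair[of _ 0])
        show "Linf l (\<lambda>s. B0 s + N *\<^sub>R Z s)" by (intro Linf_add B0L Linf_scaleR Linf_const ZL)
        show "skew (B0 s + N *\<^sub>R Z s)" for s unfolding B0_def by (intro skew_add skew_wedge skew_scaleR Zsk)
        show "AE s in lborel. s \<in> {0..l} \<longrightarrow> \<alpha> s * norm (D s + (B0 s + N *\<^sub>R Z s) *v T s) \<le> 0"
          using B0T
        proof eventually_elim
          case (elim s)
          then show ?case using ZT[of s]
            by (auto simp: matrix_vector_mult_add_rdistrib scaleR_matrix_vector_assoc[symmetric])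
        qed
      qed (use k in auto)
      also have "\<dots> = a + N * b"
      proof (rule integral_unique)
        have 1: "((\<lambda>s. B0 s \<bullet> S s) has_integral a) {0..l}"
          unfolding a_def by (intro integrable_integral Linf_integrable[OF Linf_inner[OF B0L SL]]) auto
        have 2: "((\<lambda>s. N * (Z s \<bullet> S s)) has_integral N * b) {0..l}"
          unfolding b_def by (intro has_integral_mult_right integrable_integral Linf_integrable[OF Linf_inner[OF ZL SL]]) auto
        show "((\<lambda>s. (B0 s + N *\<^sub>R Z s) \<bullet> S s) has_integral a + N * b) {0..l}"
          using has_integral_add[OF 1 2] by (simp add: inner_add_left)
      qed
      finally show ?thesis .
    qed
    from this[of "(- a - 1) / b"] have "b = 0" by (cases "b = 0") auto
    then have "integral {0..l} (\<lambda>s. Z s \<bullet> Z s) = 0"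
      unfolding b_def using integral_cong[of "{0..l}" "\<lambda>s. Z s \<bullet> S s" "\<lambda>s. Z s \<bullet> Z s"] ZS by simp
    then have "\<forall>s\<in>{0..l}. Z s \<bullet> Z s = 0"
      by (subst (asm) integral_eq_0_iff) (use l Zc in \<open>auto intro!: continuous_intros\<close>)
    then show ?thesis using s by simp
  qed
  then have Sq: "S s = wedge (q s) (T s)" if "s \<in> {0..l}" for s using that by (simp add: Z_def)
  have maxp: "AE s in lborel. s \<in> {0..l} \<longrightarrow> norm (q s) *\<^sub>R (\<alpha> s *\<^sub>R D s) = - k *\<^sub>R q s"
  proof -
    define a where "a = integral {0..l} (\<lambda>s. q s \<bullet> D s)"
    define b where "b = integral {0..l} (\<lambda>s. k * (1 / \<alpha> s) * norm (q s))"
    have aL: "Linf l (\<lambda>s. q s \<bullet> D s)" by (intro Linf_inner qL DL)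
    have bL: "Linf l (\<lambda>s. k * (1 / \<alpha> s) * norm (q s))" by (intro Linf_mult Linf_const \<alpha>rL Linf_norm qL)
    have ia: "((\<lambda>s. q s \<bullet> D s) has_integral a) {0..l}" unfolding a_def by (intro integrable_integral Linf_integrable[OF aL]) auto
    have ib: "((\<lambda>s. k * (1 / \<alpha> s) * norm (q s)) has_integral b) {0..l}" unfolding b_def by (intro integrable_integral Linf_integrable[OF bL]) auto
    have "b \<le> - a"
    proof (rule field_le_mult_one_interval)
      fix \<theta> :: real assume \<theta>: "0 < \<theta>" "\<theta> < 1"
      \<comment> \<open>Where q is nonzero, \<open>D + x\<close> points against q with length
        \<theta> k / \<alpha>, the choice that makes the pairing smallest under this bound. The
        factor \<theta> < 1 keeps the bound strictly below k, and
        \<open>field_le_mult_one_interval\<close> lets \<theta> tend to 1.\<close>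
      define x where "x s = - D s - (\<theta> * k * (1 / \<alpha> s)) *\<^sub>R sgn (q s)" for s
      have xL: "Linf l x" unfolding x_def by (intro Linf_diff Linf_minus DL Linf_scaleR Linf_mult Linf_const \<alpha>rL Linf_sgn qL)
      have BT: "AE s in lborel. s \<in> {0..l} \<longrightarrow> wedge (x s) (T s) *v T s = x s"
        using TD
      proof eventually_elim
        case (elim s)
        have "sgn (q s) \<bullet> T s = 0" using qT[of s] by (simp add: sgn_div_norm)
        then show ?case using elim T_self by (auto simp: wedge_mult x_def inner_diff_left inner_diff_right inner_commute)
      qed
      have "0 \<le> integral {0..l} (\<lambda>s. wedge (x s) (T s) \<bullet> S s)"
      proof (rule pair[of _ "\<theta> * k"])
        show "Linf l (\<lambda>s. wedge (x s) (T s))" by (intro Linf_bounded_bilinear[OF bounded_bilinear_wedge] xL TL)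
        show "AE s in lborel. s \<in> {0..l} \<longrightarrow> \<alpha> s * norm (D s + wedge (x s) (T s) *v T s) \<le> \<theta> * k"
          using BT
        proof eventually_elim
          case (elim s)
          show ?case
          proof
            assume s: "s \<in> {0..l}"
            have "\<alpha> s * norm (D s + x s) = \<theta> * k * norm (sgn (q s))"
              using \<theta> k \<alpha>_pos[OF s] by (simp add: x_def abs_mult)
            also have "\<dots> \<le> \<theta> * k * 1" using \<theta> k by (intro mult_left_mono) (auto simp: norm_sgn)
            finally show "\<alpha> s * norm (D s + wedge (x s) (T s) *v T s) \<le> \<theta> * k" using elim s by simp
          qed
        qed
      qed (use \<theta> k skew_wedge in auto)
      also have "\<dots> = integral {0..l} (\<lambda>s. - 2 * (q s \<bullet> D s + \<theta> * (k * (1 / \<alpha> s) * norm (q s))))"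
      proof (rule integral_cong_AE_interval)
        show "AE s in lborel. s \<in> {0..l} \<longrightarrow> wedge (x s) (T s) \<bullet> S s = - 2 * (q s \<bullet> D s + \<theta> * (k * (1 / \<alpha> s) * norm (q s)))"
          using BT
        proof eventually_elim
          case (elim s)
          show ?case
          proof
            assume s: "s \<in> {0..l}"
            have "q s \<bullet> sgn (q s) = norm (q s)"
              by (cases "q s = 0") (simp_all add: sgn_div_norm dot_square_norm power2_eq_square)
            then have "q s \<bullet> x s = - (q s \<bullet> D s + \<theta> * (k * (1 / \<alpha> s) * norm (q s)))"
              by (simp add: x_def inner_diff_right)
            then show "wedge (x s) (T s) \<bullet> S s = - 2 * (q s \<bullet> D s + \<theta> * (k * (1 / \<alpha> s) * norm (q s)))"
              using elim s unfolding Sq[OF s] skew_inner_wedge[OF skew_wedge] by simp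
          qed
        qed
      qed
      also have "\<dots> = - 2 * (a + \<theta> * b)"
        by (rule integral_unique[OF has_integral_mult_right[OF has_integral_add[OF ia has_integral_mult_right[OF ib]]]])
      finally show "\<theta> * b \<le> - a" by simp
    qed
    \<comment> \<open>Cauchy-Schwarz makes the integrand nonnegative, so a nonpositive integral
      forces it to vanish almost everywhere.\<close>
    then have le: "integral {0..l} (\<lambda>s. q s \<bullet> D s + k * (1 / \<alpha> s) * norm (q s)) \<le> 0"
      using integral_unique[OF has_integral_add[OF ia ib]] by simp
    have "AE s in lborel. s \<in> {0..l} \<longrightarrow> q s \<bullet> D s + k * (1 / \<alpha> s) * norm (q s) = 0"
    proof (rule Linf_nonneg_integral_zero[OF Linf_add[OF aL bL] _ le l])
      show "AE s in lborel. s \<in> {0..l} \<longrightarrow> 0 \<le> q s \<bullet> D s + k * (1 / \<alpha> s) * norm (q s)"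
        using k_AE
      proof eventually_elim
        case (elim s)
        show ?case
        proof
          assume s: "s \<in> {0..l}"
          have "norm (D s) \<le> k * (1 / \<alpha> s)" using elim s \<alpha>_pos[OF s] by (simp add: field_simps)
          then have "norm (q s) * norm (D s) \<le> norm (q s) * (k * (1 / \<alpha> s))" by (rule mult_left_mono) simp
          moreover have "\<bar>q s \<bullet> D s\<bar> \<le> norm (q s) * norm (D s)" by (rule Cauchy_Schwarz_ineq2)
          ultimately show "0 \<le> q s \<bullet> D s + k * (1 / \<alpha> s) * norm (q s)" by (simp add: mult.commute)
        qed
      qed
    qed
    then show ?thesis using k_AE
    proof eventually_elim
      case (elim s)
      show ?case
      proof
        assume s: "s \<in> {0..l}"
        define u where "u = \<alpha> s *\<^sub>R D s"
        have u: "norm u \<le> k" using elim s \<alpha>_pos[OF s] by (simp add: u_def)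
        have "\<alpha> s * (q s \<bullet> D s + k * (1 / \<alpha> s) * norm (q s)) = 0" using elim s by simp
        then have qu: "q s \<bullet> u = - k * norm (q s)" using \<alpha>_pos[OF s] by (simp add: u_def distrib_left)
        \<comment> \<open>The equality case of Cauchy-Schwarz, read off by completing the
          square.\<close>
        have "(norm (norm (q s) *\<^sub>R u + k *\<^sub>R q s))\<^sup>2
            = (norm (q s))\<^sup>2 * (norm u)\<^sup>2 + 2 * k * norm (q s) * (q s \<bullet> u) + k\<^sup>2 * (norm (q s))\<^sup>2"
          unfolding power2_norm_eq_inner by (simp add: inner_add_left inner_add_right inner_commute)
            (simp add: dot_square_norm power2_eq_square algebra_simps)
        also have "\<dots> = (norm (q s))\<^sup>2 * ((norm u)\<^sup>2 - k\<^sup>2)" unfolding qu by (simp add: power2_eq_square algebra_simps)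
        also have "\<dots> \<le> 0" using u k by (intro mult_nonneg_nonpos) (auto intro: power_mono)
        finally have "norm (q s) *\<^sub>R u + k *\<^sub>R q s = 0" by simp
        then show "norm (q s) *\<^sub>R (\<alpha> s *\<^sub>R D s) = - k *\<^sub>R q s" by (simp add: u_def eq_neg_iff_add_eq_0)
      qed
    qed
  qed
  have dq: "AE s in lborel. s \<in> {0..l} \<longrightarrow> Dl l q s = - (lam - (lam \<bullet> T s) *\<^sub>R T s) - (q s \<bullet> D s) *\<^sub>R T s"
    using W1inf_Dl_AE[OF TW l] TD
  proof eventually_elim
    case (elim s)
    show ?case
    proof
      assume s: "s \<in> {0..l}"
      have "(q has_vector_derivative S s *v D s + (- wedge lam (T s)) *v T s) (at s within {0..l})"
        unfolding q_def[abs_def] using elim s dS[OF s] unfolding D_def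
        by (intro bounded_bilinear.has_vector_derivative[OF bb]) auto
      then have "Dl l q s = S s *v D s + (- wedge lam (T s)) *v T s" by (rule Dl_eqI[OF _ s l])
      also have "(- wedge lam (T s)) *v T s = - (lam - (lam \<bullet> T s) *\<^sub>R T s)"
        using T_self[OF s] by (simp add: bounded_bilinear.minus_left[OF bb] wedge_mult)
      also have "S s *v D s = - (q s \<bullet> D s) *\<^sub>R T s"
        unfolding Sq[OF s] using elim s by (simp add: wedge_mult)
      finally show "Dl l q s = - (lam - (lam \<bullet> T s) *\<^sub>R T s) - (q s \<bullet> D s) *\<^sub>R T s" by simp
    qed
  qed
  show ?thesis
    by (rule that[OF _ muT qW qT _ maxp dq]) (use p(1) lm Sq in \<open>auto simp: S_def zero_prod_def\<close>)
qed

end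

lemma W1inf_constant_of_Dl_zero:
  fixes f :: "real \<Rightarrow> 'a::euclidean_space"
  assumes f: "W1inf l f" and l: "l > 0" and z: "AE s in lborel. s \<in> {0..l} \<longrightarrow> Dl l f s = 0" and t: "t \<in> {0..l}"
  shows "f t = f 0"
proof -
  have "integral {0..t} (Dl l f) = integral {0..t} (\<lambda>_. 0)"
    by (rule integral_cong_AE_interval) (use z in \<open>eventually_elim, use t in auto\<close>)
  then show ?thesis using integral_unique[OF W1inf_Dl_has_integral[OF f l t]] by simp
qed

section \<open>From the adjoint to the multiplier equations\<close>

context weighted_curve
begin

lemma curvature_not_AE_zero:
  assumes "k > 0" and "AE s in lborel. s \<in> {0..l} \<longrightarrow> D s = 0"
  shows False
proof -
  have "Kalpha l \<alpha> \<gamma> \<le> 0"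
  proof (rule Kalpha_bounds(3)[OF l \<alpha>L _ TW[unfolded T_def]])
    show "AE s in lborel. s \<in> {0..l} \<longrightarrow> \<alpha> s * norm (Dl l (Dl l \<gamma>) s) \<le> 0"
      using assms(2) by eventually_elim (auto simp: D_def T_def)
  qed (use \<alpha>_pos less_imp_le in auto)
  then show False using assms(1) by (simp add: k_def)
qed

text \<open>If q vanished, the wedge relation at s = l would give mu = 0, hence lam \<noteq> 0. Then
  \<open>q' = 0\<close> makes lam parallel to T everywhere, and differentiating this yields
  \<open>T' = 0\<close> almost everywhere, against k > 0.\<close>

lemma adjoint_nonzero:
  assumes k: "k > 0" and nz: "(lam, mu) \<noteq> (0, 0)" and muT: "mu \<bullet> T2 = 0"
    and Sq: "\<And>s. s \<in> {0..l} \<Longrightarrow> wedge lam (\<gamma> l - \<gamma> s) + wedge mu T2 = wedge (q s) (T s)"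
    and dq: "AE s in lborel. s \<in> {0..l} \<longrightarrow> Dl l q s = - (lam - (lam \<bullet> T s) *\<^sub>R T s) - (q s \<bullet> D s) *\<^sub>R T s"
  shows "\<exists>s\<in>{0..l}. q s \<noteq> 0"
proof (rule ccontr)
  assume "\<not> ?thesis"
  then have q0: "q s = 0" if "s \<in> {0..l}" for s using that by blast
  have ll: "l \<in> {0..l}" using l by simp
  have w0: "wedge x 0 = 0" "wedge 0 x = 0" for x :: "real^'n" by (simp_all add: wedge_def vec_eq_iff)
  have "wedge mu T2 = 0" using Sq[OF ll] q0[OF ll] by (simp add: w0)
  then have "wedge mu T2 *v T2 = 0" by simp
  then have "mu = 0" using muT T2 by (auto simp: wedge_mult norm_eq_1)
  then have lam: "lam \<noteq> 0" using nz by simp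
  have ae: "AE s in lborel. s \<in> {0..l} \<longrightarrow> (lam \<bullet> T s) *\<^sub>R T s = lam"
    using dq by eventually_elim (use W1inf_constant_Dl_AE[OF q0 l] q0 in auto)
  have eq: "(lam \<bullet> T s) *\<^sub>R T s = lam" if "s \<in> {0..l}" for s
    by (rule AE_interval_continuous_eq[OF _ _ ae l that])
       (auto intro!: continuous_intros W1inf_continuous[OF TW])
  have "AE s in lborel. s \<in> {0..l} \<longrightarrow> D s = 0"
    using W1inf_Dl_AE[OF TW l] TD
  proof eventually_elim
    case (elim s)
    show ?case
    proof
      assume s: "s \<in> {0..l}"
      have dT: "(T has_vector_derivative D s) (at s within {0..l})" using elim s by (simp add: D_def)
      have "((\<lambda>s. (lam \<bullet> T s) *\<^sub>R T s) has_vector_derivative (lam \<bullet> T s) *\<^sub>R D s + (lam \<bullet> D s) *\<^sub>R T s) (at s within {0..l})"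
        by (intro bounded_bilinear.has_vector_derivative[OF bounded_bilinear_scaleR] dT
            bounded_linear.has_vector_derivative[OF bounded_linear_inner_right])
      then have "Dl l (\<lambda>s. (lam \<bullet> T s) *\<^sub>R T s) s = (lam \<bullet> T s) *\<^sub>R D s + (lam \<bullet> D s) *\<^sub>R T s" by (rule Dl_eqI[OF _ s l])
      moreover have "Dl l (\<lambda>s. (lam \<bullet> T s) *\<^sub>R T s) s = 0" by (rule W1inf_constant_Dl_AE[OF eq l s])
      ultimately have "((lam \<bullet> T s) *\<^sub>R D s + (lam \<bullet> D s) *\<^sub>R T s) \<bullet> D s = 0" by simp
      then have "(lam \<bullet> T s) * (D s \<bullet> D s) = 0" using elim s by (simp add: inner_add_left)
      moreover have "lam \<bullet> T s \<noteq> 0" using eq[OF s] lam by auto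
      ultimately show "D s = 0" by simp
    qed
  qed
  then show False using curvature_not_AE_zero k by blast
qed

text \<open>The constants are forced. For g = (k / |lam|) |q| the maximum principle turns
  \<open>g \<alpha> T'\<close> into -(k^2 / |lam|) q, and this factor changes the term -lam in
  \<open>q'\<close> into k^2 times the unit vector \<open>sgn lam\<close> in
  \<open>V'\<close>.\<close>

lemma strong_multiplier_of_adjoint:
  assumes k: "k > 0" and lam: "lam \<noteq> 0" and qW: "W1inf l q" and qT: "\<And>s. s \<in> {0..l} \<Longrightarrow> q s \<bullet> T s = 0"
    and mp: "AE s in lborel. s \<in> {0..l} \<longrightarrow> norm (q s) *\<^sub>R (\<alpha> s *\<^sub>R D s) = - k *\<^sub>R q s"
    and dq: "AE s in lborel. s \<in> {0..l} \<longrightarrow> Dl l q s = - (lam - (lam \<bullet> T s) *\<^sub>R T s) - (q s \<bullet> D s) *\<^sub>R T s"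
  shows "strong_multiplier l \<alpha> T k (sgn lam) (\<lambda>s. k / norm lam * norm (q s)) (\<lambda>s. (- (k\<^sup>2 / norm lam)) *\<^sub>R q s)"
proof -
  define c where "c = k\<^sup>2 / norm lam"
  define L where "L = sgn lam"
  define v where "v s = (- c) *\<^sub>R q s" for s
  define g where "g s = k / norm lam * norm (q s)" for s
  have c: "c > 0" using k lam by (simp add: c_def)
  have cL: "c *\<^sub>R lam = k\<^sup>2 *\<^sub>R L" by (simp add: c_def L_def sgn_div_norm divide_inverse)
  have vW: "W1inf l v" unfolding v_def by (rule W1inf_scaleR_const[OF qW])
  have gW: "W1inf l g" unfolding g_def using W1inf_scaleR_const[OF W1inf_norm[OF qW], of "k / norm lam"] by simp
  have vg: "norm (v s) = k * g s" for s using k by (simp add: v_def g_def c_def power2_eq_square)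
  have g0: "g s \<ge> 0" for s using k by (simp add: g_def)
  have ends: "AE s in lborel. s \<noteq> 0 \<and> s \<noteq> l" using AE_lborel_singleton[of 0] AE_lborel_singleton[of l] by eventually_elim auto
  have Vf: "AE s in lborel. s \<in> {0..l} \<longrightarrow> v s = (g s * \<alpha> s) *\<^sub>R D s"
    using mp
  proof eventually_elim
    case (elim s)
    show ?case
    proof
      assume s: "s \<in> {0..l}"
      have "(g s * \<alpha> s) *\<^sub>R D s = (k / norm lam) *\<^sub>R (norm (q s) *\<^sub>R (\<alpha> s *\<^sub>R D s))" by (simp add: g_def)
      also have "\<dots> = v s" using elim s by (simp add: v_def c_def power2_eq_square)
      finally show "v s = (g s * \<alpha> s) *\<^sub>R D s" by simp
    qed
  qed
  have main: "AE s in lborel. s \<in> {0..l} \<longrightarrow> Dl l v s = (Dl l g s * \<alpha> s) *\<^sub>R D s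
        - (g s * k\<^sup>2 / \<alpha> s) *\<^sub>R T s + k\<^sup>2 *\<^sub>R proj_perp (T s) (D s) L \<and> Dl l g s = \<alpha> s * (L \<bullet> D s)"
    using Vf dq TD W1inf_Dl_AE[OF gW l] W1inf_Dl_AE[OF vW l] W1inf_Dl_AE[OF qW l] ends
  proof eventually_elim
    case (elim s)
    show ?case
    proof
      assume s: "s \<in> {0..l}"
      have \<alpha>: "\<alpha> s > 0" by (rule \<alpha>_pos[OF s])
      have TDs: "T s \<bullet> D s = 0" using elim s by blast
      have dg: "(g has_vector_derivative Dl l g s) (at s within {0..l})"
        and dv: "(v has_vector_derivative Dl l v s) (at s within {0..l})"
        and dq': "(q has_vector_derivative Dl l q s) (at s within {0..l})" using elim s by blast+
      have vs: "v s = (g s * \<alpha> s) *\<^sub>R D s" using elim s by blast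
      have "(v has_vector_derivative (- c) *\<^sub>R Dl l q s) (at s within {0..l})"
        unfolding v_def[abs_def] by (rule bounded_linear.has_vector_derivative[OF bounded_linear_scaleR_right dq'])
      then have "Dl l v s = (- c) *\<^sub>R Dl l q s" by (rule Dl_eqI[OF _ s l])
      also have "\<dots> = c *\<^sub>R lam - (c * (lam \<bullet> T s)) *\<^sub>R T s + (c * (q s \<bullet> D s)) *\<^sub>R T s"
        using elim s by (simp add: scaleR_diff_right)
      also have "c * (lam \<bullet> T s) = k\<^sup>2 * (L \<bullet> T s)" using arg_cong[OF cL, of "\<lambda>x. x \<bullet> T s"] by simp
      also have "c * (q s \<bullet> D s) = - (v s \<bullet> D s)" by (simp add: v_def)
      finally have dvs: "Dl l v s = k\<^sup>2 *\<^sub>R (L - (L \<bullet> T s) *\<^sub>R T s) - (v s \<bullet> D s) *\<^sub>R T s"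
        by (simp add: cL scaleR_diff_right)
      have P: "proj_perp (T s) (D s) L = L - (L \<bullet> T s) *\<^sub>R T s - ((L \<bullet> D s) / (D s \<bullet> D s)) *\<^sub>R D s"
        by (rule proj_perp_orthogonal[OF T_norm[OF s] TDs])
      show "Dl l v s = (Dl l g s * \<alpha> s) *\<^sub>R D s
        - (g s * k\<^sup>2 / \<alpha> s) *\<^sub>R T s + k\<^sup>2 *\<^sub>R proj_perp (T s) (D s) L \<and> Dl l g s = \<alpha> s * (L \<bullet> D s)"
      proof (cases "g s = 0")
        case True
        \<comment> \<open>At an interior zero of g both derivatives vanish, and the formula for
          \<open>v'\<close> leaves \<open>L\<close> parallel to \<open>T\<close>; then the
          projection and \<open>L \<bullet> D\<close> are zero as well.\<close>
        have z: "Dl l g s = 0 \<and> Dl l v s = 0"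
          by (rule vector_derivative_zero_of_norm_le[of l v k g s, OF _ k _ _ True dg dv]) (use vg elim s in auto)
        have "v s = 0" using vs True by simp
        then have LT: "L = (L \<bullet> T s) *\<^sub>R T s" using z dvs k by simp
        then have "L \<bullet> D s = (L \<bullet> T s) * (T s \<bullet> D s)" by (metis inner_scaleR_left)
        then have "L \<bullet> D s = 0" using TDs by simp
        then show ?thesis using z P LT True by simp
      next
        case False
        have "norm (v s) = g s * norm (\<alpha> s *\<^sub>R D s)" using g0[of s] vs \<alpha> by (simp add: abs_mult)
        then have nu: "norm (\<alpha> s *\<^sub>R D s) = k" using vg[of s] False by (simp add: mult.commute)
        have "(\<alpha> s *\<^sub>R D s) \<bullet> (\<alpha> s *\<^sub>R D s) = k\<^sup>2" using nu by (simp add: dot_square_norm)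
        then have e: "\<alpha> s * \<alpha> s * (D s \<bullet> D s) = k\<^sup>2" by (simp add: mult.assoc)
        then have D0: "D s \<bullet> D s \<noteq> 0" using k by auto
        \<comment> \<open>Differentiating the identity g^2 = |v|^2 / k^2 avoids the derivative of
          the norm; g' follows on division by g, which is nonzero here.\<close>
        have "((\<lambda>s. g s * g s - (1 / k\<^sup>2) * (v s \<bullet> v s)) has_vector_derivative
            (g s * Dl l g s + Dl l g s * g s) - (1 / k\<^sup>2) * (v s \<bullet> Dl l v s + Dl l v s \<bullet> v s)) (at s within {0..l})"
          by (intro has_vector_derivative_diff bounded_bilinear.has_vector_derivative[OF bounded_bilinear_mult]
              bounded_bilinear.has_vector_derivative[OF bounded_bilinear_inner]
              bounded_linear.has_vector_derivative[OF bounded_linear_mult_right] dg dv)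
        then have "Dl l (\<lambda>s. g s * g s - (1 / k\<^sup>2) * (v s \<bullet> v s)) s =
            (g s * Dl l g s + Dl l g s * g s) - (1 / k\<^sup>2) * (v s \<bullet> Dl l v s + Dl l v s \<bullet> v s)" by (rule Dl_eqI[OF _ s l])
        moreover have "Dl l (\<lambda>s. g s * g s - (1 / k\<^sup>2) * (v s \<bullet> v s)) s = 0"
        proof (rule W1inf_constant_Dl_AE[OF _ l s])
          fix t
          have "v t \<bullet> v t = (k * g t)\<^sup>2" using vg[of t] by (simp add: dot_square_norm)
          then show "g t * g t - (1 / k\<^sup>2) * (v t \<bullet> v t) = 0" using k by (simp add: power2_eq_square)
        qed
        ultimately have gg: "k\<^sup>2 * (g s * Dl l g s) = v s \<bullet> Dl l v s" using k
          by (simp add: inner_commute field_simps)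
        have vT: "v s \<bullet> T s = 0" using qT[OF s] by (simp add: v_def)
        have "v s \<bullet> Dl l v s = k\<^sup>2 * (v s \<bullet> L)" unfolding dvs using vT by (simp add: inner_diff_right)
        also have "\<dots> = k\<^sup>2 * (g s * (\<alpha> s * (L \<bullet> D s)))" unfolding vs by (simp add: inner_commute)
        finally have dgs: "Dl l g s = \<alpha> s * (L \<bullet> D s)" using gg k False by simp
        have "v s \<bullet> D s = g s * (\<alpha> s * \<alpha> s * (D s \<bullet> D s)) / \<alpha> s" unfolding vs using \<alpha> by simp
        then have vD: "v s \<bullet> D s = g s * k\<^sup>2 / \<alpha> s" unfolding e .
        have "Dl l g s * \<alpha> s = k\<^sup>2 * ((L \<bullet> D s) / (D s \<bullet> D s))" unfolding e[symmetric] dgs using D0 by simp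
        then have "Dl l v s = (Dl l g s * \<alpha> s) *\<^sub>R D s
            - (g s * k\<^sup>2 / \<alpha> s) *\<^sub>R T s + k\<^sup>2 *\<^sub>R proj_perp (T s) (D s) L"
          unfolding dvs vD P by (simp add: scaleR_diff_right)
        then show ?thesis using dgs by simp
      qed
    qed
  qed
  have "strong_multiplier l \<alpha> T k L g v"
    unfolding strong_multiplier_def D_def[symmetric]
  proof (intro conjI gW vW Vf)
    show "AE s in lborel. s \<in> {0..l} \<longrightarrow> Dl l v s = (Dl l g s * \<alpha> s) *\<^sub>R D s
        - (g s * k\<^sup>2 / \<alpha> s) *\<^sub>R T s + k\<^sup>2 *\<^sub>R proj_perp (T s) (D s) L"
      using main by eventually_elim blast
    show "AE s in lborel. s \<in> {0..l} \<longrightarrow> Dl l g s = \<alpha> s * (L \<bullet> D s)"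
      using main by eventually_elim blast
  qed
  then show ?thesis by (simp add: L_def g_def[abs_def] v_def[abs_def] c_def)
qed

text \<open>The abnormal case: T stays in a fixed plane with constant \<open>\<alpha>|T'| = k\<close>. Any unit vector of that
  plane then serves as multiplier, with g made positive by an additive constant.\<close>
lemma strong_multiplier_of_planar_adjoint:
  assumes k: "k > 0" and qW: "W1inf l q" and qT: "\<And>s. s \<in> {0..l} \<Longrightarrow> q s \<bullet> T s = 0"
    and q0: "\<exists>s\<in>{0..l}. q s \<noteq> 0"
    and Sq: "\<And>s. s \<in> {0..l} \<Longrightarrow> C = wedge (q s) (T s)"
    and mp: "AE s in lborel. s \<in> {0..l} \<longrightarrow> norm (q s) *\<^sub>R (\<alpha> s *\<^sub>R D s) = - k *\<^sub>R q s"
    and dq: "AE s in lborel. s \<in> {0..l} \<longrightarrow> Dl l q s = - (q s \<bullet> D s) *\<^sub>R T s"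
  obtains g V where "strong_multiplier l \<alpha> T k T1 g V" "\<And>s. s \<in> {0..l} \<Longrightarrow> g s \<ge> 1"
proof -
  \<comment> \<open>\<open>q'\<close> is parallel to T while q is orthogonal to T, so |q| is
    constant.\<close>
  have "AE s in lborel. s \<in> {0..l} \<longrightarrow> Dl l (\<lambda>s. q s \<bullet> q s) s = 0"
    using W1inf_bounded_bilinear(2)[OF bounded_bilinear_inner qW qW l] dq
    by eventually_elim (auto simp: qT inner_commute)
  then have qq: "q s \<bullet> q s = q 0 \<bullet> q 0" if "s \<in> {0..l}" for s
    by (rule W1inf_constant_of_Dl_zero[OF W1inf_bounded_bilinear(1)[OF bounded_bilinear_inner qW qW l] l _ that])
  have nq: "norm (q s) = norm (q 0)" if "s \<in> {0..l}" for s
    using qq[OF that] by (simp only: norm_eq_sqrt_inner)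
  define c where "c = norm (q 0)"
  have c: "c > 0" using q0 nq unfolding c_def by (metis norm_eq_zero zero_less_norm_iff)
  define U where "U s = (- (k / c)) *\<^sub>R q s" for s
  have UW: "W1inf l U" unfolding U_def by (rule W1inf_scaleR_const[OF qW])
  have Uu: "AE s in lborel. s \<in> {0..l} \<longrightarrow> \<alpha> s *\<^sub>R D s = U s"
    using mp
  proof eventually_elim
    case (elim s)
    show ?case
    proof
      assume s: "s \<in> {0..l}"
      have "c *\<^sub>R (\<alpha> s *\<^sub>R D s) = - k *\<^sub>R q s" using elim s nq[OF s] by (simp add: c_def)
      then have "(1 / c) *\<^sub>R (c *\<^sub>R (\<alpha> s *\<^sub>R D s)) = (1 / c) *\<^sub>R (- k *\<^sub>R q s)" by simp
      then show "\<alpha> s *\<^sub>R D s = U s" using c by (simp add: U_def)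
    qed
  qed
  have nU: "norm (U s) = k" if "s \<in> {0..l}" for s
    using nq[OF that] k c by (simp add: U_def c_def)
  define w where "w s = \<alpha> s * (T1 \<bullet> D s)" for s
  have wL: "Linf l w" unfolding w_def by (intro Linf_mult Linf_inner \<alpha>L DL Linf_const)
  have cW: "continuous_on {0..l} (\<lambda>t. 0 + integral {0..t} w)"
    by (rule W1inf_continuous[OF indefinite_integral_W1inf(1)[OF wL l]])
  then have "bounded ((\<lambda>t. 0 + integral {0..t} w) ` {0..l})" using compact_continuous_image compact_imp_bounded by blast
  then obtain G where "\<forall>x\<in>(\<lambda>t. 0 + integral {0..t} w) ` {0..l}. norm x \<le> G" unfolding bounded_iff by blast
  then have G: "\<bar>integral {0..t} w\<bar> \<le> G" if "t \<in> {0..l}" for t using that by auto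
  define g where "g t = (G + 1) + integral {0..t} w" for t
  have gW: "W1inf l g" and dg: "AE s in lborel. s \<in> {0..l} \<longrightarrow> Dl l g s = w s"
    unfolding g_def[abs_def] by (rule indefinite_integral_W1inf[OF wL l])+
  have g1: "g s \<ge> 1" if "s \<in> {0..l}" for s using G[OF that] by (auto simp: g_def abs_le_iff)
  define V where "V s = g s *\<^sub>R U s" for s
  have VW: "W1inf l V" and dV: "AE s in lborel. s \<in> {0..l} \<longrightarrow> Dl l V s = g s *\<^sub>R Dl l U s + Dl l g s *\<^sub>R U s"
    unfolding V_def[abs_def] using W1inf_bounded_bilinear[OF bounded_bilinear_scaleR gW UW l] by blast+
  have strong: "AE s in lborel. s \<in> {0..l} \<longrightarrow> Dl l V s = (Dl l g s * \<alpha> s) *\<^sub>R D s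
        - (g s * k\<^sup>2 / \<alpha> s) *\<^sub>R T s + k\<^sup>2 *\<^sub>R proj_perp (T s) (D s) T1"
    using dV Uu dq TD W1inf_Dl_AE[OF qW l]
  proof eventually_elim
    case (elim s)
    show ?case
    proof
      assume s: "s \<in> {0..l}"
      have \<alpha>: "\<alpha> s > 0" by (rule \<alpha>_pos[OF s])
      have TDs: "T s \<bullet> D s = 0" using elim s by blast
      have us: "\<alpha> s *\<^sub>R D s = U s" using elim s by blast
      have "(\<alpha> s *\<^sub>R D s) \<bullet> (\<alpha> s *\<^sub>R D s) = k\<^sup>2" unfolding us using nU[OF s] by (simp add: dot_square_norm)
      then have e: "\<alpha> s * \<alpha> s * (D s \<bullet> D s) = k\<^sup>2" by (simp add: mult.assoc)
      then have D0: "D s \<bullet> D s \<noteq> 0" using k by auto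
      have "(U has_vector_derivative (- (k / c)) *\<^sub>R Dl l q s) (at s within {0..l})"
        unfolding U_def[abs_def] using elim s by (intro bounded_linear.has_vector_derivative[OF bounded_linear_scaleR_right]) blast
      then have "Dl l U s = (- (k / c)) *\<^sub>R Dl l q s" by (rule Dl_eqI[OF _ s l])
      also have "\<dots> = - (U s \<bullet> D s) *\<^sub>R T s" using elim s by (simp add: U_def)
      also have "U s \<bullet> D s = k\<^sup>2 / \<alpha> s"
        unfolding us[symmetric] e[symmetric] using \<alpha> by simp
      finally have dU: "Dl l U s = - (k\<^sup>2 / \<alpha> s) *\<^sub>R T s" .
      have P0: "proj_perp (T s) (D s) T1 = 0"
      proof -
        have z: "0 \<in> {0..l}" using l by simp
        \<comment> \<open>Applying the constant matrix, written at times 0 and s, to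
          \<open>q 0\<close> expresses T1 through \<open>q s\<close> and \<open>T s\<close>. Since
          \<open>q s\<close> is a multiple of \<open>D s\<close>, T1 lies in the span of
          \<open>T s\<close> and \<open>D s\<close>, where the projection vanishes.\<close>
        have "wedge (q 0) (T 0) *v q 0 = wedge (q s) (T s) *v q 0" using Sq[OF z] Sq[OF s] by simp
        then have "- (q 0 \<bullet> q 0) *\<^sub>R T1 = (T s \<bullet> q 0) *\<^sub>R q s - (q s \<bullet> q 0) *\<^sub>R T s"
          using qT[OF z] by (simp add: wedge_mult T0 inner_commute)
        then have "(- (1 / c\<^sup>2)) *\<^sub>R (- (c\<^sup>2) *\<^sub>R T1) = (- (1 / c\<^sup>2)) *\<^sub>R ((T s \<bullet> q 0) *\<^sub>R q s - (q s \<bullet> q 0) *\<^sub>R T s)"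
          by (simp add: c_def dot_square_norm)
        then have T1q: "T1 = (- (1 / c\<^sup>2)) *\<^sub>R ((T s \<bullet> q 0) *\<^sub>R q s - (q s \<bullet> q 0) *\<^sub>R T s)" using c by simp
        have "q s = (- (c / k)) *\<^sub>R U s" using c k by (simp add: U_def)
        then have "q s = (- (c / k) * \<alpha> s) *\<^sub>R D s" by (simp add: us[symmetric])
        then obtain x y where xy: "T1 = x *\<^sub>R D s + y *\<^sub>R T s"
          using T1q by (metis (no_types, lifting) scaleR_diff_right scaleR_scaleR diff_conv_add_uminus scaleR_minus_left)
        show ?thesis unfolding proj_perp_orthogonal[OF T_norm[OF s] TDs] xy
          using D0 TDs T_self[OF s] by (simp add: inner_add_left inner_add_right inner_commute)
      qed
      have "Dl l V s = g s *\<^sub>R Dl l U s + Dl l g s *\<^sub>R U s" using elim s by blast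
      then show "Dl l V s = (Dl l g s * \<alpha> s) *\<^sub>R D s
        - (g s * k\<^sup>2 / \<alpha> s) *\<^sub>R T s + k\<^sup>2 *\<^sub>R proj_perp (T s) (D s) T1"
        unfolding dU P0 us[symmetric] by simp
    qed
  qed
  have "strong_multiplier l \<alpha> T k T1 g V"
    unfolding strong_multiplier_def D_def[symmetric]
  proof (intro conjI gW VW strong)
    show "AE s in lborel. s \<in> {0..l} \<longrightarrow> V s = (g s * \<alpha> s) *\<^sub>R D s"
      using Uu
    proof eventually_elim
      case (elim s)
      then show ?case unfolding V_def by (metis scaleR_scaleR)
    qed
    show "AE s in lborel. s \<in> {0..l} \<longrightarrow> Dl l g s = \<alpha> s * (T1 \<bullet> D s)"
      using dg by (simp add: w_def)
  qed
  then show ?thesis using g1 by (rule that)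
qed

text \<open>\<open>adjoint_nonzero\<close> serves both cases: for lam \<noteq> 0 it makes g
  nontrivial, and for lam = 0 it makes the constant wedge matrix determine a plane.\<close>

lemma strong_multiplier_of_inf_elastica:
  assumes el: "inf_elastica l \<alpha> a1 a2 T1 T2 \<gamma>" and k: "k > 0"
  obtains lam g V where "norm lam = 1" "strong_multiplier l \<alpha> T k lam g V"
    "\<And>s. s \<in> {0..l} \<Longrightarrow> g s \<ge> 0" "\<exists>s\<in>{0..l}. g s \<noteq> 0"
proof (rule adjoint_exists[OF el k])
  fix lam mu q assume nz: "(lam, mu) \<noteq> (0, 0)" and muT: "mu \<bullet> T2 = 0" and qW: "W1inf l q"
    and qT: "\<And>s. s \<in> {0..l} \<Longrightarrow> q s \<bullet> T s = 0"
    and Sq: "\<And>s. s \<in> {0..l} \<Longrightarrow> wedge lam (\<gamma> l - \<gamma> s) + wedge mu T2 = wedge (q s) (T s)"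
    and mp: "AE s in lborel. s \<in> {0..l} \<longrightarrow> norm (q s) *\<^sub>R (\<alpha> s *\<^sub>R D s) = - k *\<^sub>R q s"
    and dq: "AE s in lborel. s \<in> {0..l} \<longrightarrow> Dl l q s = - (lam - (lam \<bullet> T s) *\<^sub>R T s) - (q s \<bullet> D s) *\<^sub>R T s"
  have q0: "\<exists>s\<in>{0..l}. q s \<noteq> 0" by (rule adjoint_nonzero[OF k nz muT Sq dq])
  show ?thesis
  proof (cases "lam = 0")
    case False
    show ?thesis
      by (rule that[OF _ strong_multiplier_of_adjoint[OF k False qW qT mp dq]])
         (use q0 k False in \<open>auto simp: norm_sgn\<close>)
  next
    case True
    have w: "wedge 0 x = 0" for x :: "real^'n" by (simp add: wedge_def vec_eq_iff)
    have dq': "AE s in lborel. s \<in> {0..l} \<longrightarrow> Dl l q s = - (q s \<bullet> D s) *\<^sub>R T s" using dq True by simp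
    have Sq': "\<And>s. s \<in> {0..l} \<Longrightarrow> wedge mu T2 = wedge (q s) (T s)" using Sq by (simp add: True w)
    obtain g V where gV: "strong_multiplier l \<alpha> T k T1 g V" "\<And>s. s \<in> {0..l} \<Longrightarrow> g s \<ge> 1"
      using strong_multiplier_of_planar_adjoint[OF k qW qT q0 Sq' mp dq'] by blast
    show ?thesis
    proof (rule that[OF T1 gV(1)])
      show "g s \<ge> 0" if "s \<in> {0..l}" for s using gV(2)[OF that] by simp
      show "\<exists>s\<in>{0..l}. g s \<noteq> 0" using gV(2)[of 0] l by (intro bexI[of _ 0]) auto
    qed
  qed
qed

text \<open>For k = 0 the weighted curvature bound forces \<open>T' = 0\<close> almost everywhere,
  so every term of the system vanishes and any unit vector would do.\<close>

lemma strong_multiplier_of_k_zero: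
  assumes k: "k = 0"
  shows "strong_multiplier l \<alpha> T k T1 (\<lambda>_. 1) (\<lambda>_. 0)"
proof -
  have D0: "AE s in lborel. s \<in> {0..l} \<longrightarrow> D s = 0"
    using k_AE
  proof eventually_elim
    case (elim s)
    then show ?case using \<alpha>_pos[of s] k by (auto simp: mult_le_0_iff)
  qed
  have c1: "Dl l (\<lambda>_. 1 :: real) s = 0" if "s \<in> {0..l}" for s by (rule W1inf_constant_Dl_AE[OF _ l that]) simp
  have c0: "Dl l (\<lambda>_. 0 :: real^'n) s = 0" if "s \<in> {0..l}" for s by (rule W1inf_constant_Dl_AE[OF _ l that]) simp
  show ?thesis unfolding strong_multiplier_def D_def[symmetric]
  proof (intro conjI W1inf_const)
    show "AE s in lborel. s \<in> {0..l} \<longrightarrow> 0 = (1 * \<alpha> s) *\<^sub>R D s" using D0 by eventually_elim auto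
    show "AE s in lborel. s \<in> {0..l} \<longrightarrow> Dl l (\<lambda>_. 0 :: real^'n) s = (Dl l (\<lambda>_. 1) s * \<alpha> s) *\<^sub>R D s
        - (1 * k\<^sup>2 / \<alpha> s) *\<^sub>R T s + k\<^sup>2 *\<^sub>R proj_perp (T s) (D s) T1"
      using D0 by eventually_elim (auto simp: c0 k)
    show "AE s in lborel. s \<in> {0..l} \<longrightarrow> Dl l (\<lambda>_. 1) s = \<alpha> s * (T1 \<bullet> D s)"
      using D0 by eventually_elim (auto simp: c1)
  qed
qed

theorem inf_elastica_iff_strong_multiplier:
  "inf_elastica l \<alpha> a1 a2 T1 T2 \<gamma> \<longleftrightarrow> (\<exists>lam g V. norm lam = 1 \<and> W1inf l g \<and>
     (\<forall>s\<in>{0..l}. g s \<ge> 0) \<and> (\<exists>s\<in>{0..l}. g s \<noteq> 0) \<and> strong_multiplier l \<alpha> T k lam g V)" (is "_ \<longleftrightarrow> ?R")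
proof (cases "k = 0")
  case True
  have ?R
    using strong_multiplier_of_k_zero[OF True] T1 l
    by (intro exI[of _ T1] exI[of _ "\<lambda>_. 1"] exI[of _ "\<lambda>_. 0"]) (auto intro: W1inf_const)
  then show ?thesis using inf_elastica_of_k_zero[OF True] by blast
next
  case False
  then have k: "k > 0" using k_nonneg by simp
  show ?thesis
  proof
    assume "inf_elastica l \<alpha> a1 a2 T1 T2 \<gamma>"
    then obtain lam g V where "norm lam = 1" "strong_multiplier l \<alpha> T k lam g V"
      "\<And>s. s \<in> {0..l} \<Longrightarrow> g s \<ge> 0" "\<exists>s\<in>{0..l}. g s \<noteq> 0"
      using strong_multiplier_of_inf_elastica[OF _ k] by blast
    then show ?R unfolding strong_multiplier_def by blast
  next
    assume ?R
    then show "inf_elastica l \<alpha> a1 a2 T1 T2 \<gamma>" using inf_elastica_of_strong_multiplier[OF _ k] by blast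
  qed
qed

end

theorem mainTheorem1:
  fixes l :: real and \<alpha> :: "real \<Rightarrow> real"
    and a1 a2 T1 T2 :: "real^'n" and \<gamma> :: "real \<Rightarrow> real^'n"
  assumes "CARD('n) \<ge> 2"
    and "l > 0"
    and "\<forall>s\<in>{0..l}. \<alpha> s > 0"
    and "bounded_variation_on \<alpha> 0 l"
    and "\<exists>C. \<forall>s\<in>{0..l}. 1 / \<alpha> s \<le> C"
    and "norm T1 = 1" and "norm T2 = 1"
    and "admissible l a1 a2 T1 T2 \<gamma>"
  shows "inf_elastica l \<alpha> a1 a2 T1 T2 \<gamma> \<longleftrightarrow>
    (let T = Dl l \<gamma>; T' = Dl l T; k = Kalpha l \<alpha> \<gamma> in
     \<exists>(lam::real^'n) (g::real \<Rightarrow> real).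
       norm lam = 1 \<and> W1inf l g \<and> (\<forall>s\<in>{0..l}. g s \<ge> 0) \<and> (\<exists>s\<in>{0..l}. g s \<noteq> 0) \<and>
       (\<forall>\<xi>::real \<Rightarrow> real^'n. test_fun l \<xi> \<longrightarrow>
          integral {0..l} (\<lambda>s. g s * \<alpha> s * (T' s \<bullet> vector_derivative \<xi> (at s))
              + Dl l g s * \<alpha> s * (T' s \<bullet> \<xi> s)
              - g s * k\<^sup>2 / \<alpha> s * (T s \<bullet> \<xi> s)
              + k\<^sup>2 * (proj_perp (T s) (T' s) lam \<bullet> \<xi> s)) = 0) \<and>
       (\<forall>\<phi>::real \<Rightarrow> real. test_fun l \<phi> \<longrightarrow>
          integral {0..l} (\<lambda>s. Dl l g s * \<phi> s - \<alpha> s * (lam \<bullet> T' s) * \<phi> s) = 0))"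
proof -
  obtain C where C: "\<And>s. s \<in> {0..l} \<Longrightarrow> 1 / \<alpha> s \<le> C" using assms(5) by blast
  have \<alpha>L: "Linf l \<alpha>" by (rule bounded_variation_on_Linf[OF assms(4,2)])
  have "Linf l (\<lambda>s. 1 / \<alpha> s)"
  proof (rule Linf_reciprocal[OF \<alpha>L])
    show "\<bar>1 / \<alpha> s\<bar> \<le> C" if "s \<in> {0..l}" for s using C[OF that] assms(3) that by (simp add: abs_of_pos)
  qed
  then interpret weighted_curve l \<alpha> a1 a2 T1 T2 \<gamma>
    by unfold_locales (use assms \<alpha>L in auto)
  have "inf_elastica l \<alpha> a1 a2 T1 T2 \<gamma> \<longleftrightarrow> (\<exists>lam g. norm lam = 1 \<and> W1inf l g \<and>
     (\<forall>s\<in>{0..l}. g s \<ge> 0) \<and> (\<exists>s\<in>{0..l}. g s \<noteq> 0) \<and> (\<exists>V. strong_multiplier l \<alpha> T k lam g V))"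
    unfolding inf_elastica_iff_strong_multiplier by blast
  also have "\<dots> \<longleftrightarrow> (\<exists>(lam::real^'n) (g::real \<Rightarrow> real). norm lam = 1 \<and> W1inf l g \<and>
     (\<forall>s\<in>{0..l}. g s \<ge> 0) \<and> (\<exists>s\<in>{0..l}. g s \<noteq> 0) \<and>
     ((\<forall>\<xi>::real \<Rightarrow> real^'n. test_fun l \<xi> \<longrightarrow>
          integral {0..l} (\<lambda>s. g s * \<alpha> s * (D s \<bullet> vector_derivative \<xi> (at s))
              + Dl l g s * \<alpha> s * (D s \<bullet> \<xi> s)
              - g s * k\<^sup>2 / \<alpha> s * (T s \<bullet> \<xi> s)
              + k\<^sup>2 * (proj_perp (T s) (D s) lam \<bullet> \<xi> s)) = 0) \<and>
       (\<forall>\<phi>::real \<Rightarrow> real. test_fun l \<phi> \<longrightarrow>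
          integral {0..l} (\<lambda>s. Dl l g s * \<phi> s - \<alpha> s * (lam \<bullet> D s) * \<phi> s) = 0)))"
    by (intro ex_cong1 conj_cong refl weak_iff_strong[symmetric])
  finally show ?thesis unfolding Let_def T_def D_def k_def .
qed

end
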